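(* Let $f:\mathbb S^1\times\mathbb R\to\mathbb R$ be smooth and let $F:B^1\to B^0$, $F(u)(t)=u'(t)+f(t,u(t))$. (a) If $f$ is proper and $D_2f(t,x)>0$ for all $(t,x)$, then $F$ is a diffeomorphism. (b) Assume $D_2f(t,x)>0$ for all $(t,x)$. Let $f_\pm(t)=\lim_{x\to\pm\infty}f(t,x)$. Then $F$ is a diffeomorphism from $B^1$ to the horizontal strip $$\mathcal S=\left\{v\in B^0:\int_{\mathbb S^1}f_-(t)\,dt<\int_{\mathbb S^1}v(t)\,dt<\int_{\mathbb S^1}f_+(t)\,dt\right\}.$$ (c) If $f$ is proper and strictly increasing in the second variable, then $F$ is a homeomorphism.
   Context: $\mathbb S^1=\mathbb R/\mathbb Z$. The pair $(B^1,B^0)$ is either $(H^1(\mathbb S^1;\mathbb R),L^2(\mathbb S^1;\mathbb R))$ or $(C^1(\mathbb S^1;\mathbb R),C^0(\mathbb S^1;\mathbb R))$; the result is asserted in both cases. $D_2f$ is the partial derivative in the second variable. In (b), the limits $f_\pm(t)$ and the integrals $\int f_+$, $\int f_-$ may be infinite: $f_+$ takes values in $(-\infty,+\infty]$, $f_-$ in $[-\infty,+\infty)$, and $\int f_+$ (resp. $\int f_-$) is interpreted as $+\infty$ (resp. $-\infty$) when divergent. *)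

theory Defs
  imports "HOL-Analysis.Analysis"
begin

section \<open>Smooth maps and diffeomorphisms between normed spaces\<close>

text \<open>
  A continuous \<open>k\<close>-linear map is represented by a function on lists of which only the values at
  lists of length \<open>k\<close> matter.
\<close>

definition bounded_multilinear ::
    "nat \<Rightarrow> ('a::real_normed_vector list \<Rightarrow> 'b::real_normed_vector) \<Rightarrow> bool" where
  "bounded_multilinear k L \<longleftrightarrow>
     (\<forall>vs ws. length vs + 1 + length ws = k \<longrightarrow> linear (\<lambda>h. L (vs @ h # ws))) \<and>
     (\<exists>C. \<forall>vs. length vs = k \<longrightarrow> norm (L vs) \<le> C * prod_list (map norm vs))"

text \<open>
  \<open>C\<^sup>\<infinity>\<close> in the sense of Frechet. The restriction of \<open>D x\<close> to lists of length \<open>k\<close> is the \<open>k\<close>-th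
  derivative of \<open>f\<close> at \<open>x\<close>; the last clause states that the \<open>k\<close>-th derivative, as a map from \<open>S\<close> into
  the continuous \<open>k\<close>-linear maps with the operator norm, is Frechet differentiable at \<open>x\<close> with
  derivative \<open>h \<mapsto> D x (h # _)\<close>.
\<close>

definition smooth_on ::
    "'a::real_normed_vector set \<Rightarrow> ('a \<Rightarrow> 'b::real_normed_vector) \<Rightarrow> bool" where
  "smooth_on S f \<longleftrightarrow> open S \<and>
     (\<exists>D :: 'a \<Rightarrow> 'a list \<Rightarrow> 'b.
        (\<forall>x\<in>S. D x [] = f x) \<and>
        (\<forall>x\<in>S. \<forall>k. bounded_multilinear k (D x)) \<and>
        (\<forall>x\<in>S. \<forall>k. \<forall>e>0. \<forall>\<^sub>F h in nhds 0. \<forall>vs. length vs = k \<longrightarrow>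
            norm (D (x + h) vs - D x vs - D x (h # vs)) \<le> e * norm h * prod_list (map norm vs)))"

definition diffeomorphism ::
    "'a::real_normed_vector set \<Rightarrow> 'b::real_normed_vector set \<Rightarrow> ('a \<Rightarrow> 'b) \<Rightarrow> ('b \<Rightarrow> 'a) \<Rightarrow> bool" where
  "diffeomorphism S T f g \<longleftrightarrow>
     smooth_on S f \<and> f ` S = T \<and> (\<forall>x\<in>S. g (f x) = x) \<and>
     smooth_on T g \<and> g ` T = S \<and> (\<forall>y\<in>T. f (g y) = y)"

lemma smooth_on_has_derivative:
  assumes "smooth_on S f"
  shows "\<exists>f'. (\<forall>x\<in>S. (f has_derivative f' x) (at x)) \<and> (\<forall>v. smooth_on S (\<lambda>x. f' x v))"
proof -
  from assms obtain D where S: "open S"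
    and D0: "\<And>x. x \<in> S \<Longrightarrow> D x [] = f x"
    and Dm: "\<And>x k. x \<in> S \<Longrightarrow> bounded_multilinear k (D x)"
    and Dd: "\<And>x k e. x \<in> S \<Longrightarrow> e > 0 \<Longrightarrow> \<forall>\<^sub>F h in nhds 0. \<forall>vs. length vs = k \<longrightarrow>
            norm (D (x + h) vs - D x vs - D x (h # vs)) \<le> e * norm h * prod_list (map norm vs)"
    unfolding smooth_on_def by blast
  define f' where "f' = (\<lambda>x h. D x [h])"
  have "(f has_derivative f' x) (at x)" if x: "x \<in> S" for x
  proof -
    have lin: "linear (f' x)"
    proof -
      have "\<forall>vs ws. length vs + 1 + length ws = 1 \<longrightarrow> linear (\<lambda>h. D x (vs @ h # ws))"
        using Dm[OF x, of 1] unfolding bounded_multilinear_def by (rule conjunct1)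
      from this[rule_format, of "[]" "[]"] show ?thesis by (simp add: f'_def)
    qed
    obtain C where "\<And>vs. length vs = 1 \<Longrightarrow> norm (D x vs) \<le> C * prod_list (map norm vs)"
      using Dm[OF x, of 1] unfolding bounded_multilinear_def by blast
    from this[of "[h]" for h] have C: "norm (f' x h) \<le> norm h * C" for h
      by (simp add: f'_def mult.commute)
    have bl: "bounded_linear (f' x)"
      using lin C by (auto simp: bounded_linear_def bounded_linear_axioms_def)
    have "\<exists>d>0. \<forall>y. norm (y - x) < d \<longrightarrow> norm (f y - f x - f' x (y - x)) \<le> e * norm (y - x)"
      if "e > 0" for e
    proof -
      have "\<forall>\<^sub>F h in nhds 0. norm (D (x + h) [] - D x [] - D x [h]) \<le> e * norm h"
        using Dd[OF x that, of 0] by eventually_elim auto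
      then obtain d1 where d1: "d1 > 0"
        "\<And>h. norm h < d1 \<Longrightarrow> norm (D (x + h) [] - D x [] - D x [h]) \<le> e * norm h"
        by (auto simp: eventually_nhds_metric dist_norm)
      obtain d2 where d2: "d2 > 0" "\<And>y. norm (y - x) < d2 \<Longrightarrow> y \<in> S"
        using S x by (auto simp: open_dist dist_norm)
      show ?thesis
      proof (intro exI[of _ "min d1 d2"] conjI allI impI)
        fix y assume "norm (y - x) < min d1 d2"
        then show "norm (f y - f x - f' x (y - x)) \<le> e * norm (y - x)"
          using d1(2)[of "y - x"] d2(2)[of y] D0 x by (simp add: f'_def)
      qed (use d1 d2 in auto)
    qed
    then show ?thesis
      using bl by (auto simp: has_derivative_at_alt)
  qed
  moreover have "smooth_on S (\<lambda>x. f' x v)" for v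
    unfolding smooth_on_def
  proof (intro conjI exI[of _ "\<lambda>x vs. D x (vs @ [v])"] ballI allI impI)
    show "open S" by (rule S)
    fix x assume x: "x \<in> S"
    show "D x ([] @ [v]) = f' x v" by (simp add: f'_def)
    fix k :: nat
    obtain C where C: "\<And>vs. length vs = Suc k \<Longrightarrow> norm (D x vs) \<le> C * prod_list (map norm vs)"
      using Dm[OF x, of "Suc k"] unfolding bounded_multilinear_def by blast
    have L: "linear (\<lambda>h. D x (vs @ h # ws))" if "length vs + 1 + length ws = Suc k" for vs ws
      using Dm[OF x, of "Suc k"] that unfolding bounded_multilinear_def by blast
    show "bounded_multilinear k (\<lambda>vs. D x (vs @ [v]))"
      unfolding bounded_multilinear_def
    proof (intro conjI allI impI exI[of _ "C * norm v"])
      fix vs ws :: "'a list" assume "length vs + 1 + length ws = k"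
      then show "linear (\<lambda>h. D x ((vs @ h # ws) @ [v]))"
        using L[of vs "ws @ [v]"] by simp
    next
      fix vs :: "'a list" assume "length vs = k"
      then show "norm (D x (vs @ [v])) \<le> C * norm v * prod_list (map norm vs)"
        using C[of "vs @ [v]"] by (simp add: mult_ac)
    qed
    fix e :: real assume "e > 0"
    define e' where "e' = e / (norm v + 1)"
    have nv: "norm v + 1 > 0" by (simp add: add_nonneg_pos)
    have e': "e' > 0" "e' * norm v \<le> e"
      using \<open>e > 0\<close> nv by (auto simp: e'_def divide_simps algebra_simps)
    show "\<forall>\<^sub>F h in nhds 0. \<forall>vs. length vs = k \<longrightarrow>
        norm (D (x + h) (vs @ [v]) - D x (vs @ [v]) - D x ((h # vs) @ [v]))
          \<le> e * norm h * prod_list (map norm vs)"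
      using Dd[OF x e'(1), of "Suc k"]
    proof eventually_elim
      case (elim h)
      show ?case
      proof (intro allI impI)
        fix vs :: "'a list" assume "length vs = k"
        then have "norm (D (x + h) (vs @ [v]) - D x (vs @ [v]) - D x (h # (vs @ [v])))
            \<le> e' * norm h * prod_list (map norm (vs @ [v]))"
          using elim[rule_format, of "vs @ [v]"] by (simp del: map_append)
        also have "\<dots> = (e' * norm v) * (norm h * prod_list (map norm vs))"
          by (simp add: mult_ac)
        also have "\<dots> \<le> e * (norm h * prod_list (map norm vs))"
          using e'(2) by (intro mult_right_mono mult_nonneg_nonneg prod_list_nonneg) auto
        finally show "norm (D (x + h) (vs @ [v]) - D x (vs @ [v]) - D x ((h # vs) @ [v]))
            \<le> e * norm h * prod_list (map norm vs)"
          by (simp add: mult_ac)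
      qed
    qed
  qed
  ultimately show ?thesis
    by (intro exI[of _ f'] conjI ballI allI)
qed

lemma smooth_on_imp_continuous_on:
  assumes "smooth_on S f"
  shows "continuous_on S f"
proof -
  obtain f' where
    "(\<forall>x\<in>S. (f has_derivative f' x) (at x)) \<and> (\<forall>v. smooth_on S (\<lambda>x. f' x v))"
    using smooth_on_has_derivative[OF assms] by (rule exE)
  then have "\<And>x. x \<in> S \<Longrightarrow> (f has_derivative f' x) (at x)" by simp
  then show ?thesis
    by (intro continuous_at_imp_continuous_on ballI) (rule has_derivative_continuous)
qed

lemma smooth_on_real:
  fixes p :: "nat \<Rightarrow> real \<Rightarrow> real"
  assumes d: "\<And>k x. (p k has_real_derivative p (Suc k) x) (at x)"
  shows "smooth_on UNIV (p 0)"
  unfolding smooth_on_def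
proof (intro conjI exI[of _ "\<lambda>x vs. p (length vs) x * prod_list vs"] ballI allI impI)
  have n: "\<bar>prod_list vs\<bar> = prod_list (map norm vs)" for vs :: "real list"
    by (induction vs) (auto simp: abs_mult)
  fix x :: real and k :: nat
  show "bounded_multilinear k (\<lambda>vs. p (length vs) x * prod_list vs)"
    unfolding bounded_multilinear_def
  proof (intro conjI allI impI exI[of _ "\<bar>p k x\<bar>"])
    fix vs ws :: "real list"
    show "linear (\<lambda>h. p (length (vs @ h # ws)) x * prod_list (vs @ h # ws))"
      by (intro linearI) (simp_all add: algebra_simps)
  next
    fix vs :: "real list" assume "length vs = k"
    then show "norm (p (length vs) x * prod_list vs) \<le> \<bar>p k x\<bar> * prod_list (map norm vs)"
      by (simp add: abs_mult n)
  qed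
  fix e :: real assume "e > 0"
  have "(p k has_derivative (\<lambda>h. p (Suc k) x * h)) (at x)"
    using d[of k x] by (simp add: has_field_derivative_def)
  then obtain r where r: "r > 0"
    "\<And>y. norm (y - x) < r \<Longrightarrow> norm (p k y - p k x - p (Suc k) x * (y - x)) \<le> e * norm (y - x)"
    using \<open>e > 0\<close> unfolding has_derivative_at_alt by blast
  have "\<forall>\<^sub>F h in nhds 0. norm (p k (x + h) - p k x - p (Suc k) x * h) \<le> e * norm h"
    unfolding eventually_nhds_metric dist_norm
    using r(1) r(2)[of "x + h" for h] by (intro exI[of _ r]) auto
  then show "\<forall>\<^sub>F h in nhds 0. \<forall>vs. length vs = k \<longrightarrow>
      norm (p (length vs) (x + h) * prod_list vs - p (length vs) x * prod_list vs -
            p (length (h # vs)) x * prod_list (h # vs)) \<le> e * norm h * prod_list (map norm vs)"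
  proof eventually_elim
    case (elim h)
    show ?case
    proof (intro allI impI)
      fix vs :: "real list" assume l: "length vs = k"
      have "p (length vs) (x + h) * prod_list vs - p (length vs) x * prod_list vs -
            p (length (h # vs)) x * prod_list (h # vs)
          = (p k (x + h) - p k x - p (Suc k) x * h) * prod_list vs"
        by (simp add: l algebra_simps)
      then show "norm (p (length vs) (x + h) * prod_list vs - p (length vs) x * prod_list vs -
            p (length (h # vs)) x * prod_list (h # vs)) \<le> e * norm h * prod_list (map norm vs)"
        using mult_right_mono[OF elim, of "\<bar>prod_list vs\<bar>"] by (simp add: abs_mult flip: n)
    qed
  qed
qed auto


section \<open>The circle\<close>

quotient_type circle = real / "\<lambda>x y::real. x - y \<in> \<int>"
  morphisms rep_circle circle_of
proof (rule equivpI)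
  show "reflp (\<lambda>x y::real. x - y \<in> \<int>)"
    by (simp add: reflp_def)
  show "symp (\<lambda>x y::real. x - y \<in> \<int>)"
    unfolding symp_def using Ints_minus by fastforce
  show "transp (\<lambda>x y::real. x - y \<in> \<int>)"
  proof (rule transpI)
    fix x y z :: real
    assume "x - y \<in> \<int>" "y - z \<in> \<int>"
    from Ints_add[OF this] show "x - z \<in> \<int>" by simp
  qed
qed

lemma circle_of_eq_iff: "circle_of x = circle_of y \<longleftrightarrow> x - y \<in> \<int>"
  by (rule circle.abs_eq_iff)

lemma circle_of_rep [simp]: "circle_of (rep_circle t) = t"
  by (rule Quotient3_abs_rep[OF Quotient3_circle])

lemma circle_of_add_int [simp]: "circle_of (x + of_int n) = circle_of x"
  by (simp add: circle_of_eq_iff)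

lemma circle_of_frac [simp]: "circle_of (frac x) = circle_of x"
  by (simp add: circle_of_eq_iff frac_def)

instantiation circle :: topological_space
begin

definition open_circle :: "circle set \<Rightarrow> bool" where
  "open_circle U \<longleftrightarrow> open (circle_of -` U)"

instance
  by standard (auto simp: open_circle_def vimage_Union)

end

lemma continuous_on_circle_of [continuous_intros]: "continuous_on A circle_of"
  by (rule continuous_on_subset[of UNIV])
     (auto simp: continuous_on_open_vimage open_circle_def)

lemma circle_of_continuous_iff:
  fixes u :: "circle \<Rightarrow> 'a::topological_space"
  shows "continuous_on UNIV u \<longleftrightarrow> continuous_on UNIV (\<lambda>s. u (circle_of s))"
  by (simp add: continuous_on_open_vimage open_circle_def vimage_def)

lemma circle_of_unit_interval: "circle_of ` {0..1} = UNIV"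
proof -
  have "t \<in> circle_of ` {0..1}" for t
  proof (rule image_eqI)
    show "t = circle_of (frac (rep_circle t))" by simp
    show "frac (rep_circle t) \<in> {0..1}"
      using frac_lt_1[of "rep_circle t"] by (simp add: less_imp_le)
  qed
  then show ?thesis by blast
qed

lemma compact_circle: "compact (UNIV :: circle set)"
  using compact_continuous_image[OF continuous_on_circle_of, of "{0..1}"]
  by (simp add: circle_of_unit_interval)

lemma open_circle_of_image:
  assumes "open A"
  shows "open (circle_of ` A)"
proof -
  have "circle_of -` (circle_of ` A) = (\<Union>n::int. (\<lambda>x. x + of_int n) ` A)"
  proof (intro equalityI subsetI)
    fix x assume "x \<in> circle_of -` (circle_of ` A)"
    then obtain a where a: "a \<in> A" "x - a \<in> \<int>"
      by (auto simp: circle_of_eq_iff)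
    then obtain n :: int where "x - a = of_int n" by (auto elim: Ints_cases)
    then have "x = a + of_int n" by simp
    with a show "x \<in> (\<Union>n::int. (\<lambda>x. x + of_int n) ` A)" by blast
  qed auto
  moreover have "open ((\<lambda>x. x + of_int n) ` A)" for n :: int
    using open_translation[OF assms, of "of_int n"] by (simp add: add.commute)
  ultimately show ?thesis
    unfolding open_circle_def by auto
qed

definition has_circle_derivative :: "(circle \<Rightarrow> real) \<Rightarrow> (circle \<Rightarrow> real) \<Rightarrow> bool" where
  "has_circle_derivative u u' \<longleftrightarrow>
     (\<forall>s. ((\<lambda>r. u (circle_of r)) has_real_derivative u' (circle_of s)) (at s))"

lemma has_circle_derivative_unique:
  assumes "has_circle_derivative u v" "has_circle_derivative u w"
  shows "v = w"
proof
  fix t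
  have "v (circle_of (rep_circle t)) = w (circle_of (rep_circle t))"
    using assms DERIV_unique unfolding has_circle_derivative_def by blast
  then show "v t = w t" by simp
qed

text \<open>
  Smoothness on the circle and on the cylinder is smoothness of the lift along the local
  diffeomorphism \<^const>\<open>circle_of\<close>.
\<close>

definition circle_smooth :: "(circle \<Rightarrow> real) \<Rightarrow> bool" where
  "circle_smooth u \<longleftrightarrow> smooth_on UNIV (\<lambda>s. u (circle_of s))"

definition cylinder_smooth :: "(circle \<times> real \<Rightarrow> real) \<Rightarrow> bool" where
  "cylinder_smooth f \<longleftrightarrow> smooth_on UNIV (\<lambda>(s, x). f (circle_of s, x))"

lemma cylinder_smooth_imp_continuous_on:
  assumes "cylinder_smooth f"
  shows "continuous_on UNIV f"
  unfolding continuous_on_open_vimage[OF open_UNIV] Int_UNIV_right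
proof (intro allI impI)
  fix B :: "real set" assume B: "open B"
  let ?g = "\<lambda>(s, x). f (circle_of s, x)"
  have "continuous_on UNIV ?g"
    using assms smooth_on_imp_continuous_on by (auto simp: cylinder_smooth_def)
  then have o: "open (?g -` B)"
    using B by (simp add: continuous_on_open_vimage)
  show "open (f -` B)"
  proof (subst open_subopen, intro ballI)
    fix p assume p: "p \<in> f -` B"
    obtain t x where tx: "p = (t, x)" by (cases p)
    have "(rep_circle t, x) \<in> ?g -` B" using p tx by simp
    then obtain U V where UV: "open U" "open V" "(rep_circle t, x) \<in> U \<times> V" "U \<times> V \<subseteq> ?g -` B"
      using o by (auto elim!: open_prod_elim)
    have "p \<in> circle_of ` U \<times> V"
      using UV(3) tx by (auto intro: image_eqI[of _ _ "rep_circle t"])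
    moreover have "circle_of ` U \<times> V \<subseteq> f -` B" using UV(4) by auto
    ultimately show "\<exists>T. open T \<and> p \<in> T \<and> T \<subseteq> f -` B"
      using open_Times[OF open_circle_of_image[OF UV(1)] UV(2)] by blast
  qed
qed

definition circle_measure :: "circle measure" where
  "circle_measure = distr (restrict_space lborel {0..<1}) borel circle_of"

lemma sets_circle_measure [simp, measurable_cong]: "sets circle_measure = sets borel"
  by (simp add: circle_measure_def)

lemma space_circle_measure [simp]: "space circle_measure = UNIV"
  by (simp add: circle_measure_def)

lemma borel_measurable_circle_of [measurable]: "circle_of \<in> borel_measurable borel"
  by (rule borel_measurable_continuous_onI) (rule continuous_on_circle_of)

lemma circle_of_measurable_restrict [measurable]:
  "circle_of \<in> measurable (restrict_space lborel {0..<1}) borel"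
  by (rule measurable_restrict_space1) simp

lemma finite_measure_circle: "finite_measure circle_measure"
proof (rule finite_measureI)
  have "emeasure circle_measure (space circle_measure)
      = emeasure (restrict_space lborel {0..<1}) (space (restrict_space lborel {0..<1::real}))"
    unfolding circle_measure_def by (subst emeasure_distr) auto
  also have "\<dots> = 1"
    by (subst emeasure_restrict_space) (auto simp: space_restrict_space)
  finally show "emeasure circle_measure (space circle_measure) \<noteq> \<infinity>" by simp
qed

interpretation circle_measure: finite_measure circle_measure
  by (rule finite_measure_circle)


section \<open>The spaces of continuous and of continuously differentiable functions\<close>

text \<open>
  As the circle is compact, \<^typ>\<open>circle \<Rightarrow>\<^sub>C real\<close> consists of all continuous functions; its norm is
  the supremum norm.
\<close>

type_synonym c0 = "circle \<Rightarrow>\<^sub>C real"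

lemma continuous_in_bcontfun:
  fixes u :: "circle \<Rightarrow> real"
  assumes "continuous_on UNIV u"
  shows "u \<in> bcontfun"
  using assms compact_imp_bounded[OF compact_continuous_image[OF assms compact_circle]]
  by (simp add: bcontfun_def)

typedef c1 = "{u :: c0. \<exists>u' :: c0. has_circle_derivative u u'}"
  morphisms c0_of_c1 c1_of_c0
  by (rule exI[of _ 0]) (auto simp: has_circle_derivative_def intro!: exI[of _ 0])

setup_lifting type_definition_c1

definition deriv_c1 :: "c1 \<Rightarrow> c0" where
  "deriv_c1 u = (THE u' :: c0. has_circle_derivative (c0_of_c1 u) u')"

lemma deriv_c1_unique:
  "has_circle_derivative (c0_of_c1 u) (apply_bcontfun v) \<Longrightarrow> deriv_c1 u = v"
  unfolding deriv_c1_def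
  by (rule the_equality) (auto intro!: bcontfun_eqI dest: has_circle_derivative_unique)

lemma deriv_c1: "has_circle_derivative (c0_of_c1 u) (deriv_c1 u)"
proof -
  obtain v :: c0 where "has_circle_derivative (c0_of_c1 u) v"
    using c0_of_c1[of u] by auto
  then show ?thesis using deriv_c1_unique by simp
qed

lemma has_circle_derivative_add:
  "has_circle_derivative u u' \<Longrightarrow> has_circle_derivative v v' \<Longrightarrow>
   has_circle_derivative (\<lambda>t. u t + v t) (\<lambda>t. u' t + v' t)"
  by (auto simp: has_circle_derivative_def intro!: derivative_eq_intros)

lemma has_circle_derivative_minus:
  "has_circle_derivative u u' \<Longrightarrow> has_circle_derivative (\<lambda>t. - u t) (\<lambda>t. - u' t)"
  by (auto simp: has_circle_derivative_def intro!: derivative_eq_intros)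

lemma has_circle_derivative_cmult:
  assumes "has_circle_derivative u u'"
  shows "has_circle_derivative (\<lambda>t. c * u t) (\<lambda>t. c * u' t)"
  using assms unfolding has_circle_derivative_def by (auto intro: DERIV_cmult)

instantiation c1 :: real_normed_vector
begin

lift_definition zero_c1 :: c1 is 0
  by (auto simp: has_circle_derivative_def intro!: exI[of _ 0])

lift_definition plus_c1 :: "c1 \<Rightarrow> c1 \<Rightarrow> c1" is "(+)"
proof -
  fix u v :: c0
  assume "\<exists>u' :: c0. has_circle_derivative u u'" "\<exists>v' :: c0. has_circle_derivative v v'"
  then obtain u' v' :: c0 where "has_circle_derivative u u'" "has_circle_derivative v v'" by blast
  from has_circle_derivative_add[OF this] show "\<exists>w :: c0. has_circle_derivative (u + v) w"
    by (intro exI[of _ "u' + v'"]) (simp add: plus_bcontfun.rep_eq)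
qed

lift_definition uminus_c1 :: "c1 \<Rightarrow> c1" is uminus
proof -
  fix u :: c0
  assume "\<exists>u' :: c0. has_circle_derivative u u'"
  then obtain u' :: c0 where "has_circle_derivative u u'" by blast
  from has_circle_derivative_minus[OF this] show "\<exists>w :: c0. has_circle_derivative (- u) w"
    by (intro exI[of _ "- u'"]) (simp add: uminus_bcontfun.rep_eq)
qed

lift_definition scaleR_c1 :: "real \<Rightarrow> c1 \<Rightarrow> c1" is scaleR
proof -
  fix c and u :: c0
  assume "\<exists>u' :: c0. has_circle_derivative u u'"
  then obtain u' :: c0 where "has_circle_derivative u u'" by blast
  from has_circle_derivative_cmult[OF this, of c]
  show "\<exists>w :: c0. has_circle_derivative (c *\<^sub>R u) w"
    by (intro exI[of _ "c *\<^sub>R u'"]) (simp add: scaleR_bcontfun.rep_eq)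
qed

definition minus_c1 :: "c1 \<Rightarrow> c1 \<Rightarrow> c1" where "minus_c1 u v = u + - v"

definition norm_c1 :: "c1 \<Rightarrow> real" where
  "norm_c1 u = norm (c0_of_c1 u) + norm (deriv_c1 u)"

definition dist_c1 :: "c1 \<Rightarrow> c1 \<Rightarrow> real" where "dist_c1 u v = norm (u - v)"

definition sgn_c1 :: "c1 \<Rightarrow> c1" where "sgn_c1 u = inverse (norm u) *\<^sub>R u"

definition uniformity_c1 :: "(c1 \<times> c1) filter" where
  "uniformity_c1 = (INF e\<in>{0<..}. principal {(u, v). dist u v < e})"

definition open_c1 :: "c1 set \<Rightarrow> bool" where
  "open_c1 S \<longleftrightarrow> (\<forall>u\<in>S. \<forall>\<^sub>F (v, w) in uniformity. v = u \<longrightarrow> w \<in> S)"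

lemma deriv_c1_add: "deriv_c1 (u + v) = deriv_c1 u + deriv_c1 v"
  using has_circle_derivative_add[OF deriv_c1[of u] deriv_c1[of v]]
  by (intro deriv_c1_unique) (simp add: plus_c1.rep_eq plus_bcontfun.rep_eq)

lemma deriv_c1_scaleR: "deriv_c1 (c *\<^sub>R u) = c *\<^sub>R deriv_c1 u"
  using has_circle_derivative_cmult[OF deriv_c1[of u], of c]
  by (intro deriv_c1_unique) (simp add: scaleR_c1.rep_eq scaleR_bcontfun.rep_eq)

instance
proof
  fix u v w :: c1 and a b :: real
  show "u + v + w = u + (v + w)" "u + v = v + u" "0 + u = u" "- u + u = 0"
    "a *\<^sub>R (u + v) = a *\<^sub>R u + a *\<^sub>R v" "(a + b) *\<^sub>R u = a *\<^sub>R u + b *\<^sub>R u"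
    "a *\<^sub>R b *\<^sub>R u = (a * b) *\<^sub>R u" "1 *\<^sub>R u = u"
    by (transfer; simp add: algebra_simps)+
  have "0 *\<^sub>R 0 = (0 :: c1)" by transfer simp
  then have "deriv_c1 0 = 0" using deriv_c1_scaleR[of 0 0] by simp
  moreover have "c0_of_c1 u = 0 \<longleftrightarrow> u = 0"
    using c0_of_c1_inject[of u 0] by (simp add: zero_c1.rep_eq)
  ultimately show "norm u = 0 \<longleftrightarrow> u = 0"
    by (auto simp: norm_c1_def add_nonneg_eq_0_iff)
  show "norm (u + v) \<le> norm u + norm v"
    using norm_triangle_ineq[of "c0_of_c1 u" "c0_of_c1 v"]
      norm_triangle_ineq[of "deriv_c1 u" "deriv_c1 v"]
    by (simp add: norm_c1_def deriv_c1_add plus_c1.rep_eq)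
  show "norm (a *\<^sub>R u) = \<bar>a\<bar> * norm u"
    by (simp add: norm_c1_def deriv_c1_scaleR scaleR_c1.rep_eq algebra_simps)
qed (auto simp: minus_c1_def dist_c1_def sgn_c1_def uniformity_c1_def open_c1_def)

end


section \<open>The space of square integrable functions\<close>

definition square_integrable :: "(circle \<Rightarrow> real) set" where
  "square_integrable =
     {u \<in> borel_measurable circle_measure. integrable circle_measure (\<lambda>t. (u t)\<^sup>2)}"

lemma square_integrable_measurable:
  "u \<in> square_integrable \<Longrightarrow> u \<in> borel_measurable circle_measure"
  by (simp add: square_integrable_def)

lemma square_integrable_mult:
  assumes "u \<in> square_integrable" "v \<in> square_integrable"
  shows "integrable circle_measure (\<lambda>t. u t * v t)"
proof (rule Bochner_Integration.integrable_bound)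
  show "integrable circle_measure (\<lambda>t. (u t)\<^sup>2 + (v t)\<^sup>2)"
    using assms by (simp add: square_integrable_def)
  have "\<bar>a * b\<bar> \<le> a\<^sup>2 + b\<^sup>2" for a b :: real
  proof -
    have "2 * (\<bar>a\<bar> * \<bar>b\<bar>) \<le> a\<^sup>2 + b\<^sup>2"
      using zero_le_power2[of "\<bar>a\<bar> - \<bar>b\<bar>"] by (simp add: power2_diff)
    moreover have "0 \<le> \<bar>a\<bar> * \<bar>b\<bar>" by simp
    ultimately show ?thesis unfolding abs_mult by linarith
  qed
  then show "AE t in circle_measure. norm (u t * v t) \<le> norm ((u t)\<^sup>2 + (v t)\<^sup>2)"
    by (intro always_eventually) simp
qed (use assms in \<open>auto intro!: borel_measurable_times simp: square_integrable_def\<close>)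

lemma square_integrable_add:
  assumes "u \<in> square_integrable" "v \<in> square_integrable"
  shows "(\<lambda>t. u t + v t) \<in> square_integrable"
proof -
  have "(\<lambda>t. (u t + v t)\<^sup>2) = (\<lambda>t. (u t)\<^sup>2 + (v t)\<^sup>2 + 2 * (u t * v t))"
    by (simp add: power2_sum mult.assoc)
  then show ?thesis
    using assms square_integrable_mult[OF assms]
    by (auto simp: square_integrable_def)
qed

lemma square_integrable_cmult:
  "u \<in> square_integrable \<Longrightarrow> (\<lambda>t. c * u t) \<in> square_integrable"
  by (auto simp: square_integrable_def power_mult_distrib)

lemma square_integrable_const: "(\<lambda>_. c) \<in> square_integrable"
  by (simp add: square_integrable_def)

lemma square_integrable_integrable:
  "u \<in> square_integrable \<Longrightarrow> integrable circle_measure u"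
  using square_integrable_mult[OF _ square_integrable_const[of 1]] by simp

quotient_type l2 = "circle \<Rightarrow> real" / partial:
    "\<lambda>u v. u \<in> square_integrable \<and> v \<in> square_integrable \<and> (AE t in circle_measure. u t = v t)"
  morphisms rep_l2 abs_l2
proof (rule part_equivpI)
  show "\<exists>u. u \<in> square_integrable \<and> u \<in> square_integrable \<and> (AE t in circle_measure. u t = u t)"
    using square_integrable_const[of 0] by auto
  show "symp (\<lambda>u v. u \<in> square_integrable \<and> v \<in> square_integrable \<and>
                    (AE t in circle_measure. u t = v t))"
    by (auto simp: symp_def elim: eventually_mono)
  show "transp (\<lambda>u v. u \<in> square_integrable \<and> v \<in> square_integrable \<and>
                      (AE t in circle_measure. u t = v t))"
    unfolding transp_def
  proof (intro allI impI conjI; elim conjE)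
    fix u v w :: "circle \<Rightarrow> real"
    assume "AE t in circle_measure. u t = v t" "AE t in circle_measure. v t = w t"
    then show "AE t in circle_measure. u t = w t" by eventually_elim simp
  qed auto
qed

lemma rep_l2 [simp, intro]: "rep_l2 u \<in> square_integrable"
  using Quotient3_rep_reflp[OF Quotient3_l2, of u] by simp

lemma abs_rep_l2 [simp]: "abs_l2 (rep_l2 u) = u"
  by (rule Quotient3_abs_rep[OF Quotient3_l2])

lemma abs_l2_eq_iff:
  assumes "u \<in> square_integrable" "v \<in> square_integrable"
  shows "abs_l2 u = abs_l2 v \<longleftrightarrow> (AE t in circle_measure. u t = v t)"
  using Quotient3_rel[OF Quotient3_l2, of u v] assms by simp

lemma rep_abs_l2:
  assumes "u \<in> square_integrable"
  shows "AE t in circle_measure. rep_l2 (abs_l2 u) t = u t"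
  using abs_l2_eq_iff[of "rep_l2 (abs_l2 u)" u] assms by simp

lemma l2_eqI:
  assumes "AE t in circle_measure. rep_l2 u t = rep_l2 v t"
  shows "u = v"
  using abs_l2_eq_iff[of "rep_l2 u" "rep_l2 v"] assms by simp

lemma rep_l2_measurable [measurable]: "rep_l2 u \<in> borel_measurable circle_measure"
  using square_integrable_measurable by blast

instantiation l2 :: real_inner
begin

definition zero_l2 :: l2 where "0 = abs_l2 (\<lambda>_. 0)"

definition plus_l2 :: "l2 \<Rightarrow> l2 \<Rightarrow> l2" where
  "u + v = abs_l2 (\<lambda>t. rep_l2 u t + rep_l2 v t)"

definition scaleR_l2 :: "real \<Rightarrow> l2 \<Rightarrow> l2" where
  "c *\<^sub>R u = abs_l2 (\<lambda>t. c * rep_l2 u t)"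

definition uminus_l2 :: "l2 \<Rightarrow> l2" where "- u = (-1) *\<^sub>R (u :: l2)"

definition minus_l2 :: "l2 \<Rightarrow> l2 \<Rightarrow> l2" where "u - v = u + - (v :: l2)"

definition inner_l2 :: "l2 \<Rightarrow> l2 \<Rightarrow> real" where
  "inner u v = (\<integral>t. rep_l2 u t * rep_l2 v t \<partial>circle_measure)"

definition norm_l2 :: "l2 \<Rightarrow> real" where "norm u = sqrt (inner u (u :: l2))"

definition dist_l2 :: "l2 \<Rightarrow> l2 \<Rightarrow> real" where "dist u v = norm (u - v :: l2)"

definition sgn_l2 :: "l2 \<Rightarrow> l2" where "sgn u = inverse (norm u) *\<^sub>R (u :: l2)"

definition uniformity_l2 :: "(l2 \<times> l2) filter" where
  "uniformity_l2 = (INF e\<in>{0<..}. principal {(u, v). dist u v < e})"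

definition open_l2 :: "l2 set \<Rightarrow> bool" where
  "open_l2 S \<longleftrightarrow> (\<forall>u\<in>S. \<forall>\<^sub>F (v, w) in uniformity. v = u \<longrightarrow> w \<in> S)"

lemma rep_l2_zero: "AE t in circle_measure. rep_l2 0 t = 0"
  unfolding zero_l2_def by (rule rep_abs_l2) (rule square_integrable_const)

lemma rep_l2_plus: "AE t in circle_measure. rep_l2 (u + v) t = rep_l2 u t + rep_l2 v t"
  unfolding plus_l2_def by (rule rep_abs_l2) (simp add: square_integrable_add)

lemma rep_l2_scaleR: "AE t in circle_measure. rep_l2 (c *\<^sub>R u) t = c * rep_l2 u t"
  unfolding scaleR_l2_def by (rule rep_abs_l2) (simp add: square_integrable_cmult)

lemma rep_l2_uminus: "AE t in circle_measure. rep_l2 (- u) t = - rep_l2 u t"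
  using rep_l2_scaleR[of "-1" u] unfolding uminus_l2_def by simp

instance
proof
  fix u v w :: l2 and a b :: real
  show "u + v + w = u + (v + w)"
    by (rule l2_eqI)
       (use rep_l2_plus[of "u + v" w] rep_l2_plus[of u v] rep_l2_plus[of u "v + w"]
          rep_l2_plus[of v w] in \<open>eventually_elim, simp\<close>)
  show "u + v = v + u"
    by (simp add: plus_l2_def add.commute)
  show "0 + u = u"
    by (rule l2_eqI) (use rep_l2_plus[of 0 u] rep_l2_zero in \<open>eventually_elim, simp\<close>)
  show "- u + u = 0"
    by (rule l2_eqI)
       (use rep_l2_plus[of "- u" u] rep_l2_zero rep_l2_uminus[of u] in \<open>eventually_elim, simp\<close>)
  show "u - v = u + - v" by (rule minus_l2_def)
  show "a *\<^sub>R (u + v) = a *\<^sub>R u + a *\<^sub>R v"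
    by (rule l2_eqI)
       (use rep_l2_plus[of u v] rep_l2_scaleR[of a "u + v"] rep_l2_scaleR[of a u]
          rep_l2_scaleR[of a v] rep_l2_plus[of "a *\<^sub>R u" "a *\<^sub>R v"]
        in \<open>eventually_elim, simp add: algebra_simps\<close>)
  show "(a + b) *\<^sub>R u = a *\<^sub>R u + b *\<^sub>R u"
    by (rule l2_eqI)
       (use rep_l2_scaleR[of "a + b" u] rep_l2_scaleR[of a u]
          rep_l2_scaleR[of b u] rep_l2_plus[of "a *\<^sub>R u" "b *\<^sub>R u"]
        in \<open>eventually_elim, simp add: algebra_simps\<close>)
  show "a *\<^sub>R b *\<^sub>R u = (a * b) *\<^sub>R u"
    by (rule l2_eqI)
       (use rep_l2_scaleR[of "a * b" u] rep_l2_scaleR[of a "b *\<^sub>R u"] rep_l2_scaleR[of b u]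
        in \<open>eventually_elim, simp add: algebra_simps\<close>)
  show "1 *\<^sub>R u = u"
    by (rule l2_eqI) (use rep_l2_scaleR[of 1 u] in \<open>eventually_elim, simp\<close>)
  show "inner u v = inner v u"
    by (simp add: inner_l2_def mult.commute)
  show "inner (u + v) w = inner u w + inner v w"
  proof -
    have "inner (u + v) w
        = (\<integral>t. rep_l2 u t * rep_l2 w t + rep_l2 v t * rep_l2 w t \<partial>circle_measure)"
      unfolding inner_l2_def
      by (rule integral_cong_AE; (measurable)?)
         (use rep_l2_plus[of u v] in \<open>eventually_elim, simp add: algebra_simps\<close>)
    then show ?thesis
      by (simp add: inner_l2_def square_integrable_mult)
  qed
  show "inner (a *\<^sub>R u) v = a * inner u v"
  proof -
    have "inner (a *\<^sub>R u) v = (\<integral>t. a * (rep_l2 u t * rep_l2 v t) \<partial>circle_measure)"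
      unfolding inner_l2_def
      by (rule integral_cong_AE; (measurable)?)
         (use rep_l2_scaleR[of a u] in \<open>eventually_elim, simp add: algebra_simps\<close>)
    then show ?thesis
      by (simp add: inner_l2_def)
  qed
  show "0 \<le> inner u u"
    by (simp add: inner_l2_def)
  show "inner u u = 0 \<longleftrightarrow> u = 0"
  proof -
    have "inner u u = 0 \<longleftrightarrow> (AE t in circle_measure. rep_l2 u t * rep_l2 u t = 0)"
      unfolding inner_l2_def
      by (rule integral_nonneg_eq_0_iff_AE) (simp_all add: square_integrable_mult)
    also have "\<dots> \<longleftrightarrow> (AE t in circle_measure. rep_l2 u t = 0)" by simp
    also have "\<dots> \<longleftrightarrow> u = 0"
      using abs_l2_eq_iff[OF rep_l2[of u] square_integrable_const[of 0]]
      by (simp add: zero_l2_def)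
    finally show ?thesis .
  qed
qed (auto simp: dist_l2_def sgn_l2_def uniformity_l2_def open_l2_def norm_l2_def)

end


section \<open>The Sobolev space\<close>

definition weak_derivative :: "l2 \<Rightarrow> l2 \<Rightarrow> bool" where
  "weak_derivative u g \<longleftrightarrow>
     (\<forall>\<phi> \<phi>'. circle_smooth \<phi> \<and> has_circle_derivative \<phi> \<phi>' \<longrightarrow>
        (\<integral>t. rep_l2 u t * \<phi>' t \<partial>circle_measure) = - (\<integral>t. rep_l2 g t * \<phi> t \<partial>circle_measure))"

text \<open>
  Uniqueness of weak derivatives: test functions of the following form approximate the
  characteristic functions of arcs.
\<close>

inductive_set test_gen :: "(real \<Rightarrow> real) set" where
  const: "(\<lambda>_. c) \<in> test_gen"
| cos: "(\<lambda>s. cos (2 * pi * s + c)) \<in> test_gen"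
| tanh: "(\<lambda>s. tanh (n * (cos (2 * pi * s + c) - r))) \<in> test_gen"
| add: "p \<in> test_gen \<Longrightarrow> q \<in> test_gen \<Longrightarrow> (\<lambda>s. p s + q s) \<in> test_gen"
| mult: "p \<in> test_gen \<Longrightarrow> q \<in> test_gen \<Longrightarrow> (\<lambda>s. p s * q s) \<in> test_gen"

lemma test_gen_deriv:
  "p \<in> test_gen \<Longrightarrow> \<exists>q\<in>test_gen. \<forall>x. (p has_real_derivative q x) (at x)"
proof (induction rule: test_gen.induct)
  case (const c)
  show ?case by (rule bexI[OF _ test_gen.const[of 0]]) simp
next
  case (cos c)
  have m: "(\<lambda>s. 2 * pi * cos (2 * pi * s + (c + pi / 2))) \<in> test_gen"
    by (intro test_gen.intros)
  have "\<forall>x. ((\<lambda>s. cos (2 * pi * s + c)) has_real_derivative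
      2 * pi * cos (2 * pi * x + (c + pi / 2))) (at x)"
  proof
    fix x
    have "cos (2 * pi * x + (c + pi / 2)) = - sin (2 * pi * x + c)"
      using cos_add[of "2 * pi * x + c" "pi / 2"] by (simp add: add.assoc)
    then show "((\<lambda>s. cos (2 * pi * s + c)) has_real_derivative
      2 * pi * cos (2 * pi * x + (c + pi / 2))) (at x)" by (auto intro!: derivative_eq_intros)
  qed
  then show ?case using m by (rule bexI)
next
  case (tanh n c r)
  let ?t = "\<lambda>s. tanh (n * (cos (2 * pi * s + c) - r))"
  have m: "(\<lambda>s. (1 + (-1) * (?t s * ?t s)) * (n * (2 * pi * cos (2 * pi * s + (c + pi / 2)))))
      \<in> test_gen"
    by (intro test_gen.intros)
  have "\<forall>x. (?t has_real_derivative
      (1 + (-1) * (?t x * ?t x)) * (n * (2 * pi * cos (2 * pi * x + (c + pi / 2))))) (at x)"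
  proof
    fix x
    have "cos (2 * pi * x + (c + pi / 2)) = - sin (2 * pi * x + c)"
      using cos_add[of "2 * pi * x + c" "pi / 2"] by (simp add: add.assoc)
    moreover have "cosh y \<noteq> 0" for y :: real
      using cosh_real_pos[of y] by simp
    ultimately show "(?t has_real_derivative
      (1 + (-1) * (?t x * ?t x)) * (n * (2 * pi * cos (2 * pi * x + (c + pi / 2))))) (at x)"
      by (auto intro!: derivative_eq_intros simp: power2_eq_square algebra_simps)
  qed
  then show ?case using m by (rule bexI)
next
  case (add p q)
  then obtain p' q' where "p' \<in> test_gen" "q' \<in> test_gen"
    "\<And>x. (p has_real_derivative p' x) (at x)" "\<And>x. (q has_real_derivative q' x) (at x)"
    by blast
  then show ?case
    by (intro bexI[of _ "\<lambda>x. p' x + q' x"]) (auto intro: test_gen.intros DERIV_add)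
next
  case (mult p q)
  then obtain p' q' where "p' \<in> test_gen" "q' \<in> test_gen"
    "\<And>x. (p has_real_derivative p' x) (at x)" "\<And>x. (q has_real_derivative q' x) (at x)"
    by blast
  then show ?case using mult
    by (intro bexI[of _ "\<lambda>x. p' x * q x + q' x * p x"]) (auto intro!: test_gen.intros DERIV_mult)
qed

lemma test_gen_smooth:
  assumes "p \<in> test_gen"
  shows "smooth_on UNIV p"
proof -
  from test_gen_deriv obtain d where
    d: "\<And>p. p \<in> test_gen \<Longrightarrow> d p \<in> test_gen"
       "\<And>p x. p \<in> test_gen \<Longrightarrow> (p has_real_derivative d p x) (at x)"
    by metis
  have *: "(d ^^ k) p \<in> test_gen" for k
    by (induction k) (auto simp: assms d)
  show ?thesis
    using smooth_on_real[of "\<lambda>k. (d ^^ k) p"] d(2)[OF *] by simp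
qed

lemma test_gen_periodic:
  "p \<in> test_gen \<Longrightarrow> p (s + of_int n) = p s"
proof (induction arbitrary: s rule: test_gen.induct)
  case (cos c)
  have "cos (2 * pi * (s + of_int n) + c) = cos ((2 * pi * s + c) + 2 * pi * of_int n)"
    by (simp add: algebra_simps)
  then show ?case by (simp add: cos_add)
next
  case (tanh m c r)
  have "cos (2 * pi * (s + of_int n) + c) = cos ((2 * pi * s + c) + 2 * pi * of_int n)"
    by (simp add: algebra_simps)
  then show ?case by (simp add: cos_add)
qed auto

lemma test_gen_rep_circle:
  assumes "p \<in> test_gen"
  shows "p (rep_circle (circle_of s)) = p s"
proof -
  have "rep_circle (circle_of s) - s \<in> \<int>"
    by (simp add: circle_of_eq_iff[symmetric])
  then obtain n :: int where "rep_circle (circle_of s) - s = of_int n" by (auto elim: Ints_cases)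
  then have "rep_circle (circle_of s) = s + of_int n" by simp
  then show ?thesis using test_gen_periodic[OF assms] by simp
qed

lemma weak_derivative_test_gen:
  assumes "weak_derivative u g" "weak_derivative u h" "p \<in> test_gen"
  shows "(\<integral>t. rep_l2 g t * p (rep_circle t) \<partial>circle_measure)
       = (\<integral>t. rep_l2 h t * p (rep_circle t) \<partial>circle_measure)"
proof -
  obtain q where q: "q \<in> test_gen" "\<And>x. (p has_real_derivative q x) (at x)"
    using test_gen_deriv[OF assms(3)] by blast
  have "circle_smooth (\<lambda>t. p (rep_circle t))"
    by (simp add: circle_smooth_def test_gen_rep_circle assms test_gen_smooth)
  moreover have "has_circle_derivative (\<lambda>t. p (rep_circle t)) (\<lambda>t. q (rep_circle t))"
    by (simp add: has_circle_derivative_def test_gen_rep_circle assms q)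
  ultimately show ?thesis
    using assms(1,2) unfolding weak_derivative_def by fastforce
qed

lemma weak_derivative_unique:
  assumes "weak_derivative u g" "weak_derivative u h"
  shows "g = h"
proof (rule l2_eqI)
  let ?N = "restrict_space lborel {0..<1::real}"
  define w where "w = (\<lambda>t. rep_l2 g t - rep_l2 h t)"
  have wI: "integrable circle_measure w"
    unfolding w_def by (intro Bochner_Integration.integrable_diff square_integrable_integrable) auto
  define W where "W = (\<lambda>s. w (circle_of s))"
  have wm: "w \<in> borel_measurable borel"
    using borel_measurable_integrable[OF wI] by simp
  have WI: "integrable ?N W"
    using wI wm unfolding circle_measure_def W_def by (subst (asm) integrable_distr_eq) auto
  have pm: "p \<in> borel_measurable borel" if "p \<in> test_gen" for p
    using smooth_on_imp_continuous_on[OF test_gen_smooth[OF that]]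
    by (rule borel_measurable_continuous_onI)
  have pm': "(\<lambda>t. p (rep_circle t)) \<in> borel_measurable borel" if "p \<in> test_gen" for p
    using smooth_on_imp_continuous_on[OF test_gen_smooth[OF that]]
    by (intro borel_measurable_continuous_onI)
       (simp add: circle_of_continuous_iff test_gen_rep_circle that)
  have bdd: "\<exists>C. \<forall>t. \<bar>p (rep_circle t)\<bar> \<le> C" if "p \<in> test_gen" for p
  proof -
    have "continuous_on UNIV (\<lambda>t. p (rep_circle t))"
      using smooth_on_imp_continuous_on[OF test_gen_smooth[OF that]]
      by (simp add: circle_of_continuous_iff test_gen_rep_circle that)
    from compact_imp_bounded[OF compact_continuous_image[OF this compact_circle]]
    show ?thesis by (auto simp: bounded_iff)
  qed
  have test: "(\<integral>s. W s * p s \<partial>?N) = 0" if p: "p \<in> test_gen" for p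
  proof -
    obtain C where C: "\<And>t. \<bar>p (rep_circle t)\<bar> \<le> C" using bdd[OF p] by blast
    have I: "integrable circle_measure (\<lambda>t. rep_l2 v t * p (rep_circle t))" for v
    proof (rule Bochner_Integration.integrable_bound)
      show "integrable circle_measure (\<lambda>t. C * rep_l2 v t)"
        by (simp add: square_integrable_integrable)
      have "\<bar>x * p (rep_circle t)\<bar> \<le> \<bar>C * x\<bar>" for x t
        using mult_left_mono[OF C[of t], of "\<bar>x\<bar>"] C[of t]
        by (simp add: abs_mult mult.commute)
      then show "AE t in circle_measure. norm (rep_l2 v t * p (rep_circle t))
          \<le> norm (C * rep_l2 v t)"
        by simp
    qed (use pm'[OF p] in measurable)
    have "0 = (\<integral>t. w t * p (rep_circle t) \<partial>circle_measure)"
      using weak_derivative_test_gen[OF assms p] I by (simp add: w_def left_diff_distrib)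
    also have "\<dots> = (\<integral>s. w (circle_of s) * p (rep_circle (circle_of s)) \<partial>?N)"
      unfolding circle_measure_def
      by (rule integral_distr) (use wm pm'[OF p] in measurable)
    finally show ?thesis by (simp add: W_def test_gen_rep_circle p)
  qed
  have total: "(\<integral>s. W s \<partial>?N) = 0"
    using test[OF test_gen.const[of 1]] by simp
  have arc: "set_lebesgue_integral ?N ({..a} \<inter> {0..<1}) W = 0" for a
  proof -
    consider "a < 0" | "a \<ge> 1" | "0 \<le> a" "a < 1" by linarith
    then show ?thesis
    proof cases
      case 1
      then have e: "{..a} \<inter> {0..<1} = {}" by auto
      show ?thesis unfolding e by (simp add: set_lebesgue_integral_def)
    next
      case 2
      then have "{..a} \<inter> {0..<1} = {0..<1}" by auto
      then have "set_lebesgue_integral ?N ({..a} \<inter> {0..<1}) W = (\<integral>s. W s \<partial>?N)"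
        unfolding set_lebesgue_integral_def
        by (intro Bochner_Integration.integral_cong) (auto simp: space_restrict_space)
      then show ?thesis using total by simp
    next
      case 3
      define q where "q = (\<lambda>s. cos (2 * pi * s + - (pi * a)) - cos (pi * a))"
      define P where "P = (\<lambda>n::nat. \<lambda>s. 1/2 * (1 + tanh (real n * q s)))"
      have P: "P n \<in> test_gen" for n
        unfolding P_def q_def by (intro test_gen.intros)
      have q_eq: "q s = 2 * (sin (pi * s) * sin (pi * (a - s)))" for s
      proof -
        have "(2 * pi * s + - (pi * a) + pi * a) / 2 = pi * s"
          "(pi * a - (2 * pi * s + - (pi * a))) / 2 = pi * (a - s)"
          by (simp_all add: field_simps)
        then show ?thesis unfolding q_def cos_diff_cos by (simp only: mult.assoc)
      qed
      have lim: "(\<lambda>n. P n s) \<longlonglongrightarrow> indicator ({..a} \<inter> {0..<1}) s"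
        if s: "0 < s" "s < 1" "s \<noteq> a" for s
      proof (cases "s < a")
        case True
        have "sin (pi * s) > 0" using s by (intro sin_gt_zero) auto
        moreover have "sin (pi * (a - s)) > 0" using s True 3 by (intro sin_gt_zero) auto
        ultimately have "q s > 0" by (simp add: q_eq)
        then have "filterlim (\<lambda>n. real n * q s) at_top sequentially"
          by (intro filterlim_at_top_mult_tendsto_pos[OF tendsto_const _ filterlim_real_sequentially])
        then have "(\<lambda>n. tanh (real n * q s)) \<longlonglongrightarrow> 1"
          by (rule filterlim_compose[OF tanh_real_at_top])
        then have "(\<lambda>n. P n s) \<longlonglongrightarrow> 1/2 * (1 + 1)"
          unfolding P_def by (intro tendsto_intros)
        then show ?thesis using s True by simp
      next
        case False
        have "sin (pi * s) > 0" using s by (intro sin_gt_zero) auto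
        moreover have "sin (pi * (s - a)) > 0" using s False 3 by (intro sin_gt_zero) auto
        then have "sin (pi * (a - s)) < 0"
          using sin_minus[of "pi * (s - a)"] by (simp add: algebra_simps)
        ultimately have "- q s > 0" by (simp add: q_eq mult_pos_neg)
        then have "filterlim (\<lambda>n. real n * (- q s)) at_top sequentially"
          by (intro filterlim_at_top_mult_tendsto_pos[OF tendsto_const _ filterlim_real_sequentially])
        then have "(\<lambda>n. tanh (real n * (- q s))) \<longlonglongrightarrow> 1"
          by (rule filterlim_compose[OF tanh_real_at_top])
        then have "(\<lambda>n. - tanh (real n * (- q s))) \<longlonglongrightarrow> - 1"
          by (rule tendsto_minus)
        then have "(\<lambda>n. P n s) \<longlonglongrightarrow> 1/2 * (1 + (- 1))"
          unfolding P_def by (intro tendsto_intros) simp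
        then show ?thesis using s False by simp
      qed
      have "(\<lambda>n. \<integral>s. W s * P n s \<partial>?N)
          \<longlonglongrightarrow> (\<integral>s. W s * indicator ({..a} \<inter> {0..<1}) s \<partial>?N)"
      proof (rule integral_dominated_convergence)
        show "integrable ?N (\<lambda>s. \<bar>W s\<bar>)" using WI by simp
        have "AE s in lborel. s \<noteq> 0 \<and> s \<noteq> a"
          using AE_lborel_singleton[of 0] AE_lborel_singleton[of a] by eventually_elim simp
        then have "AE s in ?N. s \<noteq> 0 \<and> s \<noteq> a"
          by (subst AE_restrict_space_iff) auto
        moreover have "AE s in ?N. s \<in> {0..<1}"
          by (rule AE_I2) (simp add: space_restrict_space)
        ultimately show "AE s in ?N. (\<lambda>n. W s * P n s)
            \<longlonglongrightarrow> W s * indicator ({..a} \<inter> {0..<1}) s"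
          by eventually_elim (intro tendsto_mult_left lim, auto)
        have "\<bar>P n s\<bar> \<le> 1" for n s
          unfolding P_def using tanh_real_lt_1[of "real n * q s"] tanh_real_gt_neg1[of "real n * q s"]
          by (simp add: abs_le_iff)
        then show "AE s in ?N. norm (W s * P n s) \<le> \<bar>W s\<bar>" for n
          by (intro AE_I2) (simp add: abs_mult mult_left_le)
        show "(\<lambda>s. W s * indicator ({..a} \<inter> {0..<1}) s) \<in> borel_measurable ?N"
          using WI by (intro borel_measurable_times borel_measurable_integrable
              measurable_restrict_space1 borel_measurable_indicator) auto
        show "(\<lambda>s. W s * P n s) \<in> borel_measurable ?N" for n
        proof (rule borel_measurable_times)
          show "W \<in> borel_measurable ?N" using WI by (rule borel_measurable_integrable)
          show "P n \<in> borel_measurable ?N"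
            by (rule measurable_restrict_space1) (simp add: pm P)
        qed
      qed
      then have "(\<integral>s. W s * indicator ({..a} \<inter> {0..<1}) s \<partial>?N) = 0"
        using test[OF P] by (simp add: LIMSEQ_const_iff)
      then show ?thesis
        by (simp add: set_lebesgue_integral_def mult.commute)
    qed
  qed
  have meas: "A \<inter> {0..<1} \<in> sets ?N" if "A \<in> sets borel" for A
    using that by (auto simp: sets_restrict_space)
  have setI: "set_integrable ?N (A \<inter> {0..<1}) W" if "A \<in> sets borel" for A
    unfolding set_integrable_def by (rule integrable_mult_indicator[OF meas[OF that] WI])
  have gen: "set_lebesgue_integral ?N (A \<inter> {0..<1}) W = 0" if "A \<in> sets borel" for A
  proof -
    have b: "sets (borel :: real measure) = sigma_sets UNIV (range atMost)"
      by (subst borel_eq_atMost) (simp add: sets_measure_of)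
    have "Int_stable (range (atMost :: real \<Rightarrow> real set))"
      by (auto simp: Int_stable_def)
    moreover have "range (atMost :: real \<Rightarrow> real set) \<subseteq> Pow UNIV" by simp
    moreover have "A \<in> sigma_sets UNIV (range atMost)" using that b by simp
    ultimately show ?thesis
    proof (induction rule: sigma_sets_induct_disjoint)
      case (basic A)
      then show ?case using arc by auto
    next
      case empty
      show ?case by (simp add: set_lebesgue_integral_def)
    next
      case (compl A)
      have A: "A \<in> sets borel" unfolding b by (rule compl(1))
      have A': "UNIV - A \<in> sets borel" using A by (intro sets.Diff) simp_all
      have "(\<integral>s. W s \<partial>?N) = set_lebesgue_integral ?N ((A \<inter> {0..<1}) \<union> ((UNIV - A) \<inter> {0..<1})) W"
        unfolding set_lebesgue_integral_def
        by (intro Bochner_Integration.integral_cong) (auto simp: space_restrict_space indicator_def)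
      also have "\<dots> = set_lebesgue_integral ?N (A \<inter> {0..<1}) W
                    + set_lebesgue_integral ?N ((UNIV - A) \<inter> {0..<1}) W"
        by (rule set_integral_Un[OF _ setI[OF A] setI[OF A']]) blast
      finally show ?case using compl(2) total by simp
    next
      case (union A)
      have A: "A i \<in> sets borel" for i unfolding b using union(2) by blast
      have "(\<Union>i. A i) \<in> sets borel" using A by blast
      have e: "(\<Union>i. A i) \<inter> {0..<1} = (\<Union>i. A i \<inter> {0..<1})" by auto
      have "set_lebesgue_integral ?N (\<Union>i. A i \<inter> {0..<1}) W
          = (\<Sum>i. set_lebesgue_integral ?N (A i \<inter> {0..<1}) W)"
      proof (rule lebesgue_integral_countable_add)
        show "A i \<inter> {0..<1} \<in> sets ?N" for i by (rule meas[OF A])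
        show "A i \<inter> {0..<1} \<inter> (A j \<inter> {0..<1}) = {}" if "i \<noteq> j" for i j
          using union(1) that by (auto simp: disjoint_family_on_def)
        show "set_integrable ?N (\<Union>i. A i \<inter> {0..<1}) W"
          using setI[OF \<open>(\<Union>i. A i) \<in> sets borel\<close>] unfolding e .
      qed
      then show ?case unfolding e using union by simp
    qed
  qed
  interpret N: finite_measure ?N
  proof (rule finite_measureI)
    show "emeasure ?N (space ?N) \<noteq> \<infinity>"
      by (subst emeasure_restrict_space) (auto simp: space_restrict_space)
  qed
  have "AE s in ?N. W s = 0"
  proof (rule N.density_zero[OF WI])
    fix A assume "A \<in> sets ?N"
    then have "A \<in> sets borel" "A \<inter> {0..<1} = A" by (auto simp: sets_restrict_space)
    then show "set_lebesgue_integral ?N A W = 0" using gen[of A] by simp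
  qed
  then have "AE t in circle_measure. w t = 0"
    unfolding circle_measure_def W_def using wm by (subst AE_distr_iff) auto
  then show "AE t in circle_measure. rep_l2 g t = rep_l2 h t"
    by (simp add: w_def)
qed

typedef h1 = "{u :: l2. \<exists>g. weak_derivative u g}"
  morphisms l2_of_h1 h1_of_l2
proof -
  have "AE t in circle_measure. rep_l2 0 t * f t = 0" for f
    using rep_l2_zero by eventually_elim simp
  then have "(\<integral>t. rep_l2 0 t * f t \<partial>circle_measure) = 0" for f
    by (rule integral_eq_zero_AE)
  then have "weak_derivative 0 0" by (simp add: weak_derivative_def)
  then show ?thesis by blast
qed

setup_lifting type_definition_h1

definition deriv_h1 :: "h1 \<Rightarrow> l2" where
  "deriv_h1 u = (THE g. weak_derivative (l2_of_h1 u) g)"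

lemma deriv_h1_unique: "weak_derivative (l2_of_h1 u) g \<Longrightarrow> deriv_h1 u = g"
  unfolding deriv_h1_def by (rule the_equality) (auto dest: weak_derivative_unique)

lemma deriv_h1: "weak_derivative (l2_of_h1 u) (deriv_h1 u)"
  using l2_of_h1[of u] deriv_h1_unique by auto

lemma continuous_square_integrable:
  assumes "continuous_on UNIV u"
  shows "u \<in> square_integrable"
proof -
  have m: "u \<in> borel_measurable borel"
    using assms by (rule borel_measurable_continuous_onI)
  obtain C where C: "\<And>t. \<bar>u t\<bar> \<le> C"
    using compact_imp_bounded[OF compact_continuous_image[OF assms compact_circle]]
    by (auto simp: bounded_iff)
  have "integrable circle_measure (\<lambda>t. (u t)\<^sup>2)"
  proof (rule circle_measure.integrable_const_bound[of _ "C\<^sup>2"])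
    show "AE t in circle_measure. norm ((u t)\<^sup>2) \<le> C\<^sup>2"
      using C by (intro AE_I2) (simp add: abs_le_square_iff[symmetric] order_trans[OF C abs_ge_self])
  qed (use m in measurable)
  with m show ?thesis
    by (simp add: square_integrable_def measurable_cong_sets[OF sets_circle_measure refl])
qed

lemma test_function_square_integrable:
  assumes "circle_smooth \<phi>" "has_circle_derivative \<phi> \<phi>'"
  shows "\<phi> \<in> square_integrable" "\<phi>' \<in> square_integrable"
proof -
  have s: "smooth_on UNIV (\<lambda>s. \<phi> (circle_of s))"
    using assms(1) by (simp add: circle_smooth_def)
  then show "\<phi> \<in> square_integrable"
    by (intro continuous_square_integrable)
       (simp add: circle_of_continuous_iff smooth_on_imp_continuous_on)
  obtain f' where
    "(\<forall>x\<in>UNIV. ((\<lambda>s. \<phi> (circle_of s)) has_derivative f' x) (at x)) \<and>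
     (\<forall>v. smooth_on UNIV (\<lambda>x. f' x v))"
    using smooth_on_has_derivative[OF s] by (rule exE)
  then have f': "((\<lambda>s. \<phi> (circle_of s)) has_derivative f' x) (at x)"
    "smooth_on UNIV (\<lambda>x. f' x v)" for x v
    by simp_all
  have "f' x = (\<lambda>h. \<phi>' (circle_of x) * h)" for x
    by (rule has_derivative_unique[OF f'(1)])
       (use assms(2) in \<open>auto simp: has_circle_derivative_def has_field_derivative_def\<close>)
  then have e: "f' x 1 = \<phi>' (circle_of x)" for x by simp
  have "continuous_on UNIV (\<lambda>s. \<phi>' (circle_of s))"
    using smooth_on_imp_continuous_on[OF f'(2)[of 1]] unfolding e .
  then show "\<phi>' \<in> square_integrable"
    by (intro continuous_square_integrable) (simp add: circle_of_continuous_iff)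
qed

lemma integral_rep_l2_plus:
  assumes "p \<in> square_integrable"
  shows "(\<integral>t. rep_l2 (u + v) t * p t \<partial>circle_measure)
       = (\<integral>t. rep_l2 u t * p t \<partial>circle_measure) + (\<integral>t. rep_l2 v t * p t \<partial>circle_measure)"
proof -
  have [measurable]: "p \<in> borel_measurable circle_measure"
    by (rule square_integrable_measurable[OF assms])
  have "(\<integral>t. rep_l2 (u + v) t * p t \<partial>circle_measure)
      = (\<integral>t. rep_l2 u t * p t + rep_l2 v t * p t \<partial>circle_measure)"
    by (rule integral_cong_AE; (measurable)?)
       (use rep_l2_plus[of u v] in \<open>eventually_elim, simp add: algebra_simps\<close>)
  then show ?thesis by (simp add: square_integrable_mult assms)
qed

lemma integral_rep_l2_scaleR:
  assumes "p \<in> square_integrable"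
  shows "(\<integral>t. rep_l2 (c *\<^sub>R u) t * p t \<partial>circle_measure)
       = c * (\<integral>t. rep_l2 u t * p t \<partial>circle_measure)"
proof -
  have [measurable]: "p \<in> borel_measurable circle_measure"
    by (rule square_integrable_measurable[OF assms])
  have "(\<integral>t. rep_l2 (c *\<^sub>R u) t * p t \<partial>circle_measure)
      = (\<integral>t. c * (rep_l2 u t * p t) \<partial>circle_measure)"
    by (rule integral_cong_AE; (measurable)?)
       (use rep_l2_scaleR[of c u] in \<open>eventually_elim, simp add: algebra_simps\<close>)
  then show ?thesis by simp
qed

lemma weak_derivativeD:
  "weak_derivative u g \<Longrightarrow> circle_smooth \<phi> \<Longrightarrow> has_circle_derivative \<phi> \<phi>' \<Longrightarrow>
   (\<integral>t. rep_l2 u t * \<phi>' t \<partial>circle_measure) = - (\<integral>t. rep_l2 g t * \<phi> t \<partial>circle_measure)"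
  unfolding weak_derivative_def by blast

lemma weak_derivative_add:
  assumes "weak_derivative u g" "weak_derivative v h"
  shows "weak_derivative (u + v) (g + h)"
  unfolding weak_derivative_def
proof (intro allI impI; elim conjE)
  fix \<phi> \<phi>' assume a: "circle_smooth \<phi>" "has_circle_derivative \<phi> \<phi>'"
  show "(\<integral>t. rep_l2 (u + v) t * \<phi>' t \<partial>circle_measure)
      = - (\<integral>t. rep_l2 (g + h) t * \<phi> t \<partial>circle_measure)"
    using weak_derivativeD[OF assms(1) a] weak_derivativeD[OF assms(2) a]
      test_function_square_integrable[OF a]
    by (simp add: integral_rep_l2_plus)
qed

lemma weak_derivative_scaleR:
  assumes "weak_derivative u g"
  shows "weak_derivative (c *\<^sub>R u) (c *\<^sub>R g)"
  unfolding weak_derivative_def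
proof (intro allI impI; elim conjE)
  fix \<phi> \<phi>' assume a: "circle_smooth \<phi>" "has_circle_derivative \<phi> \<phi>'"
  show "(\<integral>t. rep_l2 (c *\<^sub>R u) t * \<phi>' t \<partial>circle_measure)
      = - (\<integral>t. rep_l2 (c *\<^sub>R g) t * \<phi> t \<partial>circle_measure)"
    using weak_derivativeD[OF assms a] test_function_square_integrable[OF a]
    by (simp add: integral_rep_l2_scaleR)
qed

instantiation h1 :: real_inner
begin

lift_definition zero_h1 :: h1 is 0
  using weak_derivative_scaleR[OF deriv_h1, of 0] by auto

lift_definition plus_h1 :: "h1 \<Rightarrow> h1 \<Rightarrow> h1" is "(+)"
  using weak_derivative_add by blast

lift_definition scaleR_h1 :: "real \<Rightarrow> h1 \<Rightarrow> h1" is scaleR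
  using weak_derivative_scaleR by blast

definition uminus_h1 :: "h1 \<Rightarrow> h1" where "- u = (-1) *\<^sub>R (u :: h1)"

definition minus_h1 :: "h1 \<Rightarrow> h1 \<Rightarrow> h1" where "u - v = u + - (v :: h1)"

definition inner_h1 :: "h1 \<Rightarrow> h1 \<Rightarrow> real" where
  "inner u v = inner (l2_of_h1 u) (l2_of_h1 v) + inner (deriv_h1 u) (deriv_h1 v)"

definition norm_h1 :: "h1 \<Rightarrow> real" where "norm u = sqrt (inner u (u :: h1))"

definition dist_h1 :: "h1 \<Rightarrow> h1 \<Rightarrow> real" where "dist u v = norm (u - v :: h1)"

definition sgn_h1 :: "h1 \<Rightarrow> h1" where "sgn u = inverse (norm u) *\<^sub>R (u :: h1)"

definition uniformity_h1 :: "(h1 \<times> h1) filter" where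
  "uniformity_h1 = (INF e\<in>{0<..}. principal {(u, v). dist u v < e})"

definition open_h1 :: "h1 set \<Rightarrow> bool" where
  "open_h1 S \<longleftrightarrow> (\<forall>u\<in>S. \<forall>\<^sub>F (v, w) in uniformity. v = u \<longrightarrow> w \<in> S)"

lemma deriv_h1_add: "deriv_h1 (u + v) = deriv_h1 u + deriv_h1 v"
  using weak_derivative_add[OF deriv_h1[of u] deriv_h1[of v]]
  by (intro deriv_h1_unique) (simp add: plus_h1.rep_eq)

lemma deriv_h1_scaleR: "deriv_h1 (c *\<^sub>R u) = c *\<^sub>R deriv_h1 u"
  using weak_derivative_scaleR[OF deriv_h1[of u], of c]
  by (intro deriv_h1_unique) (simp add: scaleR_h1.rep_eq)

instance
proof
  fix u v w :: h1 and a b :: real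
  show "u + v + w = u + (v + w)" "u + v = v + u" "0 + u = u"
    "a *\<^sub>R (u + v) = a *\<^sub>R u + a *\<^sub>R v" "(a + b) *\<^sub>R u = a *\<^sub>R u + b *\<^sub>R u"
    "a *\<^sub>R b *\<^sub>R u = (a * b) *\<^sub>R u" "1 *\<^sub>R u = u"
    by (transfer; simp add: algebra_simps)+
  show "- u + u = 0"
    unfolding uminus_h1_def by transfer simp
  show "inner u v = inner v u"
    by (simp add: inner_h1_def inner_commute)
  show "inner (u + v) w = inner u w + inner v w"
    by (simp add: inner_h1_def deriv_h1_add plus_h1.rep_eq inner_add_left)
  show "inner (a *\<^sub>R u) v = a * inner u v"
    by (simp add: inner_h1_def deriv_h1_scaleR scaleR_h1.rep_eq algebra_simps)
  show "0 \<le> inner u u"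
    by (simp add: inner_h1_def)
  have "0 *\<^sub>R 0 = (0 :: h1)" by transfer simp
  then have "deriv_h1 0 = 0" using deriv_h1_scaleR[of 0 0] by simp
  moreover have "l2_of_h1 u = 0 \<longleftrightarrow> u = 0"
    using l2_of_h1_inject[of u 0] by (simp add: zero_h1.rep_eq)
  ultimately show "inner u u = 0 \<longleftrightarrow> u = 0"
    by (auto simp: inner_h1_def add_nonneg_eq_0_iff)
qed (auto simp: minus_h1_def dist_h1_def sgn_h1_def uniformity_h1_def open_h1_def norm_h1_def)

end


section \<open>The differential operator\<close>

definition F_C :: "(circle \<times> real \<Rightarrow> real) \<Rightarrow> c1 \<Rightarrow> c0" where
  "F_C f u = deriv_c1 u + Bcontfun (\<lambda>t. f (t, c0_of_c1 u t))"

text \<open>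
  As elements of \<open>H\<^sup>1\<close> are essentially bounded, for continuous \<open>f\<close> the function below is square
  integrable, and its class does not depend on the representative \<^term>\<open>rep_l2 (l2_of_h1 u)\<close>.
\<close>

definition F_H :: "(circle \<times> real \<Rightarrow> real) \<Rightarrow> h1 \<Rightarrow> l2" where
  "F_H f u = deriv_h1 u + abs_l2 (\<lambda>t. f (t, rep_l2 (l2_of_h1 u) t))"

lemma F_C_apply:
  assumes "cylinder_smooth f"
  shows "F_C f u t = deriv_c1 u t + f (t, c0_of_c1 u t)"
proof -
  have "continuous_on UNIV (\<lambda>t. (t, c0_of_c1 u t))"
    by (intro continuous_intros) simp
  then have "continuous_on UNIV (\<lambda>t. f (t, c0_of_c1 u t))"
    by (intro continuous_on_compose2[OF cylinder_smooth_imp_continuous_on[OF assms]]) auto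
  then show ?thesis
    by (simp add: F_C_def plus_bcontfun.rep_eq Bcontfun_inverse continuous_in_bcontfun)
qed

definition D2 :: "(circle \<times> real \<Rightarrow> real) \<Rightarrow> circle \<Rightarrow> real \<Rightarrow> real" where
  "D2 f t x = deriv (\<lambda>y. f (t, y)) x"

definition f_plus :: "(circle \<times> real \<Rightarrow> real) \<Rightarrow> circle \<Rightarrow> ereal" where
  "f_plus f t = Lim at_top (\<lambda>x. ereal (f (t, x)))"

definition f_minus :: "(circle \<times> real \<Rightarrow> real) \<Rightarrow> circle \<Rightarrow> ereal" where
  "f_minus f t = Lim at_bot (\<lambda>x. ereal (f (t, x)))"

text \<open>
  The integral of the positive part minus the integral of the negative part; note that
  \<^const>\<open>e2ennreal\<close> maps negative numbers to \<open>0\<close>. It is used for functions one of whose parts is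
  bounded, so that the indeterminate case of two infinite integrals does not arise.
\<close>

definition circle_ereal_integral :: "(circle \<Rightarrow> ereal) \<Rightarrow> ereal" where
  "circle_ereal_integral g =
     enn2ereal (\<integral>\<^sup>+ t. e2ennreal (g t) \<partial>circle_measure) -
     enn2ereal (\<integral>\<^sup>+ t. e2ennreal (- g t) \<partial>circle_measure)"

definition strip :: "(circle \<times> real \<Rightarrow> real) \<Rightarrow> ('b \<Rightarrow> circle \<Rightarrow> real) \<Rightarrow> 'b set" where
  "strip f fn = {v.
     circle_ereal_integral (f_minus f) < ereal (\<integral>t. fn v t \<partial>circle_measure) \<and>
     ereal (\<integral>t. fn v t \<partial>circle_measure) < circle_ereal_integral (f_plus f)}"

definition strip_C :: "(circle \<times> real \<Rightarrow> real) \<Rightarrow> c0 set" where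
  "strip_C f = strip f apply_bcontfun"

definition strip_H :: "(circle \<times> real \<Rightarrow> real) \<Rightarrow> l2 set" where
  "strip_H f = strip f rep_l2"

end

theory Submission
  imports Defs
begin

text \<open>
  If \<open>u\<close> solves \<open>u' + f(t, u) = v\<close> and \<open>V\<close> is a primitive of \<open>v\<close>, then \<open>u - V\<close> is continuously
  differentiable, so that comparison arguments in the supremum norm apply to both pairs of spaces.
  Where \<open>u\<close> exceeds \<open>N\<close>, \<open>(u - V)'\<close> is at most \<open>-f(t, N)\<close>; if the mean of \<open>f(\<cdot>, N)\<close> exceeds that
  of \<open>v\<close>, then \<open>u\<close> cannot stay above \<open>N\<close> for a whole period and is thus bounded in terms of \<open>N\<close> and
  \<open>v\<close>. The same comparison for the difference of two solutions yields injectivity and the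
  continuity of the inverse. If the slope of \<open>f\<close> lies between positive constants, a solution is the
  fixed point of a contraction; the general case follows by truncation, perturbation by
  \<open>\<epsilon> x\<close> and the stability estimate. The linearization \<open>w' + D\<^sub>2f(t, u) w\<close> is an equation of the
  same kind, hence invertible, and the formula for the derivative of the inverse operator bootstraps
  smoothness.
\<close>

section \<open>Smoothness through families of derivatives\<close>

text \<open>Why the image is the strip: integration over a period kills u', so the mean of F(u) is
  that of f(t, u(t)), which lies strictly between the means of f(., -N) and f(., N) once |u| < N.
  Conversely, such a bracketing of the mean of v by some N is all that the a priori bound asks for.
  The set \<open>target\<close> of bracketed v is open, and one N serves for all neighbours of v. As
  N grows, monotone and dominated convergence identify it with the strip; properness makes it the
  whole space. The obstacle in (c) is that strict monotonicity gives no lower bound on increments in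
  proportion to the distance. Compactness supplies a positive bound for each fixed distance, hence a
  stability estimate without a rate, which still suffices for uniqueness, for the passage to the
  limit and for continuity of the inverse. All limits of solutions are taken in C^0, the one space
  whose completeness is established; L^2 enters only through the primitive of v.\<close>

text \<open>
  The derivatives of order \<open>k\<close> in the directions \<open>vs\<close> are treated as one family of functions on the
  base space, each weighted by the product of the norms of \<open>vs\<close>; all estimates are uniform over a
  family. So derivatives of all orders have the same type, and multilinearity need not be tracked.
\<close>

definition pointwise_bounded ::
    "'a set \<Rightarrow> (real \<times> ('a \<Rightarrow> 'b::real_normed_vector)) set \<Rightarrow> bool" where
  "pointwise_bounded S W \<longleftrightarrow>
     (\<forall>(r, f)\<in>W. 0 \<le> r) \<and> (\<forall>x\<in>S. \<exists>C\<ge>0. \<forall>(r, f)\<in>W. norm (f x) \<le> C * r)"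

text \<open>\<open>R\<close> is a relation and not a function on \<open>W\<close>: a member of a sum
  or product family can arise in several ways, and each way names its own derivative, so that
  nothing has to be chosen.\<close>

definition derivative_family ::
    "'a::real_normed_vector set \<Rightarrow> (real \<times> ('a \<Rightarrow> 'b::real_normed_vector)) set \<Rightarrow>
     (real \<times> ('a \<Rightarrow> 'b) \<times> ('a \<Rightarrow> 'a \<Rightarrow> 'b)) set \<Rightarrow> bool" where
  "derivative_family S W R \<longleftrightarrow>
     (\<forall>(r, f)\<in>W. \<exists>f'. (r, f, f') \<in> R) \<and>
     (\<forall>(r, f, f')\<in>R. (r, f) \<in> W \<and> (\<forall>x\<in>S. linear (f' x))) \<and>
     (\<forall>x\<in>S. \<forall>e>0. \<forall>\<^sub>F h in nhds 0. \<forall>(r, f, f')\<in>R.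
        norm (f (x + h) - f x - f' x h) \<le> e * norm h * r)"

definition directional ::
    "(real \<times> ('a::real_normed_vector \<Rightarrow> 'b) \<times> ('a \<Rightarrow> 'a \<Rightarrow> 'b)) set \<Rightarrow> (real \<times> ('a \<Rightarrow> 'b)) set" where
  "directional R = {(r * norm h, \<lambda>x. f' x h) | r f f' h. (r, f, f') \<in> R}"

text \<open>For \<open>{(1, f)}\<close> this is \<open>n\<close>-fold Frechet differentiability.
  Boundedness of the linear maps \<open>f' x\<close> is hidden in the next level: the weights of
  \<open>directional R\<close> carry \<open>norm h\<close>, so its pointwise bound is an operator
  norm bound.\<close>

primrec smooth_family ::
    "nat \<Rightarrow> 'a::real_normed_vector set \<Rightarrow> (real \<times> ('a \<Rightarrow> 'b::real_normed_vector)) set \<Rightarrow> bool" where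
  "smooth_family 0 S W \<longleftrightarrow> pointwise_bounded S W"
| "smooth_family (Suc n) S W \<longleftrightarrow> pointwise_bounded S W \<and>
     (\<exists>R. derivative_family S W R \<and> smooth_family n S (directional R))"

lemma smooth_family_bounded: "smooth_family n S W \<Longrightarrow> pointwise_bounded S W"
  by (cases n) auto

lemma pointwise_boundedD:
  assumes "pointwise_bounded S W" "x \<in> S"
  obtains C where "C \<ge> 0" "\<And>r f. (r, f) \<in> W \<Longrightarrow> norm (f x) \<le> C * r"
  using assms unfolding pointwise_bounded_def by blast

lemma pointwise_bounded_weight: "pointwise_bounded S W \<Longrightarrow> (r, f) \<in> W \<Longrightarrow> 0 \<le> r"
  unfolding pointwise_bounded_def by blast

lemma derivative_familyD:
  assumes "derivative_family S W R"
  shows "(r, f) \<in> W \<Longrightarrow> \<exists>f'. (r, f, f') \<in> R"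
    "(r, f, f') \<in> R \<Longrightarrow> (r, f) \<in> W"
    "(r, f, f') \<in> R \<Longrightarrow> x \<in> S \<Longrightarrow> linear (f' x)"
    "x \<in> S \<Longrightarrow> e > 0 \<Longrightarrow> \<forall>\<^sub>F h in nhds 0. \<forall>(r, f, f')\<in>R.
        norm (f (x + h) - f x - f' x h) \<le> e * norm h * r"
  using assms unfolding derivative_family_def by blast+

lemma directionalI: "(r, f, f') \<in> R \<Longrightarrow> (r * norm h, \<lambda>x. f' x h) \<in> directional R"
  unfolding directional_def by blast

lemma directionalE:
  assumes "p \<in> directional R"
  obtains r f f' h where "(r, f, f') \<in> R" "p = (r * norm h, \<lambda>x. f' x h)"
  using assms unfolding directional_def by blast

lemma has_derivative_nhdsI:
  assumes "bounded_linear f'"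
    and "\<And>e. e > 0 \<Longrightarrow> \<forall>\<^sub>F h in nhds 0. norm (f (x + h) - f x - f' h) \<le> e * norm h"
  shows "(f has_derivative f') (at x)"
  unfolding has_derivative_at_alt
proof (intro conjI allI impI assms(1))
  fix e :: real assume "e > 0"
  then obtain d where "d > 0" "\<And>h. norm h < d \<Longrightarrow> norm (f (x + h) - f x - f' h) \<le> e * norm h"
    using assms(2)[of e] by (auto simp: eventually_nhds_metric)
  then show "\<exists>d>0. \<forall>y. norm (y - x) < d \<longrightarrow> norm (f y - f x - f' (y - x)) \<le> e * norm (y - x)"
    by (metis add.commute diff_add_cancel)
qed

lemma has_derivative_nhdsD:
  assumes "(f has_derivative f') (at x)" "e > 0"
  shows "\<forall>\<^sub>F h in nhds 0. norm (f (x + h) - f x - f' h) \<le> e * norm h"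
proof -
  obtain d where d: "d > 0"
    "\<And>y. norm (y - x) < d \<Longrightarrow> norm (f y - f x - f' (y - x)) \<le> e * norm (y - x)"
    using assms unfolding has_derivative_at_alt by blast
  show ?thesis
    unfolding eventually_nhds_metric dist_norm
    using d(1) d(2)[of "x + h" for h] by (intro exI[of _ d]) auto
qed

lemma derivative_family_has_derivative:
  assumes R: "derivative_family S W R" "pointwise_bounded S W" "pointwise_bounded S (directional R)"
    and m: "(r, f, f') \<in> R" and x: "x \<in> S"
  shows "(f has_derivative f' x) (at x)"
proof (rule has_derivative_nhdsI)
  obtain C where C: "\<And>r f. (r, f) \<in> directional R \<Longrightarrow> norm (f x) \<le> C * r"
    using pointwise_boundedD[OF R(3) x] by metis
  have "norm (f' x h) \<le> norm h * (C * r)" for h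
    using C[OF directionalI[OF m], of h] by (simp add: mult_ac)
  then show "bounded_linear (f' x)"
    using derivative_familyD(3)[OF R(1) m x]
    by (auto simp: bounded_linear_def bounded_linear_axioms_def)
  fix e :: real assume e: "e > 0"
  have r: "r \<ge> 0" using pointwise_bounded_weight[OF R(2) derivative_familyD(2)[OF R(1) m]] .
  \<comment> \<open>Division by \<open>r + 1\<close> and not by \<open>r\<close>, as the weight may
    be zero.\<close>
  have "e / (r + 1) > 0" using e r by simp
  from derivative_familyD(4)[OF R(1) x this]
  show "\<forall>\<^sub>F h in nhds 0. norm (f (x + h) - f x - f' x h) \<le> e * norm h"
  proof eventually_elim
    case (elim h)
    then have "norm (f (x + h) - f x - f' x h) \<le> e / (r + 1) * norm h * r" using m by blast
    also have "\<dots> = (r / (r + 1)) * (e * norm h)" by simp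
    also have "\<dots> \<le> 1 * (e * norm h)" using r e by (intro mult_right_mono) auto
    finally show ?case by simp
  qed
qed

lemma pointwise_bounded_cong:
  assumes "pointwise_bounded S W"
    and sub: "\<And>r g. (r, g) \<in> W' \<Longrightarrow> \<exists>f. (r, f) \<in> W \<and> (\<forall>x\<in>S. g x = f x)"
  shows "pointwise_bounded S W'"
  unfolding pointwise_bounded_def
proof (intro conjI ballI)
  fix p assume "p \<in> W'"
  then show "case p of (r, f) \<Rightarrow> 0 \<le> r"
    using sub pointwise_bounded_weight[OF assms(1)] by blast
next
  fix x assume x: "x \<in> S"
  obtain C where "C \<ge> 0" "\<And>r f. (r, f) \<in> W \<Longrightarrow> norm (f x) \<le> C * r"
    using pointwise_boundedD[OF assms(1) x] by metis
  then show "\<exists>C\<ge>0. \<forall>(r, f)\<in>W'. norm (f x) \<le> C * r"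
    using sub x by (intro exI[of _ C]) fastforce
qed

lemma smooth_family_cong:
  assumes "open S" "smooth_family n S W"
    and "\<And>r g. (r, g) \<in> W' \<Longrightarrow> \<exists>f. (r, f) \<in> W \<and> (\<forall>x\<in>S. g x = f x)"
  shows "smooth_family n S W'"
  using assms(2,3)
proof (induction n arbitrary: W W')
  case 0
  then show ?case using pointwise_bounded_cong[of S W W'] by simp
next
  case (Suc n)
  then obtain R where R: "derivative_family S W R" "smooth_family n S (directional R)" by auto
  define R' where "R' = {(r, g, f') | r g f f'. (r, g) \<in> W' \<and> (r, f, f') \<in> R \<and> (\<forall>x\<in>S. g x = f x)}"
  have "derivative_family S W' R'"
    unfolding derivative_family_def
  proof (intro conjI ballI allI impI)
    fix p assume "p \<in> W'"
    then obtain r g f where p: "p = (r, g)" "(r, g) \<in> W'" "(r, f) \<in> W" "\<forall>x\<in>S. g x = f x"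
      using Suc.prems(2) by (metis surj_pair)
    obtain f' where "(r, f, f') \<in> R" using derivative_familyD(1)[OF R(1) p(3)] by blast
    with p have "(r, g, f') \<in> R'" unfolding R'_def by blast
    with p(1) show "case p of (r, f) \<Rightarrow> \<exists>f'. (r, f, f') \<in> R'" by auto
  next
    fix p assume "p \<in> R'"
    then show "case p of (r, f, f') \<Rightarrow> (r, f) \<in> W' \<and> (\<forall>x\<in>S. linear (f' x))"
      unfolding R'_def using derivative_familyD(3)[OF R(1)] by auto
  next
    fix x and e :: real assume x: "x \<in> S" and e: "e > 0"
    have "((\<lambda>h. x + h) \<longlongrightarrow> x + 0) (nhds 0)"
      by (intro tendsto_intros filterlim_ident)
    then have "\<forall>\<^sub>F h in nhds 0. x + h \<in> S"
      by (rule topological_tendstoD) (use assms(1) x in auto)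
    with derivative_familyD(4)[OF R(1) x e]
    show "\<forall>\<^sub>F h in nhds 0. \<forall>(r, f, f')\<in>R'. norm (f (x + h) - f x - f' x h) \<le> e * norm h * r"
    proof eventually_elim
      case (elim h)
      then show ?case using x unfolding R'_def by fastforce
    qed
  qed
  moreover have "smooth_family n S (directional R')"
  proof (rule Suc.IH[OF R(2)])
    fix r g assume "(r, g) \<in> directional R'"
    then obtain q k k' h where "(q, k, k') \<in> R'" "r = q * norm h" "g = (\<lambda>x. k' x h)"
      by (rule directionalE) blast
    then have "(r, g) \<in> directional R"
      unfolding R'_def using directionalI[of q _ k' R h] by blast
    then show "\<exists>f. (r, f) \<in> directional R \<and> (\<forall>x\<in>S. g x = f x)" by blast
  qed
  moreover have "pointwise_bounded S W'"
    using pointwise_bounded_cong[OF smooth_family_bounded[OF Suc.prems(1)]] Suc.prems(2) by metis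
  ultimately show ?case by auto
qed

lemma smooth_family_subset:
  "open S \<Longrightarrow> smooth_family n S W \<Longrightarrow> W' \<subseteq> W \<Longrightarrow> smooth_family n S W'"
  by (rule smooth_family_cong) blast+

lemma smooth_family_Suc_imp: "smooth_family (Suc n) S W \<Longrightarrow> smooth_family n S W"
proof (induction n arbitrary: W)
  case (Suc n)
  from Suc.prems obtain R where "pointwise_bounded S W" "derivative_family S W R"
    "smooth_family (Suc n) S (directional R)"
    unfolding smooth_family.simps(2)[of "Suc n"] by blast
  then show ?case using Suc.IH[of "directional R"] unfolding smooth_family.simps(2)[of n] by blast
qed simp

section \<open>Sums, products and linear images of families\<close>

abbreviation family_sum where
  "family_sum W1 W2 \<equiv> {(r, \<lambda>x. f x + g x) | r f g. (r, f) \<in> W1 \<and> (r, g) \<in> W2}"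

abbreviation family_prod where
  "family_prod B W1 W2 \<equiv>
     {(r * s, \<lambda>x. B (f x) (g x)) | r f s g. (r, f) \<in> W1 \<and> (s, g) \<in> W2}"

lemma smooth_family_add:
  assumes "open S" "smooth_family n S W1" "smooth_family n S W2"
  shows "smooth_family n S (family_sum W1 W2)"
  using assms(2,3)
proof (induction n arbitrary: W1 W2)
  have bounded: "pointwise_bounded S (family_sum W1 W2)"
    if b: "pointwise_bounded S W1" "pointwise_bounded S W2" for W1 W2 :: "(real \<times> ('a \<Rightarrow> 'b)) set"
    unfolding pointwise_bounded_def
  proof (intro conjI ballI)
    fix p assume "p \<in> family_sum W1 W2"
    then show "case p of (r, f) \<Rightarrow> 0 \<le> r" using pointwise_bounded_weight[OF b(1)] by auto
  next
    fix x assume x: "x \<in> S"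
    obtain C1 where C1: "C1 \<ge> 0" "\<And>r f. (r, f) \<in> W1 \<Longrightarrow> norm (f x) \<le> C1 * r"
      using pointwise_boundedD[OF b(1) x] by metis
    obtain C2 where C2: "C2 \<ge> 0" "\<And>r f. (r, f) \<in> W2 \<Longrightarrow> norm (f x) \<le> C2 * r"
      using pointwise_boundedD[OF b(2) x] by metis
    have "norm (f x + g x) \<le> (C1 + C2) * r" if "(r, f) \<in> W1" "(r, g) \<in> W2" for r f g
      using C1(2)[OF that(1)] C2(2)[OF that(2)] norm_triangle_ineq[of "f x" "g x"]
      by (simp add: distrib_right)
    then show "\<exists>C\<ge>0. \<forall>(r, f)\<in> family_sum W1 W2.
        norm (f x) \<le> C * r"
      using C1(1) C2(1) by (intro exI[of _ "C1 + C2"]) auto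
  qed
  {
    case 0
    then show ?case using bounded[of W1 W2] by simp
  next
    case (Suc n)
    then obtain R1 R2 where R1: "derivative_family S W1 R1" "smooth_family n S (directional R1)"
      and R2: "derivative_family S W2 R2" "smooth_family n S (directional R2)"
      and b: "pointwise_bounded S W1" "pointwise_bounded S W2" by auto
    let ?W = "family_sum W1 W2"
    define R where "R = {(r, \<lambda>x. f x + g x, \<lambda>x h. f' x h + g' x h) | r f g f' g'.
      (r, f, f') \<in> R1 \<and> (r, g, g') \<in> R2}"
    have "derivative_family S ?W R"
      unfolding derivative_family_def
    proof (intro conjI ballI allI impI)
      fix p assume "p \<in> ?W"
      then obtain r f g where p: "p = (r, \<lambda>x. f x + g x)" "(r, f) \<in> W1" "(r, g) \<in> W2" by blast
      then obtain f' g' where "(r, f, f') \<in> R1" "(r, g, g') \<in> R2"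
        using derivative_familyD(1)[OF R1(1)] derivative_familyD(1)[OF R2(1)] by meson
      then have "(r, \<lambda>x. f x + g x, \<lambda>x h. f' x h + g' x h) \<in> R" unfolding R_def by blast
      then show "case p of (r, f) \<Rightarrow> \<exists>f'. (r, f, f') \<in> R" using p by auto
    next
      fix p assume "p \<in> R"
      then obtain r f g f' g' where p: "p = (r, \<lambda>x. f x + g x, \<lambda>x h. f' x h + g' x h)"
        "(r, f, f') \<in> R1" "(r, g, g') \<in> R2" unfolding R_def by blast
      then have "(r, \<lambda>x. f x + g x) \<in> ?W"
        using derivative_familyD(2)[OF R1(1)] derivative_familyD(2)[OF R2(1)] by blast
      moreover have "\<forall>x\<in>S. linear (\<lambda>h. f' x h + g' x h)"
        using derivative_familyD(3)[OF R1(1) p(2)] derivative_familyD(3)[OF R2(1) p(3)]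
        by (auto intro!: linear_compose_add)
      ultimately show "case p of (r, f, f') \<Rightarrow> (r, f) \<in> ?W \<and> (\<forall>x\<in>S. linear (f' x))"
        unfolding p(1) by simp
    next
      fix x and e :: real assume x: "x \<in> S" and e: "e > 0"
      from e have e2: "e / 2 > 0" by simp
      show "\<forall>\<^sub>F h in nhds 0. \<forall>(r, f, f')\<in>R. norm (f (x + h) - f x - f' x h) \<le> e * norm h * r"
        using derivative_familyD(4)[OF R1(1) x e2] derivative_familyD(4)[OF R2(1) x e2]
      proof eventually_elim
        case (elim h)
        have "norm (f (x + h) + g (x + h) - (f x + g x) - (f' x h + g' x h)) \<le> e * norm h * r"
          if "(r, f, f') \<in> R1" "(r, g, g') \<in> R2" for r f g f' g'
        proof -
          have "f (x + h) + g (x + h) - (f x + g x) - (f' x h + g' x h)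
              = (f (x + h) - f x - f' x h) + (g (x + h) - g x - g' x h)" by simp
          also have "norm \<dots> \<le> e / 2 * norm h * r + e / 2 * norm h * r"
            using elim that by (intro norm_triangle_mono) blast+
          finally show ?thesis by (simp add: field_simps)
        qed
        then show ?case unfolding R_def by auto
      qed
    qed
    moreover have "smooth_family n S (directional R)"
    proof (rule smooth_family_subset[OF assms(1) Suc.IH[OF R1(2) R2(2)]], rule subsetI)
      fix p assume "p \<in> directional R"
      then obtain r k k' h where k: "(r, k, k') \<in> R" "p = (r * norm h, \<lambda>x. k' x h)"
        by (rule directionalE)
      then obtain f g f' g' where "k' = (\<lambda>x h. f' x h + g' x h)"
        and p: "(r, f, f') \<in> R1" "(r, g, g') \<in> R2"
        unfolding R_def by blast
      then have "p = (r * norm h, \<lambda>x. f' x h + g' x h)" using k by simp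
      then show "p \<in> family_sum (directional R1) (directional R2)"
        using directionalI[OF p(1), of h] directionalI[OF p(2), of h]
        by (intro CollectI exI[of _ "r * norm h"] exI[of _ "\<lambda>x. f' x h"] exI[of _ "\<lambda>x. g' x h"]) simp
    qed
    ultimately show ?case using bounded[OF b] by auto
  }
qed

text \<open>The directional derivatives are again constants, namely zeros with the weights
  \<open>r * norm h\<close>; an arbitrary set \<open>K\<close> of weighted constants lets the
  induction pass to them.\<close>

lemma smooth_family_const:
  fixes S :: "'a::real_normed_vector set" and K :: "(real \<times> 'b::real_normed_vector) set"
  assumes "\<And>r c. (r, c) \<in> K \<Longrightarrow> 0 \<le> r \<and> norm c \<le> C * r"
  shows "smooth_family n S {(r, \<lambda>_. c) | r c. (r, c) \<in> K}"
  using assms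
proof (induction n arbitrary: C K)
  have bounded: "pointwise_bounded S {(r, \<lambda>_. c) | r c. (r, c) \<in> K}"
    if K: "\<And>r c. (r, c) \<in> K \<Longrightarrow> 0 \<le> r \<and> norm c \<le> C * r" for C and K :: "(real \<times> 'b) set"
  proof -
    have "norm c \<le> max C 0 * r" if "(r, c) \<in> K" for r c
      using K[OF that] mult_right_mono[of C "max C 0" r] by auto
    then show ?thesis unfolding pointwise_bounded_def
      using K by (auto intro!: exI[of _ "max C 0"])
  qed
  {
    case 0
    then show ?case using bounded[of K C] by simp
  next
    case (Suc n)
    let ?W = "{(r, \<lambda>_. c) | r c. (r, c) \<in> K}"
    define R where "R = {(r, (\<lambda>_. c) :: 'a \<Rightarrow> 'b, (\<lambda>_ _. 0) :: 'a \<Rightarrow> 'a \<Rightarrow> 'b) | r c. (r, c) \<in> K}"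
    define K' where "K' = {(r * norm h, 0 :: 'b) | r c (h :: 'a). (r, c) \<in> K}"
    have "derivative_family S ?W R"
      unfolding derivative_family_def R_def using Suc.prems
      by (auto simp: module_hom_zero intro!: always_eventually)
    moreover have "directional R = {(r, \<lambda>_. c) | r c. (r, c) \<in> K'}"
    proof (intro set_eqI iffI)
      fix p assume "p \<in> directional R"
      then obtain r k k' h where "(r, k, k') \<in> R" "p = (r * norm h, \<lambda>x. k' x h)"
        by (rule directionalE)
      then show "p \<in> {(r, \<lambda>_. c) | r c. (r, c) \<in> K'}"
        unfolding R_def K'_def by auto
    next
      fix p assume "p \<in> {(r, (\<lambda>_. c) :: 'a \<Rightarrow> 'b) | r c. (r, c) \<in> K'}"
      then obtain r c h where p: "p = (r * norm (h :: 'a), (\<lambda>_. 0) :: 'a \<Rightarrow> 'b)" "(r, c) \<in> K"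
        unfolding K'_def by blast
      have "(r, (\<lambda>_. c), (\<lambda>_ _. 0)) \<in> R" using p(2) unfolding R_def by blast
      from directionalI[OF this, of h] show "p \<in> directional R" using p(1) by simp
    qed
    moreover have "smooth_family n S {(r, (\<lambda>_. c) :: 'a \<Rightarrow> 'b) | r c. (r, c) \<in> K'}"
      using Suc.prems by (intro Suc.IH[of K' 0]) (auto simp: K'_def)
    ultimately show ?case using bounded[OF Suc.prems] by auto
  }
qed


text \<open>Leibniz rule: the directional family of the product lies in a sum of two products, each
  pairing the derivatives of one factor with the other factor itself. The induction hypothesis
  applies to these because smoothness of order \<open>Suc n\<close> implies that of order
  \<open>n\<close>.\<close>

lemma smooth_family_bilinear:
  fixes prod :: "'b::real_normed_vector \<Rightarrow> 'c::real_normed_vector \<Rightarrow> 'd::real_normed_vector"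
    and W1 :: "(real \<times> ('a::real_normed_vector \<Rightarrow> 'b)) set"
  assumes "open S" "bounded_bilinear prod" "smooth_family n S W1" "smooth_family n S W2"
  shows "smooth_family n S (family_prod prod W1 W2)"
  using assms(3,4)
proof (induction n arbitrary: W1 W2)
  interpret bounded_bilinear prod by (rule assms(2))
  obtain K where K: "K > 0" "\<And>a b. norm (prod a b) \<le> norm a * norm b * K"
    using pos_bounded by blast
  have bounded: "pointwise_bounded S
      (family_prod prod W1 W2)"
    if b: "pointwise_bounded S W1" "pointwise_bounded S W2"
    for W1 :: "(real \<times> ('a \<Rightarrow> 'b)) set" and W2
    unfolding pointwise_bounded_def
  proof (intro conjI ballI)
    fix p assume "p \<in> family_prod prod W1 W2"
    then show "case p of (r, f) \<Rightarrow> 0 \<le> r"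
      using pointwise_bounded_weight[OF b(1)] pointwise_bounded_weight[OF b(2)] by auto
  next
    fix x assume x: "x \<in> S"
    obtain C1 where C1: "C1 \<ge> 0" "\<And>r f. (r, f) \<in> W1 \<Longrightarrow> norm (f x) \<le> C1 * r"
      using pointwise_boundedD[OF b(1) x] by metis
    obtain C2 where C2: "C2 \<ge> 0" "\<And>r f. (r, f) \<in> W2 \<Longrightarrow> norm (f x) \<le> C2 * r"
      using pointwise_boundedD[OF b(2) x] by metis
    have "norm (prod (f x) (g x)) \<le> (C1 * C2 * K) * (r * s)" if "(r, f) \<in> W1" "(s, g) \<in> W2" for r f s g
    proof -
      have "norm (prod (f x) (g x)) \<le> norm (f x) * norm (g x) * K" by (rule K)
      also have "\<dots> \<le> (C1 * r) * (C2 * s) * K"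
        using C1 C2 K that pointwise_bounded_weight[OF b(1)] pointwise_bounded_weight[OF b(2)]
        by (intro mult_right_mono mult_mono) auto
      finally show ?thesis by (simp add: mult_ac)
    qed
    then show "\<exists>C\<ge>0. \<forall>(r, f)\<in> family_prod prod W1 W2. norm (f x) \<le> C * r"
      using C1(1) C2(1) K(1) by (intro exI[of _ "C1 * C2 * K"]) auto
  qed
  {
    case 0
    then show ?case using bounded[of W1 W2] by simp
  next
    case (Suc n)
    then obtain R1 R2 where R1: "derivative_family S W1 R1" "smooth_family n S (directional R1)"
      and R2: "derivative_family S W2 R2" "smooth_family n S (directional R2)"
      and b: "pointwise_bounded S W1" "pointwise_bounded S W2" by auto
    let ?W = "family_prod prod W1 W2"
    define R where "R = {(r * s, \<lambda>x. prod (f x) (g x), \<lambda>x h. prod (f' x h) (g x) + prod (f x) (g' x h)) |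
      r f f' s g g'. (r, f, f') \<in> R1 \<and> (s, g, g') \<in> R2}"
    have RI: "(r * s, \<lambda>x. prod (f x) (g x), \<lambda>x h. prod (f' x h) (g x) + prod (f x) (g' x h)) \<in> R"
      if "(r, f, f') \<in> R1" "(s, g, g') \<in> R2" for r f f' s g g'
      using that unfolding R_def by blast
    have WI: "(r * s, \<lambda>x. prod (f x) (g x)) \<in> ?W"
      if "(r, f) \<in> W1" "(s, g) \<in> W2" for r f s g
      using that by blast
    have "derivative_family S ?W R"
      unfolding derivative_family_def
    proof (intro conjI ballI allI impI)
      fix p assume "p \<in> ?W"
      then obtain r f s g where p: "p = (r * s, \<lambda>x. prod (f x) (g x))" "(r, f) \<in> W1" "(s, g) \<in> W2"
        by blast
      then obtain f' g' where "(r, f, f') \<in> R1" "(s, g, g') \<in> R2"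
        using derivative_familyD(1)[OF R1(1)] derivative_familyD(1)[OF R2(1)] by meson
      from RI[OF this] show "case p of (r, f) \<Rightarrow> \<exists>f'. (r, f, f') \<in> R" using p by auto
    next
      fix p assume "p \<in> R"
      then obtain r f s g f' g' where
        p: "p = (r * s, \<lambda>x. prod (f x) (g x), \<lambda>x h. prod (f' x h) (g x) + prod (f x) (g' x h))"
        "(r, f, f') \<in> R1" "(s, g, g') \<in> R2" unfolding R_def by blast
      have "(r * s, \<lambda>x. prod (f x) (g x)) \<in> ?W"
        using WI derivative_familyD(2)[OF R1(1) p(2)] derivative_familyD(2)[OF R2(1) p(3)] by blast
      moreover have "linear (\<lambda>h. prod (f' x h) (g x) + prod (f x) (g' x h))" if "x \<in> S" for x
      proof -
        have l: "linear (f' x)" "linear (g' x)"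
          using derivative_familyD(3)[OF R1(1) p(2)] derivative_familyD(3)[OF R2(1) p(3)] that by auto
        show ?thesis
          by (rule linearI)
             (simp_all add: linear_add[OF l(1)] linear_add[OF l(2)] linear_cmul[OF l(1)]
                linear_cmul[OF l(2)] add_left add_right scaleR_left scaleR_right algebra_simps)
      qed
      ultimately show "case p of (r, f, f') \<Rightarrow> (r, f) \<in> ?W \<and> (\<forall>x\<in>S. linear (f' x))"
        unfolding p(1) by simp
    next
      fix x and e :: real assume x: "x \<in> S" and e: "e > 0"
      obtain C1 where C1: "C1 \<ge> 0" "\<And>r f. (r, f) \<in> W1 \<Longrightarrow> norm (f x) \<le> C1 * r"
        using pointwise_boundedD[OF b(1) x] by metis
      obtain C2 where C2: "C2 \<ge> 0" "\<And>r f. (r, f) \<in> W2 \<Longrightarrow> norm (f x) \<le> C2 * r"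
        using pointwise_boundedD[OF b(2) x] by metis
      obtain C3 where C3: "C3 \<ge> 0" "\<And>r f. (r, f) \<in> directional R1 \<Longrightarrow> norm (f x) \<le> C3 * r"
        using pointwise_boundedD[OF smooth_family_bounded[OF R1(2)] x] by metis
      obtain C4 where C4: "C4 \<ge> 0" "\<And>r f. (r, f) \<in> directional R2 \<Longrightarrow> norm (f x) \<le> C4 * r"
        using pointwise_boundedD[OF smooth_family_bounded[OF R2(2)] x] by metis
      define M where "M = K * (C1 + (C2 + 1 + C4) + C3 * (1 + C4)) + 1"
      have M: "M > 0" using K(1) C1(1) C2(1) C3(1) C4(1) unfolding M_def
        by (intro add_nonneg_pos mult_nonneg_nonneg) auto
      \<comment> \<open>\<open>d\<close> plays two roles: the tolerance in the remainders of both
        factors and the radius for \<open>h\<close>. \<open>M\<close> collects the resulting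
        constants; its final summand 1 keeps it positive.\<close>
      define d where "d = min 1 (e / M)"
      have d: "d > 0" "d \<le> 1" "d * M \<le> e" using e M by (auto simp: d_def min_def field_simps)
      have "\<forall>\<^sub>F h in nhds (0::'a). norm h < d"
        unfolding eventually_nhds_metric using d by (intro exI[of _ d]) auto
      then show "\<forall>\<^sub>F h in nhds 0. \<forall>(r, f, f')\<in>R. norm (f (x + h) - f x - f' x h) \<le> e * norm h * r"
        using derivative_familyD(4)[OF R1(1) x d(1)] derivative_familyD(4)[OF R2(1) x d(1)]
      proof eventually_elim
        case (elim h)
        have "norm (prod (f (x + h)) (g (x + h)) - prod (f x) (g x)
            - (prod (f' x h) (g x) + prod (f x) (g' x h))) \<le> e * norm h * (r * s)"
          if m: "(r, f, f') \<in> R1" "(s, g, g') \<in> R2" for r f f' s g g'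
        proof -
          define a where "a = f (x + h) - f x - f' x h"
          define c where "c = g (x + h) - g x - g' x h"
          have rs: "r \<ge> 0" "s \<ge> 0"
            using pointwise_bounded_weight[OF b(1)] pointwise_bounded_weight[OF b(2)]
              derivative_familyD(2)[OF R1(1) m(1)] derivative_familyD(2)[OF R2(1) m(2)] by auto
          have h: "norm h \<le> 1" "norm h \<le> d" using elim d by auto
          have f: "norm (f x) \<le> C1 * r" using C1(2) derivative_familyD(2)[OF R1(1) m(1)] by blast
          have g: "norm (g x) \<le> C2 * s" using C2(2) derivative_familyD(2)[OF R2(1) m(2)] by blast
          have f': "norm (f' x h) \<le> C3 * (r * norm h)" using C3(2)[OF directionalI[OF m(1)]] .
          have g': "norm (g' x h) \<le> C4 * (s * norm h)" using C4(2)[OF directionalI[OF m(2)]] .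
          have a: "norm a \<le> d * norm h * r" using elim(2) m(1) unfolding a_def by blast
          have c: "norm c \<le> d * norm h * s" using elim(3) m(2) unfolding c_def by blast
          have dn: "d * norm h * s \<le> 1 * s" "s * norm h \<le> s * 1"
            using d h rs mult_le_one[of d "norm h"] mult_right_mono[of "d * norm h" 1 s]
            by (auto intro!: mult_left_le)
          have "norm (g (x + h)) = norm (g x + g' x h + c)" by (simp add: c_def)
          also have "\<dots> \<le> C2 * s + C4 * (s * norm h) + d * norm h * s"
            using g g' c by (intro norm_triangle_mono)
          also have "\<dots> \<le> (C2 + 1 + C4) * s"
            using dn(1) mult_left_mono[OF dn(2) C4(1)] by (simp add: algebra_simps)
          finally have gh: "norm (g (x + h)) \<le> (C2 + 1 + C4) * s" .
          have "norm (g' x h + c) \<le> C4 * (s * norm h) + d * norm h * s"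
            using g' c by (intro norm_triangle_mono)
          also have "\<dots> \<le> (1 + C4) * (norm h * s)"
            using mult_right_mono[OF d(2), of "norm h * s"] rs by (simp add: algebra_simps)
          finally have gc: "norm (g' x h + c) \<le> (1 + C4) * (norm h * s)" .
          \<comment> \<open>The first two terms contain a remainder and are of order
            \<open>d * norm h\<close>; the third is quadratic in \<open>h\<close>, and one factor
            \<open>norm h\<close> is traded for \<open>d\<close>.\<close>
          have "prod (f (x + h)) (g (x + h)) - prod (f x) (g x)
              - (prod (f' x h) (g x) + prod (f x) (g' x h))
              = prod a (g (x + h)) + prod (f x) c + prod (f' x h) (g' x h + c)"
            unfolding a_def c_def by (simp add: add_left add_right diff_left diff_right)
          also have "norm \<dots> \<le> (d * norm h * r) * ((C2 + 1 + C4) * s) * K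
              + (C1 * r) * (d * norm h * s) * K + (C3 * (r * norm h)) * ((1 + C4) * (norm h * s)) * K"
            by (intro norm_triangle_mono order_trans[OF K(2)] mult_right_mono mult_mono a gh f c f' gc)
               (use K(1) C1(1) C2(1) C3(1) C4(1) d(1) rs in \<open>auto intro!: mult_nonneg_nonneg\<close>)
          also have "\<dots> = K * (norm h * (r * s)) * (d * (C2 + 1 + C4) + d * C1
              + norm h * (C3 * (1 + C4)))"
            by (simp add: algebra_simps)
          also have "\<dots> \<le> K * (norm h * (r * s)) * (d * (C2 + 1 + C4) + d * C1 + d * (C3 * (1 + C4)))"
            using h(2) K(1) C3(1) C4(1) rs
            by (intro mult_left_mono add_left_mono mult_right_mono) auto
          also have "\<dots> = (d * (M - 1)) * (norm h * (r * s))"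
            unfolding M_def by (simp add: algebra_simps)
          also have "\<dots> \<le> e * (norm h * (r * s))"
            using d M rs by (intro mult_right_mono) (auto simp: algebra_simps)
          finally show ?thesis by (simp add: mult_ac)
        qed
        then show ?case unfolding R_def by auto
      qed
    qed
    moreover have "smooth_family n S (directional R)"
    proof (rule smooth_family_subset[OF assms(1) smooth_family_add[OF assms(1)
            Suc.IH[OF R1(2) smooth_family_Suc_imp[OF Suc.prems(2)]]
            Suc.IH[OF smooth_family_Suc_imp[OF Suc.prems(1)] R2(2)]]], rule subsetI)
      fix p assume "p \<in> directional R"
      then obtain r k k' h where k: "(r, k, k') \<in> R" "p = (r * norm h, \<lambda>x. k' x h)"
        by (rule directionalE)
      then obtain q f s g f' g' where "r = q * s"
        "k' = (\<lambda>x h. prod (f' x h) (g x) + prod (f x) (g' x h))"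
        and m: "(q, f, f') \<in> R1" "(s, g, g') \<in> R2"
        unfolding R_def by blast
      then have p: "p = ((q * s) * norm h, \<lambda>x. prod (f' x h) (g x) + prod (f x) (g' x h))"
        using k by simp
      have "((q * norm h) * s, \<lambda>x. prod (f' x h) (g x))
          \<in> family_prod prod (directional R1) W2"
        using directionalI[OF m(1), of h] derivative_familyD(2)[OF R2(1) m(2)]
        by (intro CollectI exI[of _ "q * norm h"] exI[of _ "\<lambda>x. f' x h"] exI[of _ s] exI[of _ g]) simp
      moreover have "(q * (s * norm h), \<lambda>x. prod (f x) (g' x h))
          \<in> family_prod prod W1 (directional R2)"
        using directionalI[OF m(2), of h] derivative_familyD(2)[OF R1(1) m(1)]
        by (intro CollectI exI[of _ q] exI[of _ f] exI[of _ "s * norm h"] exI[of _ "\<lambda>x. g' x h"]) simp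
      ultimately show "p \<in> (family_sum (family_prod prod (directional R1) W2)
          (family_prod prod W1 (directional R2)))"
        unfolding p
        by (intro CollectI exI[of _ "q * s * norm h"] exI[of _ "\<lambda>x. prod (f' x h) (g x)"]
            exI[of _ "\<lambda>x. prod (f x) (g' x h)"]) (simp add: mult_ac)
    qed
    ultimately show ?case using bounded[OF b] by auto
  }
qed

text \<open>The map becomes bilinear as \<open>a *\<^sub>R T c\<close>; the product rule with the
  constant function 1 as the scalar factor then gives the claim.\<close>

lemma smooth_family_linear:
  assumes "open S" "bounded_linear T" "smooth_family n S W"
  shows "smooth_family n S {(r, \<lambda>x. T (f x)) | r f. (r, f) \<in> W}"
proof -
  have "bounded_bilinear (\<lambda>a c. a *\<^sub>R T c)"
    using bounded_bilinear.comp[OF bounded_bilinear_scaleR bounded_linear_ident assms(2)] .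
  moreover have "smooth_family n S {(r, (\<lambda>_. c) :: 'a \<Rightarrow> real) | r c. (r, c) \<in> {(1, 1)}}"
    by (rule smooth_family_const[of _ 1]) auto
  ultimately have "smooth_family n S {(r * s, \<lambda>x. f x *\<^sub>R T (g x)) | r f s g.
      (r, f) \<in> {(r, \<lambda>_. c) | r c. (r, c) \<in> {(1, 1)}} \<and> (s, g) \<in> W}"
    using smooth_family_bilinear[OF assms(1) _ _ assms(3)] by blast
  then show ?thesis
    by (rule smooth_family_subset[OF assms(1)])
       (intro subsetI, elim CollectE exE conjE,
        rule CollectI, rule exI[of _ 1], rule exI[of _ "\<lambda>_. 1"], auto)
qed

lemma smooth_family_SucI:
  assumes d: "\<And>x. x \<in> S \<Longrightarrow> (f has_derivative f' x) (at x)"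
    and f': "smooth_family n S (range (\<lambda>h. (norm h, \<lambda>x. f' x h)))"
  shows "smooth_family (Suc n) S {(1, f)}"
proof -
  have "derivative_family S {(1, f)} {(1, f, f')}"
    unfolding derivative_family_def
    using has_derivative_nhdsD[OF d] d by (auto intro: has_derivative_linear)
  moreover have "directional {(1, f, f')} = range (\<lambda>h. (norm h, \<lambda>x. f' x h))"
    unfolding directional_def by auto
  moreover have "pointwise_bounded S {(1, f)}"
    unfolding pointwise_bounded_def by (auto intro!: exI[of _ "norm (f _)"])
  ultimately show ?thesis using f' by auto
qed

lemma smooth_family_zero: "smooth_family 0 S {(1, f)}"
  unfolding smooth_family.simps pointwise_bounded_def by (auto intro!: exI[of _ "norm (f _)"])

section \<open>From families back to multilinear derivatives\<close>

primrec iterated_derivative ::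
    "('a::real_normed_vector \<Rightarrow> 'b::real_normed_vector) \<Rightarrow> 'a list \<Rightarrow> 'a \<Rightarrow> 'b" where
  "iterated_derivative f [] = f"
| "iterated_derivative f (h # vs) = (\<lambda>x. frechet_derivative (iterated_derivative f vs) (at x) h)"

text \<open>The relations provided by \<open>smooth_family\<close> depend on the order and are not
  canonical. Iterated Frechet derivatives are, and by uniqueness they agree on \<open>S\<close> with
  whatever a relation offers; so they tie all orders together into the single \<open>D\<close> of
  \<open>smooth_on\<close>.\<close>

lemma smooth_onI:
  assumes S: "open S" and f: "\<And>n. smooth_family n S {(1, f)}"
  shows "smooth_on S f"
proof -
  let ?D = "iterated_derivative f"
  define W where "W = (\<lambda>k. {(prod_list (map norm vs), ?D vs) | vs. length vs = k})"
  have WI: "(prod_list (map norm vs), ?D vs) \<in> W (length vs)" for vs unfolding W_def by blast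
  have frechet: "frechet_derivative g (at x) = f' x" "(g has_derivative f' x) (at x)"
    if "derivative_family S V R" "pointwise_bounded S V" "pointwise_bounded S (directional R)"
      "(r, g, f') \<in> R" "x \<in> S" for V R r g f' x
    using derivative_family_has_derivative[OF that] frechet_derivative_at by metis+
  have W: "smooth_family n S (W k)" for n k
  proof (induction k arbitrary: n)
    case 0
    have "W 0 = {(1, f)}" unfolding W_def by auto
    then show ?case using f by simp
  next
    case (Suc k)
    from Suc[of "Suc n"] obtain R where R: "derivative_family S (W k) R"
      "pointwise_bounded S (W k)" "smooth_family n S (directional R)" by auto
    note b = smooth_family_bounded[OF R(3)]
    show ?case
    proof (rule smooth_family_cong[OF S R(3)])
      fix r g assume "(r, g) \<in> W (Suc k)"
      then obtain h vs where g: "r = norm h * prod_list (map norm vs)" "g = ?D (h # vs)" "length vs = k"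
        unfolding W_def by (auto simp: length_Suc_conv)
      obtain f' where f': "(prod_list (map norm vs), ?D vs, f') \<in> R"
        using derivative_familyD(1)[OF R(1)] WI[of vs] g(3) by blast
      have "(r, \<lambda>x. f' x h) \<in> directional R"
        using directionalI[OF f', of h] g(1) by (simp add: mult.commute)
      moreover have "\<forall>x\<in>S. g x = f' x h"
        using frechet(1)[OF R(1,2) b f'] g(2) by simp
      ultimately show "\<exists>f. (r, f) \<in> directional R \<and> (\<forall>x\<in>S. g x = f x)"
        by (intro exI[of _ "\<lambda>x. f' x h"]) simp
    qed
  qed
  have diff: "(?D vs has_derivative (\<lambda>h. ?D (h # vs) x)) (at x)" if x: "x \<in> S" for vs x
  proof -
    from W[of "Suc 0" "length vs"] obtain R where R: "derivative_family S (W (length vs)) R"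
      "pointwise_bounded S (W (length vs))" "pointwise_bounded S (directional R)" by auto
    obtain f' where f': "(prod_list (map norm vs), ?D vs, f') \<in> R"
      using derivative_familyD(1)[OF R(1) WI] by blast
    have "(\<lambda>h. ?D (h # vs) x) = f' x" using frechet(1)[OF R f' x] by simp
    then show ?thesis using frechet(2)[OF R f' x] by simp
  qed
  \<comment> \<open>The newest direction is linear because it is the argument of a derivative. An
    older slot inherits linearity: its identity holds on all of the open set \<open>S\<close>, both
    sides are differentiated, and derivatives are unique.\<close>
  have lin: "\<forall>x\<in>S. linear (\<lambda>h. ?D (vs @ h # ws) x)" for vs ws
  proof (induction vs)
    case Nil
    then show ?case using has_derivative_linear[OF diff] by simp
  next
    case (Cons v vs)
    show ?case
    proof (intro ballI linearI)
      fix x h1 h2 and c :: real assume x: "x \<in> S"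
      have "(?D (vs @ (h1 + h2) # ws) has_derivative
          (\<lambda>h. ?D (h # vs @ h1 # ws) x + ?D (h # vs @ h2 # ws) x)) (at x)"
        by (rule has_derivative_transform_within_open[OF
            has_derivative_add[OF diff[OF x] diff[OF x]] S x])
           (simp add: linear_add[OF bspec[OF Cons.IH]])
      from fun_cong[OF has_derivative_unique[OF diff[OF x] this], of v]
      show "?D ((v # vs) @ (h1 + h2) # ws) x = ?D ((v # vs) @ h1 # ws) x + ?D ((v # vs) @ h2 # ws) x"
        by simp
      have "(?D (vs @ (c *\<^sub>R h1) # ws) has_derivative
          (\<lambda>h. c *\<^sub>R ?D (h # vs @ h1 # ws) x)) (at x)"
        by (rule has_derivative_transform_within_open[OF has_derivative_scaleR_right[OF diff[OF x]] S x])
           (simp add: linear_cmul[OF bspec[OF Cons.IH]])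
      from fun_cong[OF has_derivative_unique[OF diff[OF x] this], of v]
      show "?D ((v # vs) @ (c *\<^sub>R h1) # ws) x = c *\<^sub>R ?D ((v # vs) @ h1 # ws) x"
        by simp
    qed
  qed
  show ?thesis
    unfolding smooth_on_def
  proof (intro conjI exI[of _ "\<lambda>x vs. ?D vs x"] ballI allI impI)
    fix x :: 'a and k :: nat assume x: "x \<in> S"
    obtain C where C: "\<And>r f. (r, f) \<in> W k \<Longrightarrow> norm (f x) \<le> C * r"
      using pointwise_boundedD[OF smooth_family_bounded[OF W] x, of k] by metis
    show "bounded_multilinear k (\<lambda>vs. ?D vs x)"
      unfolding bounded_multilinear_def
      using lin x C WI by (intro conjI allI impI exI[of _ C]) blast+
    fix e :: real assume e: "e > 0"
    from W[of "Suc 0" k] obtain R where R: "derivative_family S (W k) R"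
      "pointwise_bounded S (W k)" "pointwise_bounded S (directional R)" by auto
    from derivative_familyD(4)[OF R(1) x e]
    show "\<forall>\<^sub>F h in nhds 0. \<forall>vs. length vs = k \<longrightarrow>
        norm (?D vs (x + h) - ?D vs x - ?D (h # vs) x) \<le> e * norm h * prod_list (map norm vs)"
    proof eventually_elim
      case (elim h)
      show ?case
      proof (intro allI impI)
        fix vs :: "'a list" assume "length vs = k"
        then obtain f' where f': "(prod_list (map norm vs), ?D vs, f') \<in> R"
          using derivative_familyD(1)[OF R(1)] WI[of vs] by blast
        have "?D (h # vs) x = f' x h" using frechet(1)[OF R f' x] by simp
        then show "norm (?D vs (x + h) - ?D vs x - ?D (h # vs) x) \<le> e * norm h * prod_list (map norm vs)"
          using elim f' by auto
      qed
    qed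
  qed (use S in auto)
qed

section \<open>Continuous functions on the circle\<close>

lemma periodic_add_int:
  fixes g :: "real \<Rightarrow> 'a"
  assumes "\<And>t. g (t + 1) = g t"
  shows "g (t + of_int n) = g t"
proof (induction n rule: int_induct[where k = 0])
  case (step1 i)
  then show ?case using assms[of "t + of_int i"] by (simp add: add.assoc)
next
  case (step2 i)
  then show ?case using assms[of "t + of_int i - 1"] by (simp add: algebra_simps)
qed simp

lemma periodic_rep_circle:
  fixes g :: "real \<Rightarrow> 'a"
  assumes "\<And>t. g (t + 1) = g t"
  shows "g (rep_circle (circle_of s)) = g s"
proof -
  have "rep_circle (circle_of s) - s \<in> \<int>"
    by (simp add: circle_of_eq_iff[symmetric])
  then obtain n :: int where "rep_circle (circle_of s) - s = of_int n" by (auto elim: Ints_cases)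
  then have "rep_circle (circle_of s) = s + of_int n" by simp
  then show ?thesis using periodic_add_int[of g, OF assms] by simp
qed

lemma circle_of_add_1 [simp]: "circle_of (t + 1) = circle_of t"
  using circle_of_add_int[of t 1] by simp

lemma circle_of_1 [simp]: "circle_of 1 = circle_of 0"
  using circle_of_add_1[of 0] by simp

lemma continuous_on_circle_of_compose [continuous_intros]:
  "continuous_on A f \<Longrightarrow> continuous_on A (\<lambda>x. circle_of (f x))"
  by (rule continuous_on_compose2[OF continuous_on_circle_of[of UNIV]]) auto

lemma circle_of_cases:
  obtains t where "t \<in> {0..1}" "x = circle_of t"
  using circle_of_unit_interval by blast

lemma apply_Bcontfun:
  fixes u :: "circle \<Rightarrow> real"
  shows "continuous_on UNIV u \<Longrightarrow> apply_bcontfun (Bcontfun u) = u"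
  by (rule Bcontfun_inverse) (rule continuous_in_bcontfun)

lemma c0_of_periodic:
  fixes g :: "real \<Rightarrow> real"
  assumes "continuous_on UNIV g" "\<And>t. g (t + 1) = g t"
  obtains c :: c0 where "\<And>t. c (circle_of t) = g t"
proof
  have e: "g (rep_circle (circle_of t)) = g t" for t
    by (rule periodic_rep_circle[of g, OF assms(2)])
  then have "continuous_on UNIV (\<lambda>x. g (rep_circle x))"
    using assms(1) by (simp add: circle_of_continuous_iff)
  then show "apply_bcontfun (Bcontfun (\<lambda>x. g (rep_circle x))) (circle_of t) = g t" for t
    by (simp add: apply_Bcontfun e)
qed

text \<open>\<open>g\<close> composed with \<open>frac\<close> is continuous although
  \<open>frac\<close> is not: the preimage of a closed set is a compact subset of
  \<open>[0, 1]\<close> translated by all integers, and the sum of a compact and a closed set is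
  closed. The condition \<open>g 0 = g 1\<close> repairs the jump.\<close>

lemma c0_of_interval:
  fixes g :: "real \<Rightarrow> real"
  assumes "continuous_on {0..1} g" "g 0 = g 1"
  obtains c :: c0 where "\<And>t. t \<in> {0..1} \<Longrightarrow> c (circle_of t) = g t"
proof -
  have "closed ((\<lambda>t. g (frac t)) -` C)" if "closed C" for C
  proof -
    define K where "K = {0..1} \<inter> g -` C"
    have "closed K" unfolding K_def
      by (rule continuous_closed_preimage[OF assms(1)]) (use \<open>closed C\<close> in auto)
    then have K: "compact K"
      using compact_Int_closed[OF compact_Icc, of K 0 1] by (simp add: K_def Int_assoc[symmetric])
    have "(\<lambda>t. g (frac t)) -` C = (\<Union>x\<in>K. \<Union>n\<in>\<int>. {x + n})"
    proof (intro set_eqI iffI)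
      fix t assume "t \<in> (\<lambda>t. g (frac t)) -` C"
      then have "frac t \<in> K" using frac_lt_1[of t] by (simp add: K_def less_imp_le)
      moreover have "t = frac t + of_int \<lfloor>t\<rfloor>" by (simp add: frac_def)
      ultimately show "t \<in> (\<Union>x\<in>K. \<Union>n\<in>\<int>. {x + n})"
        by (metis UN_iff Ints_of_int singletonI)
    next
      fix t assume "t \<in> (\<Union>x\<in>K. \<Union>n\<in>\<int>. {x + n})"
      then obtain x and n :: int where x: "x \<in> {0..1}" "g x \<in> C" "t = x + of_int n"
        by (auto simp: K_def Ints_def)
      have "frac t = frac x" by (simp add: x(3) frac_def)
      moreover have "frac x = (if x = 1 then 0 else x)" using x(1) by (auto simp: frac_eq)
      ultimately have "g (frac t) = g x" using assms(2) by metis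
      then show "t \<in> (\<lambda>t. g (frac t)) -` C" using x by simp
    qed
    then show ?thesis using compact_closed_sums[OF K closed_Ints] by simp
  qed
  then have "continuous_on UNIV (\<lambda>t. g (frac t))" by (simp add: continuous_on_closed_vimage)
  moreover have "g (frac (t + 1)) = g (frac t)" for t by (simp add: frac_def)
  ultimately obtain c :: c0 where c: "\<And>t. c (circle_of t) = g (frac t)"
    using c0_of_periodic[of "\<lambda>t. g (frac t)"] by blast
  show thesis
  proof
    fix t :: real assume "t \<in> {0..1}"
    then show "c (circle_of t) = g t"
      using c assms(2) by (cases "t = 1") (auto simp: frac_eq)
  qed
qed

lemma c0_eqI:
  fixes c d :: c0
  assumes "\<And>t. t \<in> {0..1} \<Longrightarrow> c (circle_of t) = d (circle_of t)"
  shows "c = d"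
  using assms by (metis bcontfun_eqI circle_of_cases)

lemma c0_abs_le_norm: "\<bar>apply_bcontfun (c :: c0) t\<bar> \<le> norm c"
  using norm_bounded[of c t] by simp

lemma c0_norm_le:
  fixes c :: c0
  assumes "\<And>t. t \<in> {0..1} \<Longrightarrow> \<bar>c (circle_of t)\<bar> \<le> b"
  shows "norm c \<le> b"
proof (rule norm_bound)
  fix x show "norm (c x) \<le> b" using circle_of_cases[of x] assms by (metis real_norm_def)
qed

text \<open>Completeness is transported from the bounded continuous functions on the real line:
  composition with \<open>circle_of\<close> is isometric, and its image, the periodic functions, is
  closed under pointwise limits.\<close>

lemma c0_Cauchy_convergent:
  fixes X :: "nat \<Rightarrow> c0"
  assumes "Cauchy X"
  shows "convergent X"
proof -
  define lift :: "c0 \<Rightarrow> (real \<Rightarrow>\<^sub>C real)" where "lift = (\<lambda>c. Bcontfun (\<lambda>t. c (circle_of t)))"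
  have lift: "lift c t = c (circle_of t)" for c t
  proof -
    have "continuous_on UNIV (\<lambda>t. c (circle_of t))"
      using circle_of_continuous_iff[of c] by simp
    then have "(\<lambda>t. c (circle_of t)) \<in> bcontfun"
      by (rule bcontfun_normI[of _ "norm c"]) (simp add: c0_abs_le_norm)
    then show ?thesis unfolding lift_def by (simp add: Bcontfun_inverse)
  qed
  have dist: "dist (lift c) (lift d) = dist c d" for c d
  proof (rule antisym)
    show "dist (lift c) (lift d) \<le> dist c d"
      by (rule dist_bound) (use dist_bounded[of c _ d] in \<open>simp add: lift\<close>)
    show "dist c d \<le> dist (lift c) (lift d)"
    proof (rule dist_bound)
      fix x
      show "dist (c x) (d x) \<le> dist (lift c) (lift d)"
        using dist_bounded[of "lift c" "rep_circle x" "lift d"] by (simp add: lift)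
    qed
  qed
  have "Cauchy (\<lambda>n. lift (X n))"
    using assms by (simp add: Cauchy_def dist)
  then obtain y where y: "(\<lambda>n. lift (X n)) \<longlonglongrightarrow> y"
    using Cauchy_convergent convergent_def by blast
  have "(\<lambda>n. lift (X n) t) \<longlonglongrightarrow> y t" for t
    by (rule tendsto_uniform_limitI[OF tendsto_bcontfun_uniform_limit[OF y] UNIV_I])
  then have "(\<lambda>n. X n (circle_of t)) \<longlonglongrightarrow> y t" for t by (simp add: lift)
  note lim = this
  have "y (t + 1) = y t" for t
    using LIMSEQ_unique[OF lim[of "t + 1", unfolded circle_of_add_1] lim[of t]] .
  then obtain c :: c0 where "\<And>t. c (circle_of t) = y t"
    using c0_of_periodic[of y] by (metis continuous_on_apply_bcontfun)
  then have "y = lift c" by (intro bcontfun_eqI) (simp add: lift)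
  then have "(\<lambda>n. dist (lift (X n)) (lift c)) \<longlonglongrightarrow> 0"
    by (metis y tendsto_dist_iff)
  then have "X \<longlonglongrightarrow> c" unfolding dist by (rule iffD2[OF tendsto_dist_iff])
  then show ?thesis by (rule convergentI)
qed

lemma c0_complete: "complete (UNIV :: c0 set)"
  using c0_Cauchy_convergent by (auto simp: complete_def convergent_def)

definition c0_mult :: "c0 \<Rightarrow> c0 \<Rightarrow> c0" where
  "c0_mult c d = Bcontfun (\<lambda>t. c t * d t)"

lemma c0_mult_apply [simp]: "apply_bcontfun (c0_mult c d) t = c t * d t"
  unfolding c0_mult_def by (subst apply_Bcontfun) (intro continuous_intros, auto)

lemma bounded_bilinear_c0_mult: "bounded_bilinear c0_mult"
proof (unfold_locales)
  show "\<exists>K. \<forall>a b. norm (c0_mult a b) \<le> norm a * norm b * K"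
    by (intro exI[of _ 1] allI c0_norm_le)
       (simp add: abs_mult mult_mono c0_abs_le_norm)
qed (auto intro!: bcontfun_eqI simp: algebra_simps)

text \<open>The superposition (Nemytskii) operator.\<close>

definition nem :: "(circle \<times> real \<Rightarrow> real) \<Rightarrow> c0 \<Rightarrow> c0" where
  "nem g c = Bcontfun (\<lambda>t. g (t, c t))"

abbreviation slice :: "(circle \<times> real \<Rightarrow> real) \<Rightarrow> real \<Rightarrow> c0" where
  "slice g x \<equiv> nem g (const_bcontfun x)"

lemma nem_apply:
  assumes "continuous_on UNIV g"
  shows "apply_bcontfun (nem g c) t = g (t, c t)"
proof -
  have "continuous_on UNIV (\<lambda>t. g (t, c t))"
    by (intro continuous_on_compose2[OF assms] continuous_intros) auto
  then show ?thesis unfolding nem_def by (subst apply_Bcontfun) auto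
qed

lemma cylinder_uniformly_continuous:
  fixes g :: "circle \<times> real \<Rightarrow> real"
  assumes "continuous_on UNIV g" "e > 0"
  obtains d where "d > 0" "\<And>t x y. \<bar>x\<bar> \<le> R \<Longrightarrow> \<bar>x - y\<bar> < d \<Longrightarrow> \<bar>g (t, x) - g (t, y)\<bar> < e"
proof -
  \<comment> \<open>The rectangle has a margin of 1 around \<open>[- R, R]\<close>; together with
    \<open>min d 1\<close> it contains the second point \<open>y\<close>, which is not assumed to be
    bounded by \<open>R\<close>.\<close>
  let ?K = "{0..1} \<times> {- (R + 1)..R + 1}"
  have "continuous_on ?K (\<lambda>(s, x). g (circle_of s, x))"
    unfolding case_prod_beta
    by (intro continuous_on_compose2[OF assms(1)] continuous_intros) auto
  then have "uniformly_continuous_on ?K (\<lambda>(s, x). g (circle_of s, x))"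
    by (intro compact_uniformly_continuous compact_Times) auto
  from uniformly_continuous_onE[OF this assms(2)] obtain d where d: "d > 0"
    "\<And>p q. p \<in> ?K \<Longrightarrow> q \<in> ?K \<Longrightarrow> dist q p < d \<Longrightarrow>
      dist (case q of (s, x) \<Rightarrow> g (circle_of s, x)) (case p of (s, x) \<Rightarrow> g (circle_of s, x)) < e"
    by metis
  show thesis
  proof (rule that[of "min d 1"])
    fix t x y assume xy: "\<bar>x\<bar> \<le> R" "\<bar>x - y\<bar> < min d 1"
    obtain s where s: "s \<in> {0..1}" "t = circle_of s" by (rule circle_of_cases)
    have "dist (s, x) (s, y) < d" using xy by (simp add: dist_Pair_Pair dist_real_def)
    moreover have "(s, x) \<in> ?K" "(s, y) \<in> ?K" using xy s by auto
    ultimately show "\<bar>g (t, x) - g (t, y)\<bar> < e"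
      using d(2)[of "(s, y)" "(s, x)"] s by (simp add: dist_real_def)
  qed (use d in auto)
qed

lemma continuous_on_nem:
  assumes g: "continuous_on UNIV g"
  shows "continuous_on UNIV (nem g)"
  unfolding continuous_on_iff
proof (intro ballI allI impI)
  fix c :: c0 and e :: real assume "e > 0"
  then have "e / 2 > 0" by simp
  then obtain d where d: "d > 0"
    "\<And>t x y. \<bar>x\<bar> \<le> norm c \<Longrightarrow> \<bar>x - y\<bar> < d \<Longrightarrow> \<bar>g (t, x) - g (t, y)\<bar> < e / 2"
    using cylinder_uniformly_continuous[OF g] by metis
  show "\<exists>d>0. \<forall>c'\<in>UNIV. dist c' c < d \<longrightarrow> dist (nem g c') (nem g c) < e"
  proof (intro exI[of _ d] conjI ballI impI d(1))
    fix c' assume c': "dist c' c < d"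
    have "dist (nem g c') (nem g c) \<le> e / 2"
    proof (rule dist_bound)
      fix t
      have "\<bar>c t - c' t\<bar> < d"
        using dist_bounded[of c t c'] c' by (simp add: dist_real_def dist_commute)
      then show "dist (nem g c' t) (nem g c t) \<le> e / 2"
        using d(2)[of "c t" "c' t" t, OF c0_abs_le_norm]
          by (simp add: nem_apply[OF g] dist_real_def abs_minus_commute)
    qed
    then show "dist (nem g c') (nem g c) < e" using \<open>e > 0\<close> by simp
  qed
qed

lemma nem_has_derivative:
  assumes g: "continuous_on UNIV g" and g': "continuous_on UNIV g'"
    and d: "\<And>t x. ((\<lambda>y. g (t, y)) has_real_derivative g' (t, x)) (at x)"
  shows "(nem g has_derivative (\<lambda>h. c0_mult (nem g' c) h)) (at c)"
proof -
  interpret mult: bounded_bilinear c0_mult by (rule bounded_bilinear_c0_mult)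
  show ?thesis
    unfolding has_derivative_at_alt
  proof (intro conjI allI impI)
    show "bounded_linear (\<lambda>h. c0_mult (nem g' c) h)" by (rule mult.bounded_linear_right)
    fix e :: real assume "e > 0"
    then obtain r where r: "r > 0"
      "\<And>t x y. \<bar>x\<bar> \<le> norm c \<Longrightarrow> \<bar>x - y\<bar> < r \<Longrightarrow> \<bar>g' (t, x) - g' (t, y)\<bar> < e"
      using cylinder_uniformly_continuous[OF g'] by metis
    show "\<exists>r>0. \<forall>y. norm (y - c) < r \<longrightarrow>
        norm (nem g y - nem g c - c0_mult (nem g' c) (y - c)) \<le> e * norm (y - c)"
    proof (intro exI[of _ r] conjI allI impI r(1))
      fix y assume y: "norm (y - c) < r"
      show "norm (nem g y - nem g c - c0_mult (nem g' c) (y - c)) \<le> e * norm (y - c)"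
      proof (rule norm_bound)
        fix t
        \<comment> \<open>Mean value inequality for \<open>g\<close> minus its linear part at
          \<open>c t\<close>: the derivative of \<open>?k\<close> is an increment of
          \<open>g'\<close>, uniformly small in \<open>t\<close>.\<close>
        let ?k = "\<lambda>x. g (t, x) - g' (t, c t) * x"
        have yc: "\<bar>y t - c t\<bar> \<le> norm (y - c)" using c0_abs_le_norm[of "y - c" t] by simp
        have "norm (?k (y t) - ?k (c t)) \<le> e * norm (y t - c t)"
        proof (rule field_differentiable_bound[where S = "closed_segment (c t) (y t)"
              and f' = "\<lambda>x. g' (t, x) - g' (t, c t)"])
          fix x assume x: "x \<in> closed_segment (c t) (y t)"
          show "(?k has_field_derivative g' (t, x)
              - g' (t, c t)) (at x within closed_segment (c t) (y t))"
            by (auto intro!: derivative_eq_intros has_field_derivative_at_within[OF d])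
          have "\<bar>c t - x\<bar> \<le> \<bar>y t - c t\<bar>"
            using x by (auto simp: closed_segment_eq_real_ivl split: if_splits)
          then show "norm (g' (t, x) - g' (t, c t)) \<le> e"
            using r(2)[of "c t" x t, OF c0_abs_le_norm] yc y by simp
        qed auto
        also have "\<dots> \<le> e * norm (y - c)" using yc \<open>e > 0\<close> by (intro mult_left_mono) auto
        finally show "norm ((nem g y - nem g c - c0_mult (nem g' c) (y - c)) t) \<le> e * norm (y - c)"
          by (simp add: nem_apply[OF g] nem_apply[OF g'] algebra_simps)
      qed
    qed
  qed
qed

section \<open>Periodic solutions of uniformly monotone equations\<close>

lemma continuous_on_c0_lift [continuous_intros]:
    "continuous_on A (\<lambda>s. apply_bcontfun (c :: c0) (circle_of s))"
  by (rule continuous_on_subset[OF circle_of_continuous_iff[THEN iffD1]]) auto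

lemma antiderivative_exists:
  fixes q :: "real \<Rightarrow> real"
  assumes "continuous_on UNIV q"
  obtains Q where "\<And>s. (Q has_real_derivative q s) (at s)"
proof -
  have "isCont q x" for x using assms by (simp add: continuous_on_eq_continuous_at)
  then obtain Q where "\<forall>x. (Q has_vector_derivative q x) (at x)"
    using einterval_antiderivative[of "-\<infinity>" "\<infinity>" q] by auto
  then show thesis using that[of Q] by (simp add: has_real_derivative_iff_has_vector_derivative)
qed

text \<open>For negative \<open>t\<close> the interval is empty and the value 0, so this is a
  primitive on nonnegative arguments only. Statements about its derivative are therefore made within
  \<open>{0..1}\<close>.\<close>

definition prim_C :: "c0 \<Rightarrow> real \<Rightarrow> real" where
  "prim_C v t = integral {0..t} (\<lambda>s. v (circle_of s))"

lemma c0_lift_integrable: "(\<lambda>s. apply_bcontfun (v :: c0) (circle_of s)) integrable_on {a..b}"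
  by (intro integrable_continuous_real continuous_on_c0_lift)

lemma prim_C_diff:
  assumes "0 \<le> s" "s \<le> t"
  shows "\<bar>prim_C v t - prim_C v s\<bar> \<le> norm v * (t - s)"
proof -
  have "prim_C v t - prim_C v s = integral {s..t} (\<lambda>s. v (circle_of s))"
    unfolding prim_C_def using
        Henstock_Kurzweil_Integration.integral_combine[OF assms c0_lift_integrable]
        by (simp add: algebra_simps)
  moreover have "norm (integral {s..t} (\<lambda>s. v (circle_of s))) \<le> norm v * (t - s)"
    by (rule integral_bound[OF assms(2) continuous_on_c0_lift]) (simp add: c0_abs_le_norm)
  ultimately show ?thesis by simp
qed

lemma prim_C_has_derivative:
  "t \<in> {0..1} \<Longrightarrow> (prim_C c has_real_derivative c (circle_of t)) (at t within {0..1})"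
  unfolding prim_C_def[abs_def]
  by (rule integral_has_real_derivative) (auto intro: continuous_on_c0_lift)

text \<open>Periodicity of the antiderivative is what turns an identity on \<open>[0, 1]\<close> into a global one.\<close>

lemma has_circle_derivative_prim:
  fixes c v :: c0
  assumes "\<And>t. t \<in> {0..1} \<Longrightarrow> prim_C v t = c (circle_of t) - c (circle_of 0)"
  shows "has_circle_derivative c v"
proof -
  obtain A where A: "\<And>s. (A has_real_derivative v (circle_of s)) (at s)"
    using antiderivative_exists[OF continuous_on_c0_lift] by metis
  have prim: "prim_C v t = A t - A 0" if "0 \<le> t" for t
    unfolding prim_C_def using that
    by (intro integral_unique fundamental_theorem_of_calculus)
       (auto simp: has_real_derivative_iff_has_vector_derivative[symmetric] intro:
           has_field_derivative_at_within A)
  have A1: "((\<lambda>s. A (s + 1)) has_real_derivative v (circle_of s)) (at s)" for s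
    using A[of "s + 1"] by (simp add: DERIV_shift)
  have "((\<lambda>s. A (s + 1) - A s) has_real_derivative 0) (at s)" for s
    by (rule DERIV_cong, rule DERIV_diff[OF A1 A]) simp
  then have "A (s + 1) - A s = A (0 + 1) - A 0" for s
    using DERIV_isconst_all[of "\<lambda>s. A (s + 1) - A s" s 0] by blast
  moreover have "A 1 = A 0" using prim[of 1] assms[of 1] by simp
  ultimately have per: "A (s + 1) = A s" for s by simp
  have "continuous_on UNIV A"
    using A DERIV_isCont by (blast intro: continuous_at_imp_continuous_on)
  then have "continuous_on UNIV (\<lambda>t. c (circle_of 0) + (A t - A 0))"
    by (intro continuous_intros)
  then obtain d :: c0 where d: "\<And>t. d (circle_of t) = c (circle_of 0) + (A t - A 0)"
    by (rule c0_of_periodic) (simp add: per, blast)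
  have "d = c"
  proof (rule c0_eqI)
    fix t :: real assume "t \<in> {0..1}"
    then show "d (circle_of t) = c (circle_of t)"
      unfolding d using assms[of t] prim[of t] by simp
  qed
  with d have c: "(\<lambda>t. c (circle_of t)) = (\<lambda>t. c (circle_of 0) + (A t - A 0))" by metis
  have "((\<lambda>t. c (circle_of 0) + (A t - A 0)) has_real_derivative v (circle_of s)) (at s)" for s
    by (auto intro!: derivative_eq_intros A)
  then show ?thesis
    unfolding has_circle_derivative_def c by blast
qed

lemma periodic_linear_solution_exists:
  fixes q :: c0
  assumes "l > 0"
  obtains y :: c0 where "has_circle_derivative y (l *\<^sub>R (q - y))"
proof -
  obtain Q where Q: "\<And>s. (Q has_real_derivative exp (l * s) * (l * q (circle_of s))) (at s)"
    by (rule antiderivative_exists[of "\<lambda>s. exp (l * s) * (l * q (circle_of s))"])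
       (intro continuous_intros, blast)
  \<comment> \<open>Variation of constants; \<open>k\<close> is the solution of
    \<open>y 0 = y 1\<close>, which exists because \<open>exp (- l)\<close> differs from 1.\<close>
  define k where "k = (exp (- l) * Q 1 - Q 0) / (1 - exp (- l))"
  define y where "y = (\<lambda>s. exp (- (l * s)) * (Q s + k))"
  have dy: "(y has_real_derivative l * (q (circle_of s) - y s)) (at s)" for s
  proof -
    have "(y has_real_derivative (- l * exp (- (l * s))) * (Q s + k) +
        (exp (l * s) * (l * q (circle_of s)) + 0) * exp (- (l * s))) (at s)"
      unfolding y_def by (intro DERIV_mult DERIV_add DERIV_const Q) (auto intro!: derivative_eq_intros)
    then show ?thesis by (rule DERIV_cong) (simp add: y_def exp_minus field_simps)
  qed
  have "k * (1 - exp (- l)) = exp (- l) * Q 1 - Q 0" using assms by (simp add: k_def)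
  then have "y 0 = y 1" by (simp add: y_def algebra_simps)
  moreover have "continuous_on {0..1} y"
    using dy DERIV_isCont by (blast intro: continuous_at_imp_continuous_on)
  ultimately obtain c :: c0 where c: "\<And>t. t \<in> {0..1} \<Longrightarrow> c (circle_of t) = y t"
    using c0_of_interval by metis
  have "has_circle_derivative c (l *\<^sub>R (q - c))"
  proof (rule has_circle_derivative_prim)
    fix t :: real assume t: "t \<in> {0..1}"
    have "((\<lambda>s. (l *\<^sub>R (q - c)) (circle_of s)) has_integral y t - y 0) {0..t}"
    proof (rule fundamental_theorem_of_calculus)
      fix s assume "s \<in> {0..t}"
      then show "(y has_vector_derivative (l *\<^sub>R (q - c)) (circle_of s)) (at s within {0..t})"
        using has_field_derivative_at_within[OF dy] c[of s] t
        by (simp add: has_real_derivative_iff_has_vector_derivative[symmetric])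
    qed (use t in simp)
    then show "prim_C (l *\<^sub>R (q - c)) t = c (circle_of t) - c (circle_of 0)"
      unfolding prim_C_def using c[of t] c[of 0] t by (subst integral_unique) auto
  qed
  then show thesis by (rule that)
qed

text \<open>Maximum principle: at a maximum of \<open>y\<close> the derivative vanishes, so
  \<open>y\<close> equals \<open>q\<close> there.\<close>

lemma periodic_linear_solution_bound_above:
  fixes y q :: c0
  assumes l: "l > 0"
    and y: "has_circle_derivative y (l *\<^sub>R (q - y))"
  shows "y t \<le> norm q"
proof -
  obtain x where x: "\<And>t. y t \<le> y x"
    using continuous_attains_sup[OF compact_circle, of y] by auto
  obtain s where s: "x = circle_of s" by (rule circle_of_cases)
  have "(l *\<^sub>R (q - y)) (circle_of s) = 0"
    using y unfolding has_circle_derivative_def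
    by (intro DERIV_local_max[of "\<lambda>r. y (circle_of r)" _ s 1]) (use x s in auto)
  then have "y x = q x" using l s by simp
  then show ?thesis using x[of t] c0_abs_le_norm[of q x] by simp
qed

lemma periodic_linear_solution_bound:
  fixes y q :: c0
  assumes l: "l > 0"
    and y: "has_circle_derivative y (l *\<^sub>R (q - y))"
  shows "norm y \<le> norm q"
proof (rule norm_bound)
  fix t
  have "has_circle_derivative (- y) (l *\<^sub>R (- q - - y))"
    using has_circle_derivative_minus[OF y] by (simp add: algebra_simps uminus_bcontfun.rep_eq)
  from periodic_linear_solution_bound_above[OF l y, of t]
      periodic_linear_solution_bound_above[OF l this, of t]
  show "norm (y t) \<le> norm q" by simp
qed

text \<open>
  Writing the equation as \<open>z' + \<lambda> z = \<lambda> (z - g(\<cdot>, z) / \<lambda>)\<close> makes \<open>z\<close> the fixed point of a map that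
  contracts by \<open>1 - \<epsilon> / \<lambda>\<close>.
\<close>

lemma periodic_solution_exists:
  fixes g :: "circle \<times> real \<Rightarrow> real"
  assumes g: "continuous_on UNIV g" and eps: "e > 0"
    and mono: "\<And>t x y. y \<le> x \<Longrightarrow> e * (x - y) \<le> g (t, x) - g (t, y)"
    and lip: "\<And>t x y. y \<le> x \<Longrightarrow> g (t, x) - g (t, y) \<le> l * (x - y)"
  obtains z :: c0 where
    "\<And>s. ((\<lambda>r. z (circle_of r)) has_real_derivative - g (circle_of s, z (circle_of s))) (at s)"
proof -
  \<comment> \<open>Comparing the two bounds over one unit step shows that the contraction factor
    \<open>1 - e / l\<close> is nonnegative.\<close>
  have l: "e \<le> l" using mono[of 0 1 undefined] lip[of 0 1 undefined] by simp
  with eps have l0: "l > 0" by simp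
  have "\<exists>y. has_circle_derivative (apply_bcontfun y) (l *\<^sub>R (q - y))" for q :: c0
    by (rule periodic_linear_solution_exists[OF l0, of q]) blast
  then obtain K :: "c0 \<Rightarrow> c0" where K: "\<And>q. has_circle_derivative (K q) (l *\<^sub>R (q - K q))" by metis
  define h where "h = (\<lambda>(t, x). x - g (t, x) / l)"
  have h_apply: "h (t, x) = x - g (t, x) / l" for t x by (simp add: h_def)
  have h: "continuous_on UNIV h"
    unfolding h_def case_prod_beta using g l0 by (intro continuous_intros) auto
  have "dist (K (nem h z)) (K (nem h w)) \<le> (1 - e / l) * dist z w" for z w
  proof -
    have "has_circle_derivative (K (nem h z) - K (nem h w))
        (l *\<^sub>R (nem h z - nem h w - (K (nem h z) - K (nem h w))))"
      using has_circle_derivative_add[OF K[of "nem h z"] has_circle_derivative_minus[OF K[of "nem h w"]]]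
      by (simp add: algebra_simps)
    then have "norm (K (nem h z) - K (nem h w)) \<le> norm (nem h z - nem h w)"
      by (rule periodic_linear_solution_bound[OF l0])
    also have "\<dots> \<le> (1 - e / l) * norm (z - w)"
    proof (rule norm_bound)
      fix t
      have *: "\<bar>h (t, x) - h (t, y)\<bar> \<le> (1 - e / l) * \<bar>x - y\<bar>" if "y \<le> x" for x y
      proof -
        have "h (t, x) - h (t, y) = (x - y) - (g (t, x) - g (t, y)) / l"
          by (simp add: h_def diff_divide_distrib)
        moreover have "(g (t, x) - g (t, y)) / l \<le> x - y"
          using lip[OF that, of t] l0 by (simp add: field_simps)
        moreover have "e / l * (x - y) \<le> (g (t, x) - g (t, y)) / l"
          using mono[OF that, of t] l0 by (simp add: divide_right_mono)
        ultimately show ?thesis using that by (simp add: left_diff_distrib)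
      qed
      have "\<bar>h (t, z t) - h (t, w t)\<bar> \<le> (1 - e / l) * \<bar>z t - w t\<bar>"
        using *[of "w t" "z t"] *[of "z t" "w t"] by (cases "w t \<le> z t") (auto simp: abs_minus_commute)
      also have "\<dots> \<le> (1 - e / l) * norm (z - w)"
        using c0_abs_le_norm[of "z - w" t] l l0 by (intro mult_left_mono) auto
      finally show "norm ((nem h z - nem h w) t) \<le> (1 - e / l) * norm (z - w)"
        by (simp add: nem_apply[OF h])
    qed
    finally show ?thesis by (simp add: dist_norm)
  qed
  then have "\<exists>!z. z \<in> UNIV \<and> K (nem h z) = z"
    using eps l l0 by (intro Banach_fix[OF c0_complete, where c = "1 - e / l"]) auto
  then obtain z where z: "K (nem h z) = z" by blast
  show thesis
  proof (rule that[of z])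
    fix s
    have "((\<lambda>r. z (circle_of r)) has_real_derivative (l *\<^sub>R (nem h z - z)) (circle_of s)) (at s)"
      using K[of "nem h z"] unfolding z has_circle_derivative_def by blast
    also have "(l *\<^sub>R (nem h z - z)) (circle_of s) = - g (circle_of s, z (circle_of s))"
      using l0 by (simp add: nem_apply[OF h] h_apply field_simps)
    finally show "((\<lambda>r. z (circle_of r)) has_real_derivative
        - g (circle_of s, z (circle_of s))) (at s)" .
  qed
qed

section \<open>The equation in an abstract pair of function spaces\<close>

text \<open>A Lipschitz bound on bounded sets, uniform in \<open>t\<close>, becomes global after
  truncation of the argument, which is the form that the contraction argument demands.\<close>

definition increasing_field :: "(circle \<times> real \<Rightarrow> real) \<Rightarrow> bool" where
  "increasing_field f \<longleftrightarrow> continuous_on UNIV f \<and> (\<forall>t. strict_mono (\<lambda>x. f (t, x))) \<and>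
     (\<forall>R. \<exists>l. \<forall>t x y. \<bar>x\<bar> \<le> R \<longrightarrow> \<bar>y\<bar> \<le> R \<longrightarrow> \<bar>f (t, x) - f (t, y)\<bar> \<le> l * \<bar>x - y\<bar>)"

lemma increasing_fieldD:
  assumes "increasing_field f"
  shows "continuous_on UNIV f" "x < y \<Longrightarrow> f (t, x) < f (t, y)" "x \<le> y \<Longrightarrow> f (t, x) \<le> f (t, y)"
  using assms by (auto simp: increasing_field_def dest: strict_monoD strict_mono_mono monoD)

lemma nonincreasing_within:
  fixes h :: "real \<Rightarrow> real"
  assumes "0 \<le> s" "s \<le> t" "t \<le> 1"
    and d: "\<And>r. r \<in> {0..1} \<Longrightarrow> (h has_real_derivative h' r) (at r within {0..1})"
    and neg: "\<And>r. s < r \<Longrightarrow> r < t \<Longrightarrow> h' r \<le> 0"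
  shows "h t \<le> h s"
proof (rule DERIV_nonpos_imp_decreasing_open[OF assms(2)])
  fix r assume r: "s < r" "r < t"
  then have "at r within {0..1} = at r" using assms by (intro at_within_interior) auto
  then show "\<exists>y. (h has_real_derivative y) (at r) \<and> y \<le> 0"
    using d[of r] neg[OF r] r assms by (intro exI[of _ "h' r"]) auto
next
  have "continuous_on {0..1} h"
    using d DERIV_continuous by (fastforce simp: continuous_on_eq_continuous_within)
  then show "continuous_on {s..t} h" by (rule continuous_on_subset) (use assms in auto)
qed

text \<open>
  Here \<open>\<iota>\<close> maps a function to its continuous representative, \<open>j\<close> is the inclusion of the continuous
  functions, and \<open>P v t\<close> stands for the integral of \<open>v\<close> from \<open>0\<close> to \<open>t\<close>. Since \<open>u - P v\<close> is
  continuously differentiable for a solution \<open>u\<close> of \<open>u' + f(t, u) = v\<close>, the arguments below are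
  classical even for \<open>v\<close> in \<open>L\<^sup>2\<close>.
\<close>

locale circle_pair =
  fixes L :: "'a::real_normed_vector \<Rightarrow> 'b::real_normed_vector"
    and \<iota> :: "'a \<Rightarrow> c0" and j :: "c0 \<Rightarrow> 'b" and P :: "'b \<Rightarrow> real \<Rightarrow> real"
  assumes L: "bounded_linear L" and \<iota>: "bounded_linear \<iota>" and j: "bounded_linear j"
    and P: "bounded_linear (\<lambda>v. P v t)"
    and P_0: "P v 0 = 0"
    and P_diff: "0 \<le> s \<Longrightarrow> s \<le> t \<Longrightarrow> t \<le> 1 \<Longrightarrow> \<bar>P v t - P v s\<bar> \<le> norm v"
    and P_continuous: "continuous_on {0..1} (P v)"
    and P_j: "t \<in> {0..1} \<Longrightarrow> (P (j c) has_real_derivative c (circle_of t)) (at t within {0..1})"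
    and P_L: "t \<in> {0..1} \<Longrightarrow> P (L u) t = \<iota> u (circle_of t) - \<iota> u (circle_of 0)"
    and L_surj: "(\<And>t. t \<in> {0..1} \<Longrightarrow> P v t = c (circle_of t) - c (circle_of 0)) \<Longrightarrow>
      \<exists>u. \<iota> u = c \<and> L u = v"
    and \<iota>_inj: "\<iota> u = \<iota> u' \<Longrightarrow> u = u'"
    and norm_le: "norm u \<le> norm (\<iota> u) + norm (L u)"
begin

abbreviation mean :: "(circle \<times> real \<Rightarrow> real) \<Rightarrow> real \<Rightarrow> real" where
  "mean f x \<equiv> P (j (slice f x)) 1"

lemmas P_add = linear_add[OF bounded_linear.linear[OF P]]
lemmas P_minus = linear_diff[OF bounded_linear.linear[OF P]]
lemmas P_uminus = linear_neg[OF bounded_linear.linear[OF P]]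
lemmas P_scaleR = linear_cmul[OF bounded_linear.linear[OF P]]
lemmas j_add = linear_add[OF bounded_linear.linear[OF j]]
lemmas j_minus = linear_diff[OF bounded_linear.linear[OF j]]
lemmas j_uminus = linear_neg[OF bounded_linear.linear[OF j]]
lemmas j_scaleR = linear_cmul[OF bounded_linear.linear[OF j]]

section \<open>Comparison and a priori bounds\<close>

lemma P_1_le: "\<bar>P v 1\<bar> \<le> norm v"
  using P_diff[of 0 1 v] by (simp add: P_0)

text \<open>The locale knows \<open>P\<close> only through its axioms, so an inequality between
  integrals is obtained as monotonicity of the primitive, starting from \<open>P_0\<close>.\<close>

lemma mean_ge:
  fixes c :: c0
  assumes "\<And>t. m \<le> c t"
  shows "m \<le> P (j c) 1"
proof -
  have "m * 1 - P (j c) 1 \<le> m * 0 - P (j c) 0"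
    by (rule nonincreasing_within[where h' = "\<lambda>t. m * 1 - c (circle_of t)"])
       (use assms in \<open>auto intro!: DERIV_diff DERIV_cmult P_j\<close>)
  then show ?thesis by (simp add: P_0)
qed

lemma mean_const: "P (j (const_bcontfun m)) 1 = m"
proof (rule antisym)
  show "m \<le> P (j (const_bcontfun m)) 1" by (rule mean_ge) simp
  have "- m \<le> P (j (- const_bcontfun m)) 1" by (rule mean_ge) simp
  then show "P (j (const_bcontfun m)) 1 \<le> m" by (simp add: j_uminus P_uminus)
qed

lemma mean_less:
  fixes c d :: c0
  assumes "\<And>t. c t < d t"
  shows "P (j c) 1 < P (j d) 1"
proof -
  obtain x where x: "\<And>t. (d - c) x \<le> (d - c) t"
    using continuous_attains_inf[OF compact_circle, of "d - c"] continuous_on_apply_bcontfun[of UNIV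
        "d - c"]
    by blast
  have "0 < (d - c) x" using assms[of x] by simp
  also have "\<dots> \<le> P (j (d - c)) 1" using x by (rule mean_ge)
  finally show ?thesis by (simp add: j_minus P_minus)
qed

text \<open>As long as \<open>d\<close> is at least \<open>a\<close>, the function
  \<open>d - P v\<close> falls at least at the rate \<open>k\<close>. If this lasted for the whole
  period, integration would contradict the hypothesis on the means, since \<open>d\<close> returns
  to its initial value. Hence \<open>d\<close> is at most \<open>a\<close> somewhere, and from there
  it climbs by at most \<open>norm v + norm k\<close> until the end of the interval.\<close>

lemma upper_bound:
  fixes d k :: c0
  assumes der: "\<And>s. s \<in> {0..1} \<Longrightarrow>
      ((\<lambda>r. d (circle_of r) - P v r) has_real_derivative z' s) (at s within {0..1})"
    and z': "\<And>s. s \<in> {0..1} \<Longrightarrow> a \<le> d (circle_of s) \<Longrightarrow> z' s \<le> - k (circle_of s)"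
    and mean: "P v 1 < P (j k) 1"
  shows "d x \<le> a + 2 * (norm v + norm k)"
proof -
  let ?d = "\<lambda>s. d (circle_of s)"
  have step: "?d t \<le> b + (norm v + norm k)"
    if st: "0 \<le> s" "s \<le> t" "t \<le> 1" "?d s \<le> b" "a \<le> b" for s t b
  proof (cases "?d t \<le> b")
    case True
    then show ?thesis using norm_ge_zero[of v] norm_ge_zero[of k] by linarith
  next
    case False
    \<comment> \<open>\<open>r0\<close> will be the last time before \<open>t\<close> at which
      \<open>d\<close> is at most \<open>b\<close>; after it \<open>d\<close> exceeds
      \<open>b\<close>, hence \<open>a\<close>, and the bound on \<open>z'\<close> applies.\<close>
    define K where "K = {s..t} \<inter> {r. ?d r \<le> b}"
    have "closed {r. ?d r \<le> b}"
      by (rule closed_Collect_le) (intro continuous_intros)+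
    then have "compact K" unfolding K_def by (intro compact_Int_closed) auto
    moreover have "s \<in> K" using st by (simp add: K_def)
    ultimately obtain r0 where r0: "r0 \<in> K" "\<And>r. r \<in> K \<Longrightarrow> r \<le> r0"
      using compact_attains_sup[of K] by blast
    have r: "0 \<le> r0" "r0 \<le> t" "?d r0 \<le> b" using r0(1) st by (auto simp: K_def)
    have "(?d t - P v t) - norm k * t \<le> (?d r0 - P v r0) - norm k * r0"
    proof (rule nonincreasing_within[where h = "\<lambda>r. (?d r - P v r) - norm k * r"
          and h' = "\<lambda>r. z' r - norm k * 1"])
      fix r assume rr: "r0 < r" "r < t"
      then have "r \<notin> K" using r0(2)[of r] by auto
      then have "a \<le> ?d r" using rr st r0(1) by (auto simp: K_def)
      then have "z' r \<le> - k (circle_of r)" using z'[of r] rr r st by auto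
      then show "z' r - norm k * 1 \<le> 0" using c0_abs_le_norm[of k "circle_of r"] by simp
    qed (use r st in \<open>auto intro!: DERIV_diff DERIV_cmult der\<close>)
    moreover have "norm k * t - norm k * r0 \<le> norm k * 1"
      unfolding right_diff_distrib[symmetric] using r st by (intro mult_left_mono) auto
    ultimately show ?thesis using P_diff[of r0 t v] r st by linarith
  qed
  have "\<exists>t0\<in>{0..1}. ?d t0 \<le> a"
  proof (rule ccontr)
    assume "\<not> ?thesis"
    then have n: "a \<le> ?d t" if "t \<in> {0..1}" for t using that by (metis linear)
    have "(?d 1 - P v 1) + P (j k) 1 \<le> (?d 0 - P v 0) + P (j k) 0"
    proof (rule nonincreasing_within[where h = "\<lambda>r. (?d r - P v r) + P (j k) r"
          and h' = "\<lambda>r. z' r + k (circle_of r)"])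
      fix r :: real assume "0 < r" "r < 1"
      then show "z' r + k (circle_of r) \<le> 0" using z'[of r] n[of r] by simp
    qed (auto intro!: DERIV_add der P_j)
    then show False using mean by (simp add: P_0)
  qed
  then obtain t0 where t0: "t0 \<in> {0..1}" "?d t0 \<le> a" by blast
  \<comment> \<open>The estimate runs forward in time only. Points before \<open>t0\<close> are
    reached by passing through 1, which is 0 on the circle, and going on from there; this is the
    origin of the factor 2.\<close>
  have "?d 1 \<le> a + (norm v + norm k)" using step[of t0 1 a] t0 by simp
  then have "?d t \<le> a + (norm v + norm k) + (norm v + norm k)" if "t \<in> {0..1}" for t
    using step[of 0 t "a + (norm v + norm k)"] that by simp
  then show ?thesis by (metis circle_of_cases mult_2 add.assoc)
qed

text \<open>The equation in integrated form: it asks for no derivative of \<open>c\<close> and makes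
  sense for \<open>v\<close> in either space.\<close>

definition sol :: "(circle \<times> real \<Rightarrow> real) \<Rightarrow> 'b \<Rightarrow> c0 \<Rightarrow> bool" where
  "sol f v c \<longleftrightarrow> (\<forall>t\<in>{0..1}. P (v - j (nem f c)) t = c (circle_of t) - c (circle_of 0))"

lemma sol_derivative:
  assumes "sol f v c" "s \<in> {0..1}"
  shows "((\<lambda>r. c (circle_of r) - P v r) has_real_derivative
      - nem f c (circle_of s)) (at s within {0..1})"
proof (rule has_field_derivative_transform_within[of _ _ _ _ 1])
  show "((\<lambda>r. c (circle_of 0) - P (j (nem f c)) r) has_real_derivative - nem f c (circle_of s))
      (at s within {0..1})"
    by (rule DERIV_cong, rule DERIV_diff[OF DERIV_const P_j[OF assms(2)]]) simp
  fix r :: real assume "r \<in> {0..1}"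
  then show "c (circle_of 0) - P (j (nem f c)) r = c (circle_of r) - P v r"
    using assms(1)[unfolded sol_def, THEN bspec, of r] by (simp add: P_minus)
qed (use assms in auto)

lemma solI:
  fixes c :: c0
  assumes "\<And>s. s \<in> {0..1} \<Longrightarrow>
    ((\<lambda>r. c (circle_of r) - P v r) has_real_derivative - nem f c (circle_of s)) (at s within {0..1})"
  shows "sol f v c"
  unfolding sol_def
proof
  fix t :: real assume t: "t \<in> {0..1}"
  let ?h = "\<lambda>r. c (circle_of r) - P v r + P (j (nem f c)) r"
  have "\<exists>k. \<forall>r\<in>{0..1}. ?h r = k"
  proof (rule has_field_derivative_zero_constant)
    fix r :: real assume r: "r \<in> {0..1}"
    show "(?h has_real_derivative 0) (at r within {0..1})"
      by (rule DERIV_cong, rule DERIV_add[OF assms[OF r] P_j[OF r]]) simp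
  qed auto
  then have "?h t = ?h 0" using t by fastforce
  then show "P (v - j (nem f c)) t = c (circle_of t) - c (circle_of 0)"
    by (simp add: P_minus P_0)
qed

lemma solution_le:
  fixes c :: c0
  assumes f: "continuous_on UNIV f" "\<And>t x y. x \<le> y \<Longrightarrow> f (t, x) \<le> f (t, y)" and s: "sol f v c"
    and mean: "P v 1 < mean f N"
  shows "c x \<le> N + 2 * (norm v + norm (slice f N))"
  by (rule upper_bound[OF sol_derivative[OF s] _ mean])
     (use f(2) in \<open>auto simp: nem_apply[OF f(1)] \<close>)

lemma solution_ge:
  fixes c :: c0
  assumes f: "continuous_on UNIV f" "\<And>t x y. x \<le> y \<Longrightarrow> f (t, x) \<le> f (t, y)" and s: "sol f v c"
    and mean: "mean f (- N) < P v 1"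
  shows "- c x \<le> N + 2 * (norm v + norm (slice f (- N)))"
proof -
  have "(- c) x \<le> N + 2 * (norm (- v) + norm (- slice f (- N)))"
  proof (rule upper_bound)
    fix s :: real assume "s \<in> {0..1}"
    from DERIV_minus[OF sol_derivative[OF s this]]
    show "((\<lambda>r. (- c) (circle_of r) - P (- v) r) has_real_derivative nem f c (circle_of s))
        (at s within {0..1})"
      by (simp add: P_uminus algebra_simps)
  next
    fix s :: real assume "N \<le> (- c) (circle_of s)"
    then have "c (circle_of s) \<le> - N" by simp
    then show "nem f c (circle_of s) \<le> - (- slice f (- N)) (circle_of s)"
      using f(2) by (simp add: nem_apply[OF f(1)])
  qed (use mean in \<open>simp add: P_uminus j_uminus\<close>)
  then show ?thesis by simp
qed

section \<open>Strict monotonicity and stability\<close>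

text \<open>The increment is continuous and positive on the compact set of triples with
  \<open>y + e \<le> x\<close>, so it attains a positive minimum; if the set is empty, any
  \<open>w\<close> will do.\<close>

lemma gap:
  fixes R e :: real and f :: "circle \<times> real \<Rightarrow> real"
  assumes f: "continuous_on UNIV f" "\<And>t x y. x < y \<Longrightarrow> f (t, x) < f (t, y)" and e: "e > 0"
  obtains w :: real where "w > 0"
    "\<And>t x y. \<bar>x\<bar> \<le> R \<Longrightarrow> \<bar>y\<bar> \<le> R \<Longrightarrow> y + e \<le> x \<Longrightarrow> w \<le> f (t, x) - f (t, y)"
proof -
  let ?K = "({- R..R} \<times> {- R..R}) \<inter> {p. snd p + e \<le> fst p}"
  show thesis
  proof (cases "?K = {}")
    case True
    then have "(x, y) \<notin> ?K" for x y by blast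
    then have "\<not> (\<bar>x\<bar> \<le> R \<and> \<bar>y\<bar> \<le> R \<and> y + e \<le> x)" for x y by (auto simp: abs_le_iff)
    then show thesis using that[of 1] by auto
  next
    case False
    have "closed {p :: real \<times> real. snd p + e \<le> fst p}"
      by (rule closed_Collect_le) (intro continuous_intros)+
    then have cpt: "compact ((UNIV :: circle set) \<times> ?K)"
      by (intro compact_Times compact_circle compact_Int_closed) auto
    have cont: "continuous_on (UNIV \<times> ?K) (\<lambda>q. f (fst q, fst (snd q)) - f (fst q, snd (snd q)))"
      by (intro continuous_intros continuous_on_compose2[OF f(1)]) auto
    have "(UNIV :: circle set) \<times> ?K \<noteq> {}" using False by blast
    from continuous_attains_inf[OF cpt this cont] obtain q where q: "q \<in> UNIV \<times> ?K"
      "\<forall>q'\<in>UNIV \<times> ?K. f (fst q, fst (snd q)) - f (fst q, snd (snd q))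
        \<le> f (fst q', fst (snd q')) - f (fst q', snd (snd q'))"
      by (rule bexE)
    show thesis
    proof (rule that)
      have "snd (snd q) < fst (snd q)" using q(1) e by auto
      then show "0 < f (fst q, fst (snd q)) - f (fst q, snd (snd q))"
        using f(2) by simp
      fix t x y assume "\<bar>x\<bar> \<le> R" "\<bar>y\<bar> \<le> R" "y + e \<le> x"
      then show "f (fst q, fst (snd q)) - f (fst q, snd (snd q)) \<le> f (t, x) - f (t, y)"
        using bspec[OF q(2), of "(t, x, y)"] by (auto simp: abs_le_iff)
    qed
  qed
qed

text \<open>\<open>upper_bound\<close> is applied to the difference of the two solutions with the
  level \<open>e / 2\<close>: wherever it exceeds this level, \<open>gap\<close> makes
  \<open>(c - d) - P (v - w)\<close> fall at least at the rate \<delta>, while the mean of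
  \<open>v - w\<close> is below \<delta>. The choice of \<delta> depends only on \<open>R\<close>
  and \<open>e\<close>, not on the solutions.\<close>

lemma stability:
  assumes f: "continuous_on UNIV f" "\<And>t x y. x < y \<Longrightarrow> f (t, x) < f (t, y)" and e: "e > 0"
  obtains \<delta> where "\<delta> > 0" "\<And>v w c d. norm c \<le> R \<Longrightarrow> norm d \<le> R \<Longrightarrow> sol f v c \<Longrightarrow> sol f w d \<Longrightarrow>
      norm (v - w) < \<delta> \<Longrightarrow> norm (c - d) \<le> e"
proof -
  have "e / 2 > 0" using e by simp
  from gap[OF f this, of R] obtain w0 where w0: "w0 > 0"
    "\<And>t x y. \<bar>x\<bar> \<le> R \<Longrightarrow> \<bar>y\<bar> \<le> R \<Longrightarrow> y + e / 2 \<le> x \<Longrightarrow> w0 \<le> f (t, x) - f (t, y)" by metis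
  \<comment> \<open>\<delta> is both the allowed distance of the right hand sides and the constant
    rate \<open>k\<close> in \<open>upper_bound\<close>. The resulting bound
    \<open>e / 2 + 4 * \<delta>\<close> is at most \<open>3 * e / 4\<close>.\<close>
  define \<delta> where "\<delta> = min w0 (e / 16)"
  have \<delta>: "\<delta> > 0" "\<delta> \<le> w0" "\<delta> \<le> e / 16" using w0 e by (auto simp: \<delta>_def)
  have le: "(c - d) x \<le> e"
    if "norm c \<le> R" "norm d \<le> R" "sol f v c" "sol f w d" "norm (v - w) < \<delta>" for v w c d x
  proof -
    have "(c - d) x \<le> e / 2 + 2 * (norm (v - w) + norm (const_bcontfun \<delta> :: c0))"
    proof (rule upper_bound)
      fix s :: real assume s: "s \<in> {0..1}"
      show "((\<lambda>r. (c - d) (circle_of r) - P (v - w) r) has_real_derivative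
          - nem f c (circle_of s) - - nem f d (circle_of s)) (at s within {0..1})"
        using DERIV_diff[OF sol_derivative[OF that(3) s] sol_derivative[OF that(4) s]]
        by (simp add: P_minus algebra_simps)
      assume "e / 2 \<le> (c - d) (circle_of s)"
      then have "w0 \<le> f (circle_of s, c (circle_of s)) - f (circle_of s, d (circle_of s))"
        using c0_abs_le_norm[of c "circle_of s"] c0_abs_le_norm[of d "circle_of s"] that
        by (intro w0(2)) auto
      then show "- nem f c (circle_of s) - - nem f d (circle_of s) \<le> - (const_bcontfun \<delta>) (circle_of s)"
        using \<delta> by (simp add: nem_apply[OF f(1)])
    next
      show "P (v - w) 1 < P (j (const_bcontfun \<delta>)) 1"
        using P_1_le[of "v - w"] that(5) by (simp add: mean_const)
    qed
    also have "\<dots> \<le> e / 2 + 2 * (\<delta> + \<delta>)"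
      using that(5) \<delta> by (intro add_left_mono mult_left_mono add_mono norm_bound) auto
    also have "\<dots> \<le> e" using \<delta> e by simp
    finally show ?thesis .
  qed
  show thesis
  proof (rule that[OF \<delta>(1)])
    fix v w c d assume a: "norm c \<le> R" "norm d \<le> R" "sol f v c" "sol f w d" "norm (v - w) < \<delta>"
    show "norm (c - d) \<le> e"
    proof (rule norm_bound)
      fix x
      show "norm ((c - d) x) \<le> e"
        using le[OF a, of x] le[OF a(2) a(1) a(4) a(3), of x] a(5) by (simp add: norm_minus_commute)
    qed
  qed
qed


section \<open>Existence of solutions\<close>

text \<open>\<open>V\<close> is the primitive of \<open>v\<close> with its linear part removed,
  which makes it periodic. Then \<open>c - V\<close> solves an equation with the continuous field
  \<open>h\<close>, even when \<open>v\<close> is merely in L^2; the removed slope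
  \<open>P v 1\<close> reappears as a constant in \<open>h\<close>.\<close>

lemma solution_exists_uniform:
  fixes g :: "circle \<times> real \<Rightarrow> real"
  assumes g: "continuous_on UNIV g" and eps: "e > 0"
    and mono: "\<And>t x y. y \<le> x \<Longrightarrow> e * (x - y) \<le> g (t, x) - g (t, y)"
    and lip: "\<And>t x y. y \<le> x \<Longrightarrow> g (t, x) - g (t, y) \<le> l * (x - y)"
  obtains c where "sol g v c"
proof -
  have "continuous_on {0..1} (\<lambda>t. P v t - t * P v 1)"
    by (intro continuous_intros P_continuous)
  moreover have "P v 0 - 0 * P v 1 = P v 1 - 1 * P v 1" by (simp add: P_0)
  ultimately obtain V :: c0 where V: "\<And>t. t \<in> {0..1} \<Longrightarrow> V (circle_of t) = P v t - t * P v 1"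
    using c0_of_interval[of "\<lambda>t. P v t - t * P v 1"] by blast
  define h where "h = (\<lambda>(t, x). g (t, x + V t) - P v 1)"
  have "continuous_on UNIV h"
    unfolding h_def case_prod_beta
    by (intro continuous_intros continuous_on_compose2[OF g]
        continuous_on_compose2[OF continuous_on_apply_bcontfun[of UNIV]]) auto
  moreover have "e * (x - y) \<le> h (t, x) - h (t, y)" if "y \<le> x" for t x y
    using mono[of "y + V t" "x + V t" t] that by (simp add: h_def)
  moreover have "h (t, x) - h (t, y) \<le> l * (x - y)" if "y \<le> x" for t x y
    using lip[of "y + V t" "x + V t" t] that by (simp add: h_def)
  ultimately obtain z :: c0 where
    z: "\<And>s. ((\<lambda>r. z (circle_of r)) has_real_derivative - h (circle_of s, z (circle_of s))) (at s)"
    using periodic_solution_exists[of h e l] eps by metis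
  have "sol g v (z + V)"
  proof (rule solI)
    fix s :: real assume s: "s \<in> {0..1}"
    show "((\<lambda>r. (z + V) (circle_of r) - P v r) has_real_derivative - nem g (z + V) (circle_of s))
        (at s within {0..1})"
    proof (rule has_field_derivative_transform_within[of _ _ _ _ 1])
      show "((\<lambda>r. z (circle_of r) - r * P v 1) has_real_derivative - nem g (z + V) (circle_of s))
          (at s within {0..1})"
        by (rule DERIV_cong[OF DERIV_diff[OF has_field_derivative_at_within[OF z]
            DERIV_cmult_right[OF DERIV_ident]]])
           (simp add: nem_apply[OF g] h_def)
    qed (use s V in auto)
  qed
  then show thesis by (rule that)
qed

text \<open>
  The right hand side is truncated outside \<open>[-R, R]\<close> and perturbed by \<open>\<epsilon> x\<close>; by the a priori bounds
  the truncation is not seen by the solutions, and by stability they converge as \<open>\<epsilon> \<rightarrow> 0\<close>.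
\<close>

lemma solution_exists:
  assumes f: "increasing_field f" and N: "N \<ge> 0"
    and lower: "mean f (- N) < P v 1"
    and upper: "P v 1 < mean f N"
  obtains c where "sol f v c"
proof -
  note cont = increasing_fieldD(1)[OF f] and inc = increasing_fieldD(2)[OF f]
    and inc' = increasing_fieldD(3)[OF f]
  \<comment> \<open>Solutions of the modified equation are bounded by \<open>N\<close> plus twice
    the sum of \<open>norm v\<close> and the norm of a slice of \<open>g\<close>; for
    \<open>e \<le> 1\<close> the perturbation adds at most \<open>N\<close> to that slice.
    \<open>B\<close> absorbs this on both sides, so \<open>R\<close> bounds all approximate
    solutions.\<close>
  define B where "B = norm v + norm (slice f N) + norm (slice f (- N)) + N"
  define R where "R = N + 2 * B"
  have B: "B \<ge> N" "norm v + (norm (slice f N) + N) \<le> B"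
    "norm v + (norm (slice f (- N)) + N) \<le> B"
    using norm_ge_zero[of v] norm_ge_zero[of "slice f N"]
      norm_ge_zero[of "slice f (- N)"] unfolding B_def by linarith+
  have R: "R \<ge> N" "R \<ge> 0" using B N by (auto simp: R_def)
  obtain l where l: "\<And>t x y. \<bar>x\<bar> \<le> R \<Longrightarrow> \<bar>y\<bar> \<le> R \<Longrightarrow> \<bar>f (t, x) - f (t, y)\<bar> \<le> l * \<bar>x - y\<bar>"
    using f unfolding increasing_field_def by blast
  define clamp where "clamp = (\<lambda>x. max (- R) (min R x))"
  have clamp: "\<bar>clamp x\<bar> \<le> R" "y \<le> x \<Longrightarrow> clamp y \<le> clamp x" "y \<le> x \<Longrightarrow> clamp x - clamp y \<le> x - y"
    "\<bar>x\<bar> \<le> R \<Longrightarrow> clamp x = x" for x y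
    using R(2) unfolding clamp_def by (auto simp: max_def min_def)
  have approx: "\<exists>c. norm c \<le> R \<and> sol f (v - e *\<^sub>R j c) c" if eps: "0 < e" "e \<le> 1" for e :: real
  proof -
    define g where "g = (\<lambda>(t, x). f (t, clamp x) + e * x)"
    have g: "continuous_on UNIV g"
      unfolding g_def case_prod_beta clamp_def
      by (intro continuous_intros continuous_on_compose2[OF cont]) auto
    have g_mono: "e * (x - y) \<le> g (t, x) - g (t, y)" if "y \<le> x" for t x y
      using inc'[OF clamp(2)[OF that], of t] by (simp add: g_def algebra_simps)
    have g_lip: "g (t, x) - g (t, y) \<le> (max l 0 + e) * (x - y)" if "y \<le> x" for t x y
    proof -
      have "f (t, clamp x) - f (t, clamp y) \<le> l * \<bar>clamp x - clamp y\<bar>"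
        using l[OF clamp(1) clamp(1), of t x y] by linarith
      also have "\<dots> \<le> max l 0 * (x - y)"
        using clamp(2,3)[OF that] by (intro mult_mono) auto
      finally show ?thesis by (simp add: g_def algebra_simps)
    qed
    obtain c where c: "sol g v c"
      using solution_exists_uniform[OF g eps(1), of "max l 0 + e"] g_mono g_lip by blast
    have g_le: "g (t, x) \<le> g (t, y)" if "x \<le> y" for t x y
    proof -
      have "0 \<le> e * (y - x)" using that eps by simp
      also have "\<dots> \<le> g (t, y) - g (t, x)" using that by (rule g_mono)
      finally show ?thesis by simp
    qed
    have g_apply: "g (t, x) = f (t, clamp x) + e * x" for t x by (simp add: g_def)
    have nem_g: "nem g d = nem f d + e *\<^sub>R d" if "norm d \<le> R" for d
      using clamp(4) order_trans[OF c0_abs_le_norm that]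
      by (intro bcontfun_eqI) (simp add: nem_apply[OF g] nem_apply[OF cont] g_apply)
    have const: "norm (const_bcontfun a :: c0) \<le> \<bar>a\<bar>" for a by (rule norm_bound) simp
    have nem_N: "slice g a = slice f a + const_bcontfun (e * a)"
      "norm (slice g a) \<le> norm (slice f a) + N"
      if "\<bar>a\<bar> = N" for a
    proof -
      have c: "e *\<^sub>R (const_bcontfun a :: c0) = const_bcontfun (e * a)"
        by (rule bcontfun_eqI) simp
      show e: "slice g a = slice f a + const_bcontfun (e * a)"
        using nem_g[of "const_bcontfun a"] const[of a] that R c by simp
      have "norm (const_bcontfun (e * a) :: c0) \<le> \<bar>e * a\<bar>" by (rule const)
      also have "\<dots> \<le> N" using eps that by (simp add: abs_mult mult_left_le_one_le)
      finally show "norm (slice g a) \<le> norm (slice f a) + N"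
        unfolding e by (intro norm_triangle_mono) auto
    qed
    have mean: "mean g a = mean f a + e * a"
      if "\<bar>a\<bar> = N" for a
      unfolding nem_N[OF that] j_add P_add mean_const ..
    \<comment> \<open>The perturbation raises the mean at \<open>N\<close> and lowers it at
      \<open>- N\<close>, so the bracketing of \<open>P v 1\<close> survives.\<close>
    have "e * N \<ge> 0" using eps N by simp
    then have m: "P v 1 < mean g N"
      "mean g (- N) < P v 1"
      using upper lower mean[of N] mean[of "- N"] N by simp_all
    have "norm c \<le> R"
    proof (rule norm_bound)
      fix x
      have "c x \<le> N + 2 * (norm v + norm (slice g N))"
        using solution_le[OF g g_le c m(1)] .
      moreover have "- c x \<le> N + 2 * (norm v + norm (slice g (- N)))"
        using solution_ge[OF g g_le c m(2)] .
      ultimately show "norm (c x) \<le> R"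
        using nem_N(2)[of N] nem_N(2)[of "- N"] B N unfolding R_def by simp
    qed
    \<comment> \<open>Below the level \<open>R\<close> the truncation is invisible, and the term
      \<open>e *\<^sub>R c\<close> can be moved to the right hand side: \<open>c\<close> solves the
      original equation for a nearby \<open>v\<close>.\<close>
    moreover from nem_g[OF this] have "sol f (v - e *\<^sub>R j c) c"
      using c unfolding sol_def
      by (simp add: j_add j_scaleR algebra_simps)
    ultimately show ?thesis by blast
  qed
  then have "\<exists>c. norm c \<le> R \<and> sol f (v - inverse (real (Suc n)) *\<^sub>R j c) c" for n
    by (intro approx) (auto simp: inverse_le_1_iff)
  then obtain X where X: "\<And>n. norm (X n) \<le> R"
    "\<And>n. sol f (v - inverse (real (Suc n)) *\<^sub>R j (X n)) (X n)" by metis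
  define w where "w = (\<lambda>n. v - inverse (real (Suc n)) *\<^sub>R j (X n))"
  obtain J where J: "\<And>c. norm (j c) \<le> norm c * J" "J > 0"
    using bounded_linear.pos_bounded[OF j] by blast
  have "(\<lambda>n. inverse (real (Suc n)) *\<^sub>R j (X n)) \<longlonglongrightarrow> 0"
  proof (rule Lim_null_comparison)
    show "\<forall>\<^sub>F n in sequentially. norm (inverse (real (Suc n)) *\<^sub>R j (X n))
        \<le> inverse (real (Suc n)) * (R * J)"
    proof (intro always_eventually allI)
      fix n
      have "norm (j (X n)) \<le> R * J"
        using J X(1)[of n] by (meson mult_right_mono order_trans less_imp_le)
      then show "norm (inverse (real (Suc n)) *\<^sub>R j (X n)) \<le> inverse (real (Suc n)) * (R * J)"
        by (simp add: mult_left_mono del: of_nat_Suc)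
    qed
    show "(\<lambda>n. inverse (real (Suc n)) * (R * J)) \<longlonglongrightarrow> 0"
      using tendsto_mult_left_zero[OF LIMSEQ_inverse_real_of_nat] .
  qed
  then have w: "w \<longlonglongrightarrow> v" unfolding w_def using tendsto_diff[OF tendsto_const[of v]] by fastforce
  \<comment> \<open>All \<open>X n\<close> solve the same equation with right hand sides
    \<open>w n\<close> that converge, and share the bound \<open>R\<close>; stability turns this
    into the Cauchy property.\<close>
  have "Cauchy X"
  proof (rule CauchyI)
    fix e :: real assume "e > 0"
    then have "e / 2 > 0" by simp
    from stability[OF cont inc this, of R] obtain \<delta> where \<delta>: "\<delta> > 0"
      "\<And>v w c d. norm c \<le> R \<Longrightarrow> norm d \<le> R \<Longrightarrow> sol f v c \<Longrightarrow> sol f w d \<Longrightarrow>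
        norm (v - w) < \<delta> \<Longrightarrow> norm (c - d) \<le> e / 2" by metis
    obtain M where M: "\<And>m n. m \<ge> M \<Longrightarrow> n \<ge> M \<Longrightarrow> norm (w m - w n) < \<delta>"
      using CauchyD[OF LIMSEQ_imp_Cauchy[OF w] \<delta>(1)] by blast
    have "norm (X m - X n) < e" if "m \<ge> M" "n \<ge> M" for m n
      using \<delta>(2)[OF X(1) X(1) X(2)[of m] X(2)[of n]] M[OF that] \<open>e > 0\<close> unfolding w_def by simp
    then show "\<exists>M. \<forall>m\<ge>M. \<forall>n\<ge>M. norm (X m - X n) < e" by blast
  qed
  then obtain c where c: "X \<longlonglongrightarrow> c" using c0_Cauchy_convergent convergent_def by blast
  have "sol f v c"
    unfolding sol_def
  proof
    fix t :: real assume t: "t \<in> {0..1}"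
    have "(\<lambda>n. nem f (X n)) \<longlonglongrightarrow> nem f c"
      using continuous_on_tendsto_compose[OF continuous_on_nem[OF cont] c] by simp
    then have "(\<lambda>n. P (w n - j (nem f (X n))) t) \<longlonglongrightarrow> P (v - j (nem f c)) t"
      by (intro bounded_linear.tendsto[OF P] tendsto_diff w bounded_linear.tendsto[OF j])
    moreover have "P (w n - j (nem f (X n))) t = X n (circle_of t) - X n (circle_of 0)" for n
      using X(2)[of n] t unfolding sol_def w_def by blast
    moreover have "(\<lambda>n. X n x) \<longlonglongrightarrow> c x" for x
      by (rule tendsto_uniform_limitI[OF tendsto_bcontfun_uniform_limit[OF c] UNIV_I])
    then have "(\<lambda>n. X n (circle_of t) - X n (circle_of 0)) \<longlonglongrightarrow> c (circle_of t) - c (circle_of 0)"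
      by (intro tendsto_diff)
    ultimately show "P (v - j (nem f c)) t = c (circle_of t) - c (circle_of 0)"
      using LIMSEQ_unique by simp
  qed
  then show thesis by (rule that)
qed

section \<open>The operator as a homeomorphism onto an open set\<close>

definition F :: "(circle \<times> real \<Rightarrow> real) \<Rightarrow> 'a \<Rightarrow> 'b" where
  "F f u = L u + j (nem f (\<iota> u))"

abbreviation bracketed :: "(circle \<times> real \<Rightarrow> real) \<Rightarrow> 'b \<Rightarrow> real \<Rightarrow> bool" where
  "bracketed f v N \<equiv> mean f (- N) < P v 1 \<and> P v 1 < mean f N"

text \<open>The strip of (b), described by the means of finite slices instead of the integrals of
  the limits. In this form it is visibly open, and the bound for the solutions can be read off from
  \<open>N\<close>.\<close>

definition target :: "(circle \<times> real \<Rightarrow> real) \<Rightarrow> 'b set" where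
  "target f = {v. \<exists>N\<ge>0. bracketed f v N}"

lemma F_sol: "sol f (F f u) (\<iota> u)"
  by (simp add: sol_def F_def P_L)

lemma sol_imp_F:
  assumes "sol f v c"
  obtains u where "\<iota> u = c" "F f u = v"
proof -
  obtain u where "\<iota> u = c" "L u = v - j (nem f c)"
    using L_surj[of "v - j (nem f c)" c] assms by (auto simp: sol_def)
  then show thesis by (intro that[of u]) (auto simp: F_def)
qed

lemma continuous_on_F:
  assumes "continuous_on UNIV f"
  shows "continuous_on UNIV (F f)"
  unfolding F_def
  by (intro continuous_intros bounded_linear.continuous_on[OF L] bounded_linear.continuous_on[OF j]
      continuous_on_compose2[OF continuous_on_nem[OF assms]] bounded_linear.continuous_on[OF \<iota>]) auto

text \<open>Integration over a period annihilates \<open>L u\<close>, so the mean of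
  \<open>F f u\<close> is that of \<open>nem f (\<iota> u)\<close>; strict monotonicity compares it
  with the slices at any level above \<open>norm (\<iota> u)\<close>.\<close>

lemma F_in_target:
  assumes "increasing_field f"
  shows "F f u \<in> target f"
proof -
  note cont = increasing_fieldD(1)[OF assms] and inc = increasing_fieldD(2)[OF assms]
  have "P (L u) 1 = 0" using P_L[of 1 u] by simp
  then have F1: "P (F f u) 1 = P (j (nem f (\<iota> u))) 1" by (simp add: F_def P_add)
  define N where "N = norm (\<iota> u) + 1"
  have "- N < \<iota> u t" "\<iota> u t < N" for t
    using c0_abs_le_norm[of "\<iota> u" t] by (auto simp: N_def abs_le_iff)
  then have "mean f (- N) < P (F f u) 1"
    "P (F f u) 1 < mean f N"
    unfolding F1 by (auto intro!: mean_less simp: nem_apply[OF cont] inc)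
  moreover have "N \<ge> 0" by (simp add: N_def)
  ultimately show ?thesis unfolding target_def by blast
qed

text \<open>The inequalities are strict and \<open>P v 1\<close> is 1-Lipschitz in \<open>v\<close>.
  The radius is capped at 1 so that the norms of the neighbours are bounded as well.\<close>

lemma target_local:
  assumes "v \<in> target f"
  obtains N r where "N \<ge> 0" "r > 0" "r \<le> 1"
    "\<And>w. norm (w - v) < r \<Longrightarrow> bracketed f w N"
proof -
  obtain N where N: "N \<ge> 0" "mean f (- N) < P v 1"
    "P v 1 < mean f N" using assms by (auto simp: target_def)
  define r where "r = min 1 (min (P v 1 - mean f (- N))
    (mean f N - P v 1))"
  show thesis
  proof (rule that[of N r])
    fix w assume w: "norm (w - v) < r"
    have "\<bar>P w 1 - P v 1\<bar> \<le> norm (w - v)" using P_1_le[of "w - v"] by (simp add: P_minus)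
    with w show "bracketed f w N" unfolding r_def by linarith
  qed (use N in \<open>auto simp: r_def\<close>)
qed

lemma open_target: "open (target f)"
  unfolding open_dist
proof
  fix v assume "v \<in> target f"
  then obtain N r where "N \<ge> 0" "r > 0"
    "\<And>w. norm (w - v) < r \<Longrightarrow> bracketed f w N" using target_local by metis
  then show "\<exists>e>0. \<forall>w. dist w v < e \<longrightarrow> w \<in> target f"
    unfolding target_def dist_norm by blast
qed

lemma solutions_locally_bounded:
  assumes "increasing_field f" "v \<in> target f"
  obtains r R where "r > 0" "\<And>w c. norm (w - v) < r \<Longrightarrow> sol f w c \<Longrightarrow> norm c \<le> R"
proof -
  note cont = increasing_fieldD(1)[OF assms(1)] and inc = increasing_fieldD(3)[OF assms(1)]
  obtain N r where N: "N \<ge> 0" "r > 0" "r \<le> 1"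
    and m: "\<And>w. norm (w - v) < r \<Longrightarrow> bracketed f w N" using target_local[OF assms(2)] by metis
  define R where "R = N + 2 * (norm v + 1 + norm (slice f N)
    + norm (slice f (- N)))"
  show thesis
  proof (rule that[OF N(2)])
    fix w c assume w: "norm (w - v) < r" and c: "sol f w c"
    have "norm w \<le> norm v + 1" using w N(3) norm_triangle_ineq2[of w v] by linarith
    then show "norm c \<le> R"
      using solution_le[OF cont inc c conjunct2[OF m[OF w]]]
          solution_ge[OF cont inc c conjunct1[OF m[OF w]]]
        norm_ge_zero[of "slice f N"] norm_ge_zero[of "slice f (- N)"]
      unfolding R_def by (intro norm_bound) (smt (verit) real_norm_def)
  qed
qed

theorem F_homeomorphism:
  assumes f: "increasing_field f"
  obtains G where "homeomorphism UNIV (target f) (F f) G"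
proof -
  note cont = increasing_fieldD(1)[OF f] and inc = increasing_fieldD(2)[OF f]
  have uniq: "c = d" if "sol f v c" "sol f v d" for v c d
  proof -
    \<comment> \<open>Uniqueness is stability for equal right hand sides, used for every
      \<open>e\<close>.\<close>
    have "norm (c - d) \<le> 0"
    proof (rule field_le_epsilon)
      fix e :: real assume "e > 0"
      from stability[OF cont inc this, of "max (norm c) (norm d)"] that
      show "norm (c - d) \<le> 0 + e" by (metis add_0 diff_self max.cobounded1 max.cobounded2 norm_zero)
    qed
    then show ?thesis by simp
  qed
  have "inj (F f)"
  proof (rule injI)
    fix u u' assume "F f u = F f u'"
    then show "u = u'" using uniq F_sol \<iota>_inj by metis
  qed
  have "v \<in> range (F f)" if "v \<in> target f" for v
  proof -
    obtain N where "N \<ge> 0" "mean f (- N) < P v 1"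
      "P v 1 < mean f N" using \<open>v \<in> target f\<close> by (auto simp: target_def)
    then obtain c where "sol f v c" using solution_exists[OF f] by blast
    then show ?thesis by (metis sol_imp_F rangeI)
  qed
  then have range: "range (F f) = target f" using F_in_target[OF f] by blast
  define G where "G = inv (F f)"
  have GF: "G (F f u) = u" for u unfolding G_def using \<open>inj (F f)\<close> by simp
  have FG: "F f (G v) = v" if "v \<in> target f" for v
    unfolding G_def using that range by (simp add: f_inv_into_f)
  have iG: "continuous_on (target f) (\<lambda>v. \<iota> (G v))"
    unfolding continuous_on_iff
  proof (intro ballI allI impI)
    fix v and e :: real assume v: "v \<in> target f" and "e > 0"
    then have "e / 2 > 0" by simp
    obtain r R where r: "r > 0" "\<And>w c. norm (w - v) < r \<Longrightarrow> sol f w c \<Longrightarrow> norm c \<le> R"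
      using solutions_locally_bounded[OF f v] by metis
    from stability[OF cont inc \<open>e / 2 > 0\<close>, of R] obtain \<delta> where \<delta>: "\<delta> > 0"
      "\<And>v w c d. norm c \<le> R \<Longrightarrow> norm d \<le> R \<Longrightarrow> sol f v c \<Longrightarrow> sol f w d \<Longrightarrow>
        norm (v - w) < \<delta> \<Longrightarrow> norm (c - d) \<le> e / 2" by metis
    show "\<exists>d>0. \<forall>w\<in>target f. dist w v < d \<longrightarrow> dist (\<iota> (G w)) (\<iota> (G v)) < e"
    proof (intro exI[of _ "min r \<delta>"] conjI ballI impI)
      fix w assume w: "w \<in> target f" "dist w v < min r \<delta>"
      have s: "sol f w (\<iota> (G w))" "sol f v (\<iota> (G v))"
        using F_sol[of f "G w"] F_sol[of f "G v"] FG w(1) v by simp_all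
      have "norm (\<iota> (G w) - \<iota> (G v)) \<le> e / 2"
        using w(2) r(1) by (intro \<delta>(2)[OF r(2)[OF _ s(1)] r(2)[OF _ s(2)] s]) (auto simp: dist_norm)
      then show "dist (\<iota> (G w)) (\<iota> (G v)) < e" using \<open>e > 0\<close> by (simp add: dist_norm)
    qed (use r \<delta> in auto)
  qed
  \<comment> \<open>The equation expresses \<open>L (G v)\<close> through \<open>v\<close> and
    \<open>\<iota> (G v)\<close>. So continuity of \<open>G\<close> in the sup norm already implies
    continuity in the norm of the domain, through \<open>norm_le\<close>.\<close>
  have "continuous_on (target f) (\<lambda>v. v - j (nem f (\<iota> (G v))))"
    by (intro continuous_intros bounded_linear.continuous_on[OF j] iG
        continuous_on_compose2[OF continuous_on_nem[OF cont] iG]) auto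
  moreover have "v - j (nem f (\<iota> (G v))) = L (G v)" if "v \<in> target f" for v
    using FG[OF that] by (simp add: F_def algebra_simps)
  ultimately have LG: "continuous_on (target f) (\<lambda>v. L (G v))" by simp
  have "continuous_on (target f) G"
    unfolding continuous_on_def
  proof
    fix v assume v: "v \<in> target f"
    have t: "((\<lambda>w. norm (\<iota> (G w) - \<iota> (G v)) + norm (L (G w) - L (G v))) \<longlongrightarrow>
        norm (\<iota> (G v) - \<iota> (G v)) + norm (L (G v) - L (G v))) (at v within target f)"
      using iG LG v unfolding continuous_on_def by (intro tendsto_intros) auto
    have "((\<lambda>w. G w - G v) \<longlongrightarrow> 0) (at v within target f)"
    proof (rule Lim_null_comparison[OF always_eventually])
      show "\<forall>w. norm (G w - G v) \<le> norm (\<iota> (G w) - \<iota> (G v)) + norm (L (G w) - L (G v))"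
        using norm_le by (metis L \<iota> bounded_linear.linear linear_diff)
    qed (use t in simp)
    then show "(G \<longlongrightarrow> G v) (at v within target f)" by (rule LIM_zero_cancel)
  qed
  then have "homeomorphism UNIV (target f) (F f) G"
    unfolding homeomorphism_def using GF FG range continuous_on_F[OF cont]
    by (auto simp: image_iff) (metis GF F_in_target[OF f])
  then show thesis by (rule that)
qed

end

section \<open>Smoothness of the inverse\<close>

lemma smooth_family_1I:
  assumes "open S" "smooth_family n S W" "(1, f) \<in> W"
  shows "smooth_family n S {(1, f)}"
  by (rule smooth_family_subset[OF assms(1,2)]) (use assms(3) in simp)

lemma smooth_family_1_const: "smooth_family n S {(1, \<lambda>_. c)}"
  using smooth_family_const[of "{(1, c)}" "norm c" n S] by simp

lemma smooth_family_1_add: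
  assumes "open S" "smooth_family n S {(1, f)}" "smooth_family n S {(1, g)}"
  shows "smooth_family n S {(1, \<lambda>x. f x + g x)}"
  by (rule smooth_family_1I[OF assms(1) smooth_family_add[OF assms]]) auto

lemma smooth_family_1_linear:
  assumes "open S" "bounded_linear T" "smooth_family n S {(1, f)}"
  shows "smooth_family n S {(1, \<lambda>x. T (f x))}"
  by (rule smooth_family_1I[OF assms(1) smooth_family_linear[OF assms]]) auto

lemma smooth_family_range_linear:
  assumes "open S" "bounded_linear T" "smooth_family n S (range (\<lambda>h. (norm h, g h)))"
  shows "smooth_family n S (range (\<lambda>h. (norm h, \<lambda>x. T (g h x))))"
  by (rule smooth_family_subset[OF assms(1) smooth_family_linear[OF assms]]) blast

lemma smooth_family_range_id:
  fixes S :: "'a::real_normed_vector set"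
  shows "smooth_family n S (range (\<lambda>h :: 'b::real_normed_vector. (norm h, \<lambda>_. h)))"
proof -
  have "smooth_family n S {(r, \<lambda>_. c) | r c. (r, c) \<in> range (\<lambda>h :: 'b. (norm h, h))}"
    by (rule smooth_family_const[of _ 1]) auto
  moreover have "{(r, \<lambda>_ :: 'a. c) | r c. (r, c) \<in> range (\<lambda>h :: 'b. (norm h, h))}
      = range (\<lambda>h. (norm h, \<lambda>_. h))"
    by auto
  ultimately show ?thesis by simp
qed

lemma smooth_family_range_bilinear:
  fixes prod :: "'b::real_normed_vector \<Rightarrow> 'c::real_normed_vector \<Rightarrow> 'd::real_normed_vector"
  assumes "open S" "bounded_bilinear prod" "smooth_family n S {(1, f)}"
    "smooth_family n S (range (\<lambda>h. (norm h, g h)))"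
  shows "smooth_family n S (range (\<lambda>h. (norm h, \<lambda>x. prod (f x) (g h x))))"
proof (rule smooth_family_subset[OF assms(1) smooth_family_bilinear[OF assms]], rule subsetI)
  fix p assume "p \<in> range (\<lambda>h. (norm h, \<lambda>x. prod (f x) (g h x)))"
  then obtain h where "p = (norm h, \<lambda>x. prod (f x) (g h x))" by blast
  then show "p \<in> family_prod prod {(1, f)} (range (\<lambda>h. (norm h, g h)))"
    by (intro CollectI exI[of _ 1] exI[of _ f] exI[of _ "norm h"] exI[of _ "g h"]) simp
qed

lemma smooth_family_apply:
  fixes prod :: "'b::real_normed_vector \<Rightarrow> 'c::real_normed_vector \<Rightarrow> 'd::real_normed_vector"
  assumes "open S" "bounded_bilinear prod" "smooth_family n S {(1, f)}"
  shows "smooth_family n S (range (\<lambda>h. (norm h, \<lambda>x. prod (f x) h)))"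
  using smooth_family_range_bilinear[OF assms smooth_family_range_id] .

section \<open>Differentiating the inverse of an operator\<close>

text \<open>Where \<open>g\<close> vanishes, continuity of \<open>f\<close> suffices for the product
  to be differentiable, as the change of \<open>f\<close> is multiplied by something of first order.
  It serves for a factor whose differentiability is still to be shown.\<close>

lemma has_derivative_bilinear_vanishing:
  fixes prod :: "'b::real_normed_vector \<Rightarrow> 'c::real_normed_vector \<Rightarrow> 'd::real_normed_vector"
  assumes "bounded_bilinear prod" "continuous (at y) f" "(g has_derivative g') (at y)" "g y = 0"
  shows "((\<lambda>z. prod (f z) (g z)) has_derivative (\<lambda>h. prod (f y) (g' h))) (at y)"
proof -
  interpret bounded_bilinear prod by (rule assms(1))
  have 1: "((\<lambda>z. prod (f y) (g z)) has_derivative (\<lambda>h. prod (f y) (g' h))) (at y)"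
    by (rule bounded_linear.has_derivative[OF bounded_linear_right assms(3)])
  have 2: "((\<lambda>z. prod (f z - f y) (g z)) has_derivative (\<lambda>h. 0)) (at y)"
    unfolding has_derivative_at_alt
  proof (intro conjI allI impI)
    show "bounded_linear (\<lambda>h. 0)" by simp
    fix e :: real assume e: "e > 0"
    obtain K where K: "K > 0" "\<And>a b. norm (prod a b) \<le> norm a * norm b * K"
      using pos_bounded by blast
    obtain C where C: "C > 0" "\<And>h. norm (g' h) \<le> norm h * C"
      using bounded_linear.pos_bounded[OF has_derivative_bounded_linear[OF assms(3)]] by blast
    obtain d1 where d1: "d1 > 0"
        "\<And>z. norm (z - y) < d1 \<Longrightarrow> norm (g z - g y - g' (z - y)) \<le> 1 * norm (z - y)"
      using assms(3) unfolding has_derivative_at_alt by (meson zero_less_one)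
    define e' where "e' = e / (K * (C + 1))"
    have e': "e' > 0" using e K C by (simp add: e'_def)
    obtain d2 where d2: "d2 > 0" "\<And>z. dist z y < d2 \<Longrightarrow> dist (f z) (f y) < e'"
      using assms(2) e' unfolding continuous_at_eps_delta by blast
    show "\<exists>d>0. \<forall>z. norm (z - y) < d \<longrightarrow>
        norm (prod (f z - f y) (g z) - prod (f y - f y) (g y) - 0) \<le> e * norm (z - y)"
    proof (intro exI[of _ "min d1 d2"] conjI allI impI)
      fix z assume z: "norm (z - y) < min d1 d2"
      have "norm (g z) = norm (g z - g y - g' (z - y) + g' (z - y))" using assms(4) by simp
      also have "\<dots> \<le> 1 * norm (z - y) + norm (z - y) * C"
        using z d1(2)[of z] C(2)[of "z - y"] by (intro norm_triangle_mono) auto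
      finally have "norm (g z) \<le> (C + 1) * norm (z - y)" by (simp add: algebra_simps)
      then have "norm (f z - f y) * norm (g z) * K \<le> e' * ((C + 1) * norm (z - y)) * K"
        using z d2(2)[of z] K e' by (intro mult_right_mono mult_mono) (auto simp: dist_norm)
      also have "\<dots> = (e' * (K * (C + 1))) * norm (z - y)" by (simp only: mult_ac)
      also have "e' * (K * (C + 1)) = e" using K(1) C(1) by (simp add: e'_def)
      finally show "norm (prod (f z - f y) (g z) - prod (f y - f y) (g y) - 0) \<le> e * norm (z - y)"
        using K(2)[of "f z - f y" "g z"] by (simp add: zero_left)
    qed (use d1 d2 in auto)
  qed
  show ?thesis using has_derivative_add[OF 1 2] by (simp add: diff_left)
qed

lemma blinfun_compose_assoc:
  fixes a :: "'c::real_normed_vector \<Rightarrow>\<^sub>L 'd::real_normed_vector"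
    and b :: "'b::real_normed_vector \<Rightarrow>\<^sub>L 'c" and d :: "'a::real_normed_vector \<Rightarrow>\<^sub>L 'b"
  shows "a o\<^sub>L b o\<^sub>L d = a o\<^sub>L (b o\<^sub>L d)"
  by (rule blinfun_eqI) simp

lemma blinfun_compose_id: "id_blinfun o\<^sub>L a = a" "a o\<^sub>L id_blinfun = a"
  by (rule blinfun_eqI, simp)+

text \<open>The resolvent identity \<open>res\<close> takes the place of the Neumann series. It
  gives continuity of \<open>A\<close> first; then, because \<open>B z - B y\<close> vanishes at
  \<open>y\<close>, it gives the derivative.\<close>

lemma blinfun_inverse_has_derivative:
  fixes A :: "'y::real_normed_vector \<Rightarrow> 'b::real_normed_vector \<Rightarrow>\<^sub>L 'a::real_normed_vector"
  assumes T: "open T" "y \<in> T"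
    and AB: "\<And>z. z \<in> T \<Longrightarrow> A z o\<^sub>L B z = id_blinfun" "\<And>z. z \<in> T \<Longrightarrow> B z o\<^sub>L A z = id_blinfun"
    and B: "(B has_derivative B') (at y)"
  shows "(A has_derivative (\<lambda>h. - (A y o\<^sub>L B' h o\<^sub>L A y))) (at y)"
proof -
  interpret c: bounded_bilinear "(o\<^sub>L)" by (rule bounded_bilinear_blinfun_compose)
  note assoc = blinfun_compose_assoc and id = blinfun_compose_id
  have res: "A z = A y - (A z o\<^sub>L (B z - B y) o\<^sub>L A y)" if "z \<in> T" for z
  proof -
    have "(A z o\<^sub>L (B z - B y) o\<^sub>L A y) = ((A z o\<^sub>L B z) o\<^sub>L A y) - (A z o\<^sub>L (B y o\<^sub>L A y))"
      by (simp add: c.diff_left c.diff_right assoc)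
    then show ?thesis using AB[OF that] AB[OF T(2)] by (simp add: id)
  qed
  have inT: "\<forall>\<^sub>F z in at y. z \<in> T" using T by (auto simp: eventually_at_topological)
  have Bc: "(B \<longlongrightarrow> B y) (at y)"
    using has_derivative_continuous[OF B] by (simp add: continuous_within)
  have "isCont A y"
    unfolding isCont_def
  proof (rule LIM_zero_cancel, rule Lim_null_comparison)
    have "((\<lambda>z. norm (B z - B y) * norm (A y)) \<longlongrightarrow> norm (B y - B y) * norm (A y)) (at y)"
      by (intro tendsto_intros Bc)
    \<comment> \<open>With a factor below 1/2, the term of \<open>res\<close> that contains
      \<open>A z\<close> is absorbed by the left hand side, leaving
      \<open>norm (A z) \<le> 2 * norm (A y)\<close>.\<close>
    then have "\<forall>\<^sub>F z in at y. norm (B z - B y) * norm (A y) < 1 / 2"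
      by (rule order_tendstoD) simp
    with inT show "\<forall>\<^sub>F z in at y. norm (A z - A y) \<le> 2 * norm (A y) * norm (B z - B y) * norm (A y)"
    proof eventually_elim
      case (elim z)
      have *: "norm (A z o\<^sub>L (B z - B y) o\<^sub>L A y) \<le> norm (A z) * (norm (B z - B y) * norm (A y))"
        using order_trans[OF norm_blinfun_compose mult_left_mono[OF norm_blinfun_compose norm_ge_zero],
            of "A z" "B z - B y" "A y"]
        by (simp add: assoc)
      have "norm (A z) \<le> norm (A y) + norm (A z o\<^sub>L (B z - B y) o\<^sub>L A y)"
        using res[OF elim(1)] norm_triangle_ineq4 by metis
      also have "\<dots> \<le> norm (A y) + norm (A z) * (1 / 2)"
        using * mult_left_mono[OF less_imp_le[OF elim(2)], of "norm (A z)"] by simp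
      finally have Az: "norm (A z) \<le> 2 * norm (A y)" by simp
      have "A z - A y = - (A z o\<^sub>L (B z - B y) o\<^sub>L A y)" using res[OF elim(1)]
        by (metis add_diff_cancel_left' diff_conv_add_uminus)
      then have "norm (A z - A y) \<le> norm (A z) * (norm (B z - B y) * norm (A y))" using * by simp
      also have "\<dots> \<le> (2 * norm (A y)) * (norm (B z - B y) * norm (A y))"
        using Az by (intro mult_right_mono) auto
      finally show ?case by (simp add: mult_ac)
    qed
    show "((\<lambda>z. 2 * norm (A y) * norm (B z - B y) * norm (A y)) \<longlongrightarrow> 0) (at y)"
      using tendsto_mult_left_zero[OF tendsto_mult_right_zero[OF tendsto_norm_zero[OF LIM_zero[OF Bc]]]]
      by blast
  qed
  moreover have "((\<lambda>z. (B z - B y) o\<^sub>L A y) has_derivative (\<lambda>h. B' h o\<^sub>L A y)) (at y)"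
    by (rule bounded_linear.has_derivative[OF c.bounded_linear_left])
       (use has_derivative_diff[OF B has_derivative_const[of "B y"]] in simp)
  ultimately have "((\<lambda>z. A z o\<^sub>L ((B z - B y) o\<^sub>L A y))
      has_derivative (\<lambda>h. A y o\<^sub>L (B' h o\<^sub>L A y))) (at y)"
    by (intro has_derivative_bilinear_vanishing[OF bounded_bilinear_blinfun_compose])
        (auto simp: c.zero_left)
  from has_derivative_diff[OF has_derivative_const[of "A y"] this]
  have "((\<lambda>z. A y - (A z o\<^sub>L ((B z - B y) o\<^sub>L A y)))
      has_derivative (\<lambda>h. - (A y o\<^sub>L B' h o\<^sub>L A y))) (at y)"
    by (simp add: assoc)
  then show ?thesis
    by (rule has_derivative_transform_within_open[OF _ T]) (use res in \<open>simp add: assoc\<close>)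
qed

lemma linear_continuous_imp_bounded_linear:
  assumes "linear A" "continuous_on UNIV A"
  shows "bounded_linear A"
proof -
  have "continuous (at 0) A" using assms(2) by (simp add: continuous_on_eq_continuous_at)
  then obtain d where d: "d > 0" "\<And>v. norm v < d \<Longrightarrow> norm (A v) < 1"
    unfolding continuous_at_eps_delta linear_0[OF assms(1)]
      by (metis dist_0_norm dist_commute zero_less_one)
  have "norm (A v) \<le> norm v * (2 / d)" for v
  proof (cases "v = 0")
    case False
    define k where "k = d / (2 * norm v)"
    have k: "k > 0" "k * norm v < d" using False d by (auto simp: k_def)
    then have "k * norm (A v) < 1"
      using d(2)[of "k *\<^sub>R v"] by (simp add: linear_cmul[OF assms(1)])
    then show ?thesis using False d k by (simp add: k_def field_simps)
  qed (simp add: linear_0[OF assms(1)])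
  with assms(1) show ?thesis unfolding bounded_linear_def bounded_linear_axioms_def by blast
qed

section \<open>Linearization and smoothness of the inverse\<close>

context circle_pair
begin

lemma bounded_bilinear_j_mult: "bounded_bilinear (\<lambda>c h. j (c0_mult c (\<iota> h)))"
proof -
  have "bounded_bilinear (\<lambda>c h. c0_mult c (\<iota> h))"
    using bounded_bilinear.comp[OF bounded_bilinear_c0_mult bounded_linear_ident \<iota>] .
  then interpret m: bounded_bilinear "\<lambda>c h. c0_mult c (\<iota> h)" .
  interpret j: bounded_linear j by (rule j)
  obtain K where K: "K > 0" "\<And>c h. norm (c0_mult c (\<iota> h)) \<le> norm c * norm h * K"
    using m.pos_bounded by blast
  obtain J where J: "J > 0" "\<And>c. norm (j c) \<le> norm c * J"
    using j.pos_bounded by blast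
  show ?thesis
  proof (unfold_locales)
    show "\<exists>K. \<forall>c h. norm (j (c0_mult c (\<iota> h))) \<le> norm c * norm h * K"
      using order_trans[OF J(2) mult_right_mono[OF K(2)]] J(1)
      by (intro exI[of _ "K * J"]) (auto simp: mult_ac)
  qed (simp_all add: m.add_left m.add_right m.scaleR_left m.scaleR_right j.add j.scaleR)
qed

text \<open>For the field \<open>a t * x\<close> the mean of the slice at \<open>N\<close> is
  \<open>N\<close> times the positive mean of \<open>a\<close>, so every right hand side is
  bracketed and \<open>F_homeomorphism\<close> applies with target \<open>UNIV\<close>. The inverse
  is linear with the operator, and bounded since it is continuous.\<close>

lemma linearized_inverse:
  fixes a :: c0
  assumes a: "\<And>t. 0 < a t"
  obtains A where "bounded_linear A" "\<And>u. A (L u + j (c0_mult a (\<iota> u))) = u"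
    "\<And>v. L (A v) + j (c0_mult a (\<iota> (A v))) = v"
proof -
  define g where "g = (\<lambda>(t, x). a t * x)"
  have g_apply: "g (t, x) = a t * x" for t x by (simp add: g_def)
  have cont: "continuous_on UNIV g"
    unfolding g_def case_prod_beta
    by (intro continuous_intros continuous_on_compose2[OF continuous_on_apply_bcontfun[of UNIV]]) auto
  have g: "increasing_field g"
    unfolding increasing_field_def
  proof (intro conjI allI cont)
    show "strict_mono (\<lambda>x. g (t, x))" for t using a by (auto simp: strict_mono_def g_def)
    show "\<exists>l. \<forall>t x y. \<bar>x\<bar> \<le> R \<longrightarrow> \<bar>y\<bar> \<le> R \<longrightarrow> \<bar>g (t, x) - g (t, y)\<bar> \<le> l * \<bar>x - y\<bar>" for R
      by (intro exI[of _ "norm a"])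
         (auto simp: g_def abs_mult c0_abs_le_norm mult_right_mono simp flip: right_diff_distrib)
  qed
  have nem: "nem g c = c0_mult a c" for c
    by (rule bcontfun_eqI) (simp add: nem_apply[OF cont] g_apply)
  have nem_const: "slice g N = N *\<^sub>R a" for N
    by (rule bcontfun_eqI) (simp add: nem_apply[OF cont] g_apply)
  have "P (j 0) 1 < P (j a) 1" using a by (intro mean_less) simp
  then have m: "0 < P (j a) 1"
    by (simp add: linear_0[OF bounded_linear.linear[OF j]] linear_0[OF bounded_linear.linear[OF P]])
  have "v \<in> target g" for v
  proof -
    define N where "N = (\<bar>P v 1\<bar> + 1) / P (j a) 1"
    have "N \<ge> 0" "mean g (- N) < P v 1"
      "P v 1 < mean g N"
      unfolding nem_const j_scaleR P_scaleR using m
      by (auto simp: N_def)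
    then show ?thesis unfolding target_def by blast
  qed
  then have UN: "target g = UNIV" by blast
  obtain A where A: "homeomorphism UNIV UNIV (F g) A" using F_homeomorphism[OF g] UN by metis
  have Fg: "F g u = L u + j (c0_mult a (\<iota> u))" for u by (simp add: F_def nem)
  interpret b: bounded_bilinear "\<lambda>c h. j (c0_mult c (\<iota> h))" by (rule bounded_bilinear_j_mult)
  have lin: "linear (F g)"
    unfolding Fg[abs_def] by (intro linear_compose_add bounded_linear.linear L b.bounded_linear_right)
  have AF: "A (F g u) = u" "F g (A v) = v" for u v using A by (auto simp: homeomorphism_def)
  have "linear A"
  proof (rule linearI)
    show "A (v + w) = A v + A w" for v w
      by (metis AF linear_add[OF lin])
    show "A (r *\<^sub>R v) = r *\<^sub>R A v" for r v
      by (metis AF linear_cmul[OF lin])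
  qed
  then have "bounded_linear A"
    using A by (intro linear_continuous_imp_bounded_linear) (auto simp: homeomorphism_def)
  then show thesis using AF by (intro that[of A]) (auto simp: Fg)
qed

text \<open>\<open>fs m\<close> stands for the \<open>m\<close>-th derivative of \<open>f\<close> in
  the second variable. The operators \<open>p m\<close> built from them are closed under
  differentiation: the derivative of \<open>p m\<close> is multiplication by
  \<open>p (Suc m)\<close>. The \<open>p m\<close> are therefore treated for all \<open>m\<close> at
  once.\<close>

theorem F_diffeomorphism:
  fixes fs :: "nat \<Rightarrow> circle \<times> real \<Rightarrow> real"
  assumes cont: "\<And>m. continuous_on UNIV (fs m)"
    and der: "\<And>m t x. ((\<lambda>y. fs m (t, y)) has_real_derivative fs (Suc m) (t, x)) (at x)"
    and pos: "\<And>t x. fs 1 (t, x) > 0" and inc: "increasing_field (fs 0)"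
  obtains G where "diffeomorphism UNIV (target (fs 0)) (F (fs 0)) G"
proof -
  let ?T = "target (fs 0)"
  define p where "p = (\<lambda>m u. nem (fs m) (\<iota> u))"
  interpret b: bounded_bilinear "\<lambda>c h. j (c0_mult c (\<iota> h))" by (rule bounded_bilinear_j_mult)
  have bil: "bounded_bilinear (\<lambda>c h. c0_mult c (\<iota> h))"
    using bounded_bilinear.comp[OF bounded_bilinear_c0_mult bounded_linear_ident \<iota>] .
  \<comment> \<open>Multiplication by a coefficient as an operator that depends linearly and
    boundedly on the coefficient; \<open>DF\<close> is thereby an affine image of
    \<open>p 1\<close>.\<close>
  define M where "M = b.prod_right"
  have M: "bounded_linear M" and M_apply: "blinfun_apply (M c) h = j (c0_mult c (\<iota> h))" for c h
    unfolding M_def by (auto simp: b.bounded_linear_prod_right)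
  define DF where "DF = (\<lambda>u. Blinfun L + M (p 1 u))"
  have DF_apply: "blinfun_apply (DF u) h = L h + j (c0_mult (p 1 u) (\<iota> h))" for u h
    by (simp add: DF_def M_apply blinfun.add_left bounded_linear_Blinfun_apply[OF L])
  have p_der: "(p m has_derivative (\<lambda>h. c0_mult (p (Suc m) u) (\<iota> h))) (at u)" for m u
    unfolding p_def
    by (rule has_derivative_compose[OF bounded_linear_imp_has_derivative[OF \<iota>]
          nem_has_derivative[OF cont cont der]])
  have F_der: "(F (fs 0) has_derivative blinfun_apply (DF u)) (at u)" for u
    unfolding F_def DF_apply[abs_def]
    using has_derivative_add[OF bounded_linear_imp_has_derivative[OF L]
        bounded_linear.has_derivative[OF j p_der[of 0 u]]] by (simp add: p_def)
  have sp: "smooth_family n UNIV {(1, p m)}" for n m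
  proof (induction n arbitrary: m)
    case (Suc n)
    show ?case
      by (rule smooth_family_SucI[OF p_der]) (rule smooth_family_apply[OF open_UNIV bil Suc])
  qed (rule smooth_family_zero)
  have sDF: "smooth_family n UNIV {(1, DF)}" for n
    unfolding DF_def
    by (rule smooth_family_1_add[OF open_UNIV smooth_family_1_const
          smooth_family_1_linear[OF open_UNIV M sp]])
  have "smooth_family n UNIV {(1, F (fs 0))}" for n
  proof (cases n)
    case (Suc n')
    show ?thesis
      unfolding Suc by (rule smooth_family_SucI[OF F_der])
        (rule smooth_family_apply[OF open_UNIV bounded_bilinear_blinfun_apply sDF])
  qed (simp add: smooth_family_zero del: smooth_family.simps)
  then have smooth_F: "smooth_on UNIV (F (fs 0))" by (intro smooth_onI) auto
  obtain G where G: "homeomorphism UNIV ?T (F (fs 0)) G" using F_homeomorphism[OF inc] by blast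
  have GF: "G (F (fs 0) u) = u" and FG: "y \<in> ?T \<Longrightarrow> F (fs 0) (G y) = y" for u y
    using G by (auto simp: homeomorphism_def)
  have "\<exists>A. A o\<^sub>L DF u = id_blinfun \<and> DF u o\<^sub>L A = id_blinfun" for u
  proof -
    have "0 < p 1 u t" for t unfolding p_def nem_apply[OF cont] by (rule pos)
    then obtain A where A: "bounded_linear A" "\<And>h. A (L h + j (c0_mult (p 1 u) (\<iota> h))) = h"
      "\<And>v. L (A v) + j (c0_mult (p 1 u) (\<iota> (A v))) = v"
      using linearized_inverse[of "p 1 u"] by metis
    show ?thesis
      by (intro exI[of _ "Blinfun A"] conjI blinfun_eqI)
         (simp_all add: bounded_linear_Blinfun_apply[OF A(1)] DF_apply A del: One_nat_def)
  qed
  then obtain I where I: "\<And>u. I u o\<^sub>L DF u = id_blinfun" "\<And>u. DF u o\<^sub>L I u = id_blinfun" by metis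
  define A where "A = (\<lambda>y. I (G y))"
  have G_der: "(G has_derivative blinfun_apply (A y)) (at y)" if y: "y \<in> ?T" for y
  proof (rule has_derivative_inverse_basic[OF F_der blinfun.bounded_linear_right _ _ open_target y FG])
    show "blinfun_apply (A y) \<circ> blinfun_apply (DF (G y)) = id"
    proof
      fix h
      have "blinfun_apply (A y o\<^sub>L DF (G y)) h = h" unfolding A_def I by simp
      then show "(blinfun_apply (A y) \<circ> blinfun_apply (DF (G y))) h = id h" by simp
    qed
    have "continuous_on ?T G" using G by (simp add: homeomorphism_def)
    then show "continuous (at y) G"
      using y open_target by (simp add: continuous_on_eq_continuous_at)
  qed
  have pG_der: "((\<lambda>y. p m (G y)) has_derivative
      (\<lambda>h. c0_mult (p (Suc m) (G y)) (\<iota> (blinfun_apply (A y) h)))) (at y)" if y: "y \<in> ?T" for m y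
    using has_derivative_compose[OF G_der[OF y] p_der] .
  have "((\<lambda>y. DF (G y)) has_derivative
      (\<lambda>h. M (c0_mult (p 2 (G y)) (\<iota> (blinfun_apply (A y) h))))) (at y)" if y: "y \<in> ?T" for y
    using has_derivative_add[OF has_derivative_const[of "Blinfun L"]
        bounded_linear.has_derivative[OF M pG_der[OF y, of 1]]]
    unfolding DF_def by (simp add: numeral_2_eq_2)
  then have A_der: "(A has_derivative (\<lambda>h. - (A y o\<^sub>L M (c0_mult (p 2 (G y)) (\<iota> (blinfun_apply (A y) h)))
      o\<^sub>L A y))) (at y)" if y: "y \<in> ?T" for y
    using y by (intro blinfun_inverse_has_derivative[OF open_target y, of A "\<lambda>y. DF (G y)"])
      (auto simp: A_def I)
  note T = open_target[of "fs 0"]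
  \<comment> \<open>\<open>A\<close> is the derivative of \<open>G\<close>. The derivatives of
    \<open>p m\<close> after \<open>G\<close> and of \<open>A\<close> are multilinear expressions in
    functions of the same two kinds, so one order of smoothness of all of them together yields the
    next.\<close>
  have sA: "(\<forall>m. smooth_family n ?T {(1, \<lambda>y. p m (G y))}) \<and> smooth_family n ?T {(1, A)}" for n
  proof (induction n)
    case (Suc n)
    have ap: "bounded_bilinear (\<lambda>(B :: 'b \<Rightarrow>\<^sub>L 'a) h. \<iota> (blinfun_apply B h))"
    proof -
      interpret i: bounded_linear \<iota> by (rule \<iota>)
      obtain K where K: "\<And>u. norm (\<iota> u) \<le> norm u * K" "K > 0" using i.pos_bounded by blast
      show ?thesis
      proof unfold_locales
        have "norm (\<iota> (blinfun_apply B h)) \<le> norm B * norm h * K" for B :: "'b \<Rightarrow>\<^sub>L 'a" and h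
          using order_trans[OF K(1) mult_right_mono[OF norm_blinfun]] K(2) by simp
        then show "\<exists>K. \<forall>(B :: 'b \<Rightarrow>\<^sub>L 'a) h. norm (\<iota> (blinfun_apply B h)) \<le> norm B * norm h * K"
          by blast
      qed (simp_all add: blinfun.bilinear_simps i.add i.scaleR)
    qed
    have w: "smooth_family n ?T (range (\<lambda>h. (norm h, \<lambda>y. \<iota> (blinfun_apply (A y) h))))"
      by (rule smooth_family_apply[OF T ap]) (use Suc in simp)
    have pw: "smooth_family n ?T
        (range (\<lambda>h. (norm h, \<lambda>y. c0_mult (p m (G y)) (\<iota> (blinfun_apply (A y) h)))))" for m
      by (rule smooth_family_range_bilinear[OF T bounded_bilinear_c0_mult _ w]) (use Suc in simp)
    have 1: "smooth_family (Suc n) ?T {(1, \<lambda>y. p m (G y))}" for m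
      by (rule smooth_family_SucI[OF pG_der pw])
    have c: "bounded_bilinear (\<lambda>(X :: 'b \<Rightarrow>\<^sub>L 'a) (Y :: 'b \<Rightarrow>\<^sub>L 'b). X o\<^sub>L Y)"
      and c': "bounded_bilinear (\<lambda>(X :: 'b \<Rightarrow>\<^sub>L 'a) (Y :: 'a \<Rightarrow>\<^sub>L 'b). Y o\<^sub>L X)"
      by (rule bounded_bilinear_blinfun_compose)
         (rule bounded_bilinear.flip[OF bounded_bilinear_blinfun_compose])
    have "smooth_family n ?T (range (\<lambda>h. (norm h, \<lambda>y. A y o\<^sub>L
        (M (c0_mult (p 2 (G y)) (\<iota> (blinfun_apply (A y) h))) o\<^sub>L A y))))"
      using Suc by (intro smooth_family_range_bilinear[OF T c] smooth_family_range_bilinear[OF T c']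
          smooth_family_range_linear[OF T M] pw) auto
    then have "smooth_family n ?T (range (\<lambda>h. (norm h, \<lambda>y. - (A y o\<^sub>L
        (M (c0_mult (p 2 (G y)) (\<iota> (blinfun_apply (A y) h))) o\<^sub>L A y)))))"
      by (rule smooth_family_range_linear[OF T bounded_linear_minus[OF bounded_linear_ident]])
    then have "smooth_family (Suc n) ?T {(1, A)}"
      by (intro smooth_family_SucI[OF A_der]) (simp_all only: blinfun_compose_assoc)
    with 1 show ?case by blast
  qed (simp add: smooth_family_zero del: smooth_family.simps)
  have "smooth_family n ?T {(1, G)}" for n
  proof (cases n)
    case (Suc n')
    show ?thesis
      unfolding Suc by (rule smooth_family_SucI[OF G_der])
        (use sA smooth_family_apply[OF T bounded_bilinear_blinfun_apply] in auto)
  qed (simp add: smooth_family_zero del: smooth_family.simps)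
  then have "smooth_on ?T G" by (intro smooth_onI T) auto
  then have "diffeomorphism UNIV ?T (F (fs 0)) G"
    using G smooth_F by (auto simp: diffeomorphism_def homeomorphism_def)
  then show thesis by (rule that)
qed

end

section \<open>The pair of \<open>C\<^sup>1\<close> and \<open>C\<^sup>0\<close>\<close>

interpretation C: circle_pair deriv_c1 c0_of_c1 "\<lambda>c. c" prim_C
proof
  show "deriv_c1 (u + w) = deriv_c1 u + deriv_c1 w" "deriv_c1 (r *\<^sub>R u) = r *\<^sub>R deriv_c1 u" for u w r
    by (simp_all add: deriv_c1_add deriv_c1_scaleR)
  show "\<exists>K. \<forall>u. norm (deriv_c1 u) \<le> norm u * K"
    by (intro exI[of _ 1]) (simp add: norm_c1_def)
  show "c0_of_c1 (u + w) = c0_of_c1 u + c0_of_c1 w" "c0_of_c1 (r *\<^sub>R u) = r *\<^sub>R c0_of_c1 u" for u w r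
    by (simp_all add: plus_c1.rep_eq scaleR_c1.rep_eq)
  show "\<exists>K. \<forall>u. norm (c0_of_c1 u) \<le> norm u * K"
    by (intro exI[of _ 1]) (simp add: norm_c1_def)
  show "\<exists>K. \<forall>c :: c0. norm c \<le> norm c * K" by (intro exI[of _ 1]) simp
  show "prim_C (v + w) t = prim_C v t + prim_C w t" for v w t
    unfolding prim_C_def by (simp add: Henstock_Kurzweil_Integration.integral_add c0_lift_integrable)
  show "prim_C (r *\<^sub>R v) t = r *\<^sub>R prim_C v t" for r v t
    unfolding prim_C_def by simp
  have "\<bar>prim_C v t\<bar> \<le> norm v * \<bar>t\<bar>" for v t
  proof (cases "0 \<le> t")
    case True
    then show ?thesis using prim_C_diff[of 0 t v] by (simp add: prim_C_def)
  next
    case False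
    then have "prim_C v t = 0" by (simp add: prim_C_def)
    then show ?thesis by (simp del: abs_of_neg)
  qed
  then show "\<exists>K. \<forall>v. norm (prim_C v t) \<le> norm v * K" for t by auto
  show "prim_C v 0 = 0" for v by (simp add: prim_C_def)
  show "\<bar>prim_C v t - prim_C v s\<bar> \<le> norm v" if "0 \<le> s" "s \<le> t" "t \<le> 1" for v s t
    using prim_C_diff[OF that(1,2), of v] mult_left_mono[of "t - s" 1 "norm v"] that by simp
  show "(prim_C c has_real_derivative c (circle_of t)) (at t within {0..1})" if "t \<in> {0..1}" for c t
    by (rule prim_C_has_derivative[OF that])
  then show "continuous_on {0..1} (prim_C v)" for v
    using DERIV_continuous by (fastforce simp: continuous_on_eq_continuous_within)
  show "prim_C (deriv_c1 u) t = c0_of_c1 u (circle_of t) - c0_of_c1 u (circle_of 0)"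
    if "t \<in> {0..1}" for u t
    unfolding prim_C_def using that deriv_c1[of u]
    by (intro integral_unique fundamental_theorem_of_calculus)
       (auto simp: has_real_derivative_iff_has_vector_derivative[symmetric] has_circle_derivative_def
         intro: has_field_derivative_at_within)
  show "\<exists>u. c0_of_c1 u = c \<and> deriv_c1 u = v"
    if "\<And>t. t \<in> {0..1} \<Longrightarrow> prim_C v t = c (circle_of t) - c (circle_of 0)" for v c :: c0
  proof -
    have d: "has_circle_derivative c v" by (rule has_circle_derivative_prim[OF that])
    then have "c0_of_c1 (c1_of_c0 c) = c" by (intro c1_of_c0_inverse) auto
    then show ?thesis using d deriv_c1_unique by metis
  qed
  show "u = u'" if "c0_of_c1 u = c0_of_c1 u'" for u u' using that c0_of_c1_inject by blast
  show "norm u \<le> norm (c0_of_c1 u) + norm (deriv_c1 u)" for u by (simp add: norm_c1_def)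
qed auto

lemma F_C_eq: "F_C f = C.F f"
  by (simp add: fun_eq_iff F_C_def C.F_def nem_def)

section \<open>Integration over the circle\<close>

lemma circle_integral:
  fixes h :: "circle \<Rightarrow> real"
  assumes "h \<in> borel_measurable borel"
  shows "(\<integral>t. h t \<partial>circle_measure) = (LINT s:{0..<1}|lborel. h (circle_of s))"
proof -
  have "(\<integral>t. h t \<partial>circle_measure) = (\<integral>s. h (circle_of s) \<partial>restrict_space lborel {0..<1})"
    unfolding circle_measure_def by (rule integral_distr) (use assms in auto)
  also have "\<dots> = (LINT s:{0..<1}|lborel. h (circle_of s))"
    unfolding set_lebesgue_integral_def by (rule integral_restrict_space) auto
  finally show ?thesis .
qed

text \<open>The representative in \<open>[0, 1)\<close>, a Borel section of
  \<open>circle_of\<close>; the values of \<open>rep_circle\<close> are determined only up to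
  integers.\<close>

definition coord :: "circle \<Rightarrow> real" where "coord x = frac (rep_circle x)"

lemma coord_circle_of [simp]: "coord (circle_of s) = frac s"
  unfolding coord_def by (rule periodic_rep_circle[of frac]) (simp add: frac_def)

lemma circle_of_coord [simp]: "circle_of (coord x) = x"
  by (simp add: coord_def)

lemma coord_bounds: "0 \<le> coord x" "coord x < 1" by (simp_all add: coord_def frac_lt_1)

text \<open>\<open>coord\<close> jumps at \<open>circle_of 0\<close>; its sublevel sets between 0
  and 1 are the union of an open arc and that closed point.\<close>

lemma borel_measurable_coord [measurable]: "coord \<in> borel_measurable borel"
proof (rule borel_measurableI_less)
  fix a :: real
  have Z: "closed {circle_of 0}"
  proof -
    have "circle_of -` (- {circle_of 0}) = - \<int>"
      by (auto simp: circle_of_eq_iff)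
    then show ?thesis
      using closed_Ints[where 'a = real] by (simp add: closed_def open_circle_def)
  qed
  consider "a \<le> 0" | "0 < a" "a < 1" | "1 \<le> a" by linarith
  then show "{w \<in> space borel. coord w < a} \<in> sets borel"
  proof cases
    case 1
    then have "{w \<in> space borel. coord w < a} = {}" using coord_bounds(1)
      by (auto simp: not_less intro: order_trans)
    then show ?thesis by simp
  next
    case 2
    have "{w \<in> space borel. coord w < a} = circle_of ` {0<..<a} \<union> {circle_of 0}"
    proof (intro set_eqI iffI)
      fix w assume "w \<in> {w \<in> space borel. coord w < a}"
      then show "w \<in> circle_of ` {0<..<a} \<union> {circle_of 0}"
        using coord_bounds(1)[of w] circle_of_coord[of w]
        by (cases "coord w = 0") (auto intro!: image_eqI[of w circle_of "coord w"])
    next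
      fix w assume "w \<in> circle_of ` {0<..<a} \<union> {circle_of 0}"
      then show "w \<in> {w \<in> space borel. coord w < a}"
        using 2 by (auto simp: frac_eq[THEN iffD2])
    qed
    then show ?thesis
      using borel_open[OF open_circle_of_image[of "{0<..<a}"]] borel_closed[OF Z]
        by (simp only: sets.Un open_greaterThanLessThan)
  next
    case 3
    then have "{w \<in> space borel. coord w < a} = UNIV" using coord_bounds(2)
      by (auto intro: less_le_trans)
    then show ?thesis by simp
  qed
qed

lemma c0_measurable: "apply_bcontfun (c :: c0) \<in> borel_measurable borel"
  by (intro borel_measurable_continuous_onI) simp

text \<open>The two inclusions leave open which endpoints belong to the arc, and these form a null
  set. Initial arcs, final arcs and the full circle are thereby treated alike.\<close>

lemma circle_integral_arc:
  fixes c :: c0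
  assumes J: "J \<in> sets borel" "{a<..<b} \<subseteq> J \<inter> {0..<1}" "J \<inter> {0..<1} \<subseteq> {a..b}"
  shows "(\<integral>x. c x * indicator J (coord x) \<partial>circle_measure) = integral {a..b} (\<lambda>s. c (circle_of s))"
proof -
  note [measurable] = c0_measurable[of c] J(1)
  have cm [measurable]: "(\<lambda>s. c (circle_of s)) \<in> borel_measurable borel"
    by (intro borel_measurable_continuous_onI continuous_on_c0_lift)
  have "(\<integral>x. c x * indicator J (coord x) \<partial>circle_measure)
      = (LINT s:{0..<1}|lborel. c (circle_of s) * indicator J (coord (circle_of s)))"
    by (rule circle_integral) measurable
  also have "\<dots> = (LINT s:{a..b}|lborel. c (circle_of s))"
    unfolding set_lebesgue_integral_def
  proof (rule integral_cong_AE)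
    have "AE s in lborel. s \<noteq> a \<and> s \<noteq> b"
      using AE_lborel_singleton[of a] AE_lborel_singleton[of b] by eventually_elim simp
    then show "AE s in lborel. indicat_real {0..<1} s *\<^sub>R
        (c (circle_of s) * indicator J (coord (circle_of s)))
        = indicat_real {a..b} s *\<^sub>R c (circle_of s)"
    proof eventually_elim
      case (elim s)
      then have "s \<in> {a..b} \<longleftrightarrow> s \<in> {a<..<b}" by auto
      then have "s \<in> {0..<1} \<and> s \<in> J \<longleftrightarrow> s \<in> {a..b}" using J(2,3) by blast
      moreover have "s \<in> {0..<1} \<Longrightarrow> frac s = s" by (simp add: frac_eq)
      ultimately show ?case by (auto simp: indicator_def)
    qed
  next
    show "(\<lambda>s. indicat_real {0..<1} s *\<^sub>R (c (circle_of s) * indicator J (coord (circle_of s))))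
        \<in> borel_measurable lborel"
      "(\<lambda>s. indicat_real {a..b} s *\<^sub>R c (circle_of s)) \<in> borel_measurable lborel"
      unfolding measurable_lborel1 by measurable
  qed
  also have "\<dots> = integral {a..b} (\<lambda>s. c (circle_of s))"
    by (intro set_borel_integral_eq_integral borel_integrable_atLeastAtMost' continuous_on_c0_lift)
  finally show ?thesis .
qed

lemma circle_integral_c0:
  fixes c :: c0
  shows "(\<integral>x. c x \<partial>circle_measure) = integral {0..1} (\<lambda>s. c (circle_of s))"
proof -
  have "{0<..<1} \<subseteq> UNIV \<inter> {0..<1::real}" "UNIV \<inter> {0..<1::real} \<subseteq> {0..1}" by auto
  from circle_integral_arc[OF _ this, of c] show ?thesis by simp
qed

section \<open>The pair of \<open>H\<^sup>1\<close> and \<open>L\<^sup>2\<close>\<close>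

lemma integral_mult_cong_AE:
  fixes p q w :: "circle \<Rightarrow> real"
  assumes [measurable]: "p \<in> borel_measurable circle_measure" "q \<in> borel_measurable circle_measure"
    "w \<in> borel_measurable circle_measure"
    and "AE x in circle_measure. p x = q x"
  shows "(\<integral>x. p x * w x \<partial>circle_measure) = (\<integral>x. q x * w x \<partial>circle_measure)"
  by (rule integral_cong_AE; (measurable)?) (use assms(4) in \<open>eventually_elim, simp\<close>)

lemma inner_abs_l2:
  assumes "p \<in> square_integrable"
  shows "inner v (abs_l2 p) = (\<integral>x. rep_l2 v x * p x \<partial>circle_measure)"
  using integral_mult_cong_AE[OF _ _ _ rep_abs_l2[OF assms], of "rep_l2 v"]
    square_integrable_measurable[OF assms] by (simp add: inner_l2_def mult.commute)

lemma inner_abs_abs_l2: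
  assumes "p \<in> square_integrable" "q \<in> square_integrable"
  shows "inner (abs_l2 p) (abs_l2 q) = (\<integral>x. p x * q x \<partial>circle_measure)"
  unfolding inner_abs_l2[OF assms(2)]
  by (intro integral_mult_cong_AE rep_abs_l2 square_integrable_measurable assms rep_l2)

definition arc_ind :: "real \<Rightarrow> circle \<Rightarrow> real" where
  "arc_ind t x = indicator {..<t} (coord x)"

lemma borel_measurable_arc_ind [measurable]: "arc_ind t \<in> borel_measurable borel"
  unfolding arc_ind_def by measurable

lemma arc_ind_square_integrable: "arc_ind t \<in> square_integrable"
proof -
  have "integrable circle_measure (\<lambda>x. (arc_ind t x)\<^sup>2)"
    by (rule circle_measure.integrable_const_bound[of _ 1]) (auto simp: arc_ind_def indicator_def)
  then show ?thesis by (simp add: square_integrable_def)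
qed

lemma c0_square_integrable: "apply_bcontfun (c :: c0) \<in> square_integrable"
  by (rule continuous_square_integrable) simp

lemma integral_arc:
  fixes c :: c0
  assumes "t \<in> {0..1}"
  shows "(\<integral>x. c x * arc_ind t x \<partial>circle_measure) = prim_C c t"
proof -
  have "{0<..<t} \<subseteq> {..<t} \<inter> {0..<1}" "{..<t} \<inter> {0..<1} \<subseteq> {0..t}" using assms by auto
  from circle_integral_arc[OF _ this, of c] show ?thesis by (simp add: arc_ind_def prim_C_def)
qed

lemma integral_arc_arc:
  assumes "0 \<le> s" "s \<le> t" "t \<le> 1"
  shows "(\<integral>x. arc_ind s x * arc_ind t x \<partial>circle_measure) = s"
proof -
  have "(\<integral>x. arc_ind s x * arc_ind t x \<partial>circle_measure)
      = (\<integral>x. const_bcontfun 1 x * arc_ind s x \<partial>circle_measure)"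
    using assms by (intro Bochner_Integration.integral_cong) (auto simp: arc_ind_def indicator_def)
  also have "\<dots> = s" using assms by (subst integral_arc) (auto simp: prim_C_def)
  finally show ?thesis .
qed

text \<open>Written as an inner product, the primitive is linear in \<open>v\<close> by
  construction, and Cauchy-Schwarz controls it in both arguments.\<close>

definition prim_H :: "l2 \<Rightarrow> real \<Rightarrow> real" where
  "prim_H v t = inner v (abs_l2 (arc_ind t))"

lemma prim_H_eq: "prim_H v t = (\<integral>x. rep_l2 v x * arc_ind t x \<partial>circle_measure)"
  unfolding prim_H_def by (rule inner_abs_l2) (rule arc_ind_square_integrable)

lemma prim_H_0: "prim_H v 0 = 0"
proof -
  have "arc_ind 0 = (\<lambda>_. 0)" using coord_bounds(1) by (simp add: arc_ind_def fun_eq_iff not_less)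
  then show ?thesis unfolding prim_H_eq by simp
qed

text \<open>The indicators of two nested initial arcs differ by a function of L^2 norm
  \<open>sqrt (t - s)\<close>; Cauchy-Schwarz gives the Hoelder bound.\<close>

lemma prim_H_diff:
  assumes "0 \<le> s" "s \<le> t" "t \<le> 1"
  shows "\<bar>prim_H v t - prim_H v s\<bar> \<le> norm v * sqrt (t - s)"
proof -
  have "(norm (abs_l2 (arc_ind t) - abs_l2 (arc_ind s)))\<^sup>2 = t - s"
    using assms integral_arc_arc[of t t] integral_arc_arc[of s s] integral_arc_arc[of s t]
    by (simp add: power2_norm_eq_inner inner_diff inner_abs_abs_l2 arc_ind_square_integrable
        mult.commute)
  then have "norm (abs_l2 (arc_ind t) - abs_l2 (arc_ind s)) = sqrt (t - s)"
    by (metis norm_ge_zero real_sqrt_unique)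
  then show ?thesis
    using Cauchy_Schwarz_ineq2[of v "abs_l2 (arc_ind t) - abs_l2 (arc_ind s)"]
    by (simp add: prim_H_def inner_diff_right)
qed

lemma prim_H_continuous: "continuous_on {0..1} (prim_H v)"
proof -
  have "(prim_H v \<longlongrightarrow> prim_H v s) (at s within {0..1})" if s: "s \<in> {0..1}" for s
  proof (rule LIM_zero_cancel, rule Lim_null_comparison)
    have "norm (prim_H v t - prim_H v s) \<le> norm v * sqrt \<bar>t - s\<bar>" if "t \<in> {0..1}" for t
      using prim_H_diff[of s t v] prim_H_diff[of t s v] s that
      by (cases "s \<le> t") (auto simp: abs_minus_commute)
    then show "\<forall>\<^sub>F t in at s within {0..1}. norm (prim_H v t - prim_H v s) \<le> norm v * sqrt \<bar>t - s\<bar>"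
      unfolding eventually_at_filter by (intro always_eventually) auto
    have "((\<lambda>t. norm v * sqrt \<bar>t - s\<bar>) \<longlongrightarrow> norm v * sqrt \<bar>s - s\<bar>) (at s within {0..1})"
      by (intro tendsto_intros)
    then show "((\<lambda>t. norm v * sqrt \<bar>t - s\<bar>) \<longlongrightarrow> 0) (at s within {0..1})" by simp
  qed
  then show ?thesis unfolding continuous_on_def by blast
qed

definition l2_of_c0 :: "c0 \<Rightarrow> l2" where "l2_of_c0 c = abs_l2 (apply_bcontfun c)"

lemma rep_l2_of_c0: "AE x in circle_measure. rep_l2 (l2_of_c0 c) x = c x"
  unfolding l2_of_c0_def by (rule rep_abs_l2) (rule c0_square_integrable)

lemma integral_l2_of_c0:
  assumes "p \<in> borel_measurable borel"
  shows "(\<integral>x. rep_l2 (l2_of_c0 c) x * p x \<partial>circle_measure) = (\<integral>x. c x * p x \<partial>circle_measure)"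
  using integral_mult_cong_AE[OF _ _ _ rep_l2_of_c0[of c], of p] assms c0_measurable[of c] by simp

lemma prim_H_l2_of_c0: "t \<in> {0..1} \<Longrightarrow> prim_H (l2_of_c0 c) t = prim_C c t"
  unfolding prim_H_eq by (simp add: integral_l2_of_c0 integral_arc)

lemma prim_H_has_derivative:
  assumes "t \<in> {0..1}"
  shows "(prim_H (l2_of_c0 c) has_real_derivative c (circle_of t)) (at t within {0..1})"
  by (rule has_field_derivative_transform_within[OF prim_C_has_derivative[OF assms], of 1])
     (use assms prim_H_l2_of_c0 in auto)

lemma norm_l2_of_c0: "norm (l2_of_c0 c) \<le> norm c"
proof -
  have "(norm (l2_of_c0 c))\<^sup>2 = (\<integral>x. c0_mult c c x \<partial>circle_measure)"
    unfolding power2_norm_eq_inner l2_of_c0_def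
    by (simp add: inner_abs_abs_l2 c0_square_integrable)
  also have "\<dots> = prim_C (c0_mult c c) 1 - prim_C (c0_mult c c) 0"
    unfolding circle_integral_c0 by (simp add: prim_C_def)
  also have "\<dots> \<le> norm (c0_mult c c)" using prim_C_diff[of 0 1 "c0_mult c c"] by simp
  also have "\<dots> \<le> (norm c)\<^sup>2"
    by (rule norm_bound)
       (simp only: c0_mult_apply real_norm_def abs_mult power2_eq_square, intro mult_mono
           c0_abs_le_norm, auto)
  finally show ?thesis by (rule power2_le_imp_le) simp
qed

lemma bounded_linear_l2_of_c0: "bounded_linear l2_of_c0"
proof (rule bounded_linear_intro[of _ 1])
  fix c d :: c0 and r :: real
  show "l2_of_c0 (c + d) = l2_of_c0 c + l2_of_c0 d"
    by (rule l2_eqI) (use rep_l2_of_c0[of "c + d"] rep_l2_of_c0[of c] rep_l2_of_c0[of d]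
      rep_l2_plus[of "l2_of_c0 c" "l2_of_c0 d"] in \<open>eventually_elim, simp\<close>)
  show "l2_of_c0 (r *\<^sub>R c) = r *\<^sub>R l2_of_c0 c"
    by (rule l2_eqI) (use rep_l2_of_c0[of "r *\<^sub>R c"] rep_l2_of_c0[of c]
      rep_l2_scaleR[of r "l2_of_c0 c"] in \<open>eventually_elim, simp\<close>)
  show "norm (l2_of_c0 c) \<le> norm c * 1" using norm_l2_of_c0[of c] by simp
qed

text \<open>The primitive of \<open>c - d\<close> vanishes, so \<open>c - d\<close> is a derivative
  of the zero function; derivatives are unique.\<close>

lemma inj_l2_of_c0:
  assumes "l2_of_c0 c = l2_of_c0 d"
  shows "c = d"
proof -
  have "prim_C (c - d) t = 0" if "t \<in> {0..1}" for t
    using assms that prim_H_l2_of_c0[of t c] prim_H_l2_of_c0[of t d] C.P_minus[of c d t] by simp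
  then have "has_circle_derivative (0 :: c0) (c - d)" by (intro has_circle_derivative_prim) simp
  moreover have "has_circle_derivative (0 :: c0) (0 :: c0)" by (simp add: has_circle_derivative_def)
  ultimately have "apply_bcontfun (c - d) = apply_bcontfun 0" by (rule has_circle_derivative_unique)
  then have "c - d = 0" by (simp only: apply_bcontfun_inject)
  then show ?thesis by simp
qed

lemma integral_rep_l2_1: "prim_H v 1 = (\<integral>x. rep_l2 v x \<partial>circle_measure)"
  unfolding prim_H_eq using coord_bounds(2) by (simp add: arc_ind_def indicator_def)

section \<open>Weak derivatives and primitives\<close>

lemma smooth_on_real_derivatives:
  fixes q :: "real \<Rightarrow> real"
  assumes "smooth_on UNIV q"
  obtains p where "p 0 = q" "\<And>(k :: nat) x. (p k has_real_derivative p (Suc k) x) (at x)"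
proof -
  have step: "\<exists>g'. smooth_on UNIV g' \<and> (\<forall>x. (g has_real_derivative g' x) (at x))"
    if g: "smooth_on UNIV g" for g :: "real \<Rightarrow> real"
  proof -
    obtain f' where f': "\<forall>x\<in>UNIV. (g has_derivative f' x) (at x)" "\<forall>v. smooth_on UNIV (\<lambda>x. f' x v)"
      using smooth_on_has_derivative[OF g] by (elim exE conjE)
    have "(g has_real_derivative f' x 1) (at x)" for x
    proof -
      have "(g has_derivative f' x) (at x)" using f'(1) by simp
      moreover have "f' x = (*) (f' x 1)"
      proof
        fix h
        have "f' x (h *\<^sub>R 1) = h *\<^sub>R f' x 1"
          by (rule linear_cmul[OF has_derivative_linear[of g _ "at x"]]) (use f'(1) in simp)
        then show "f' x h = f' x 1 * h" by (simp add: mult.commute)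
      qed
      ultimately show ?thesis by (simp add: has_field_derivative_def)
    qed
    then show ?thesis using f'(2) by blast
  qed
  then obtain D where D: "\<And>g. smooth_on UNIV g \<Longrightarrow> smooth_on UNIV (D g)"
    "\<And>g x. smooth_on UNIV g \<Longrightarrow> (g has_real_derivative D g x) (at x)" by metis
  have s: "smooth_on UNIV ((D ^^ k) q)" for k by (induction k) (auto simp: assms D(1))
  show thesis by (rule that[of "\<lambda>k. (D ^^ k) q"]) (use D(2)[OF s] in auto)
qed

lemma circle_smooth_cases:
  assumes "circle_smooth \<phi>" "has_circle_derivative \<phi> \<phi>'"
  obtains p p' :: c0 where "\<phi> = apply_bcontfun p" "\<phi>' = apply_bcontfun p'"
proof -
  obtain q where q: "q 0 = (\<lambda>s. \<phi> (circle_of s))"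
      "\<And>(k :: nat) x. (q k has_real_derivative q (Suc k) x) (at x)"
    using smooth_on_real_derivatives[OF assms(1)[unfolded circle_smooth_def]] by metis
  have "q 1 s = \<phi>' (circle_of s)" for s
    using DERIV_unique[of "q 0" _ s] q(2)[of 0 s]
        assms(2)[unfolded has_circle_derivative_def, folded q(1)]
    unfolding One_nat_def by blast
  then have q1: "q 1 = (\<lambda>s. \<phi>' (circle_of s))" by (rule ext)
  have "continuous_on UNIV (q k)" for k
    using q(2) DERIV_isCont by (intro continuous_at_imp_continuous_on) blast
  from this[of 0] this[of 1] have "continuous_on UNIV \<phi>" "continuous_on UNIV \<phi>'"
    unfolding circle_of_continuous_iff q(1) q1 .
  then show thesis using that[of "Bcontfun \<phi>" "Bcontfun \<phi>'"] by (simp add: apply_Bcontfun)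
qed

lemma integral_circle_derivative:
  fixes p p' :: c0
  assumes "has_circle_derivative p p'" "0 \<le> a" "a \<le> b"
  shows "integral {a..b} (\<lambda>s. p' (circle_of s)) = p (circle_of b) - p (circle_of a)"
  using assms
  by (intro integral_unique fundamental_theorem_of_calculus)
     (auto simp: has_real_derivative_iff_has_vector_derivative[symmetric] has_circle_derivative_def
       intro: has_field_derivative_at_within)

text \<open>Integration by parts through Fubini: \<open>c x\<close> is a constant plus the integral
  of \<open>v\<close> over the points before \<open>x\<close>, and exchanging the integrals leaves,
  for each \<open>y\<close>, the integral of \<open>p'\<close> from \<open>y\<close> to the end of
  the period.\<close>

lemma weak_derivative_prim:
  fixes c :: c0
  assumes c: "\<And>t. t \<in> {0..1} \<Longrightarrow> prim_H v t = c (circle_of t) - c (circle_of 0)"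
  shows "weak_derivative (l2_of_c0 c) v"
  unfolding weak_derivative_def
proof (intro allI impI; elim conjE)
  fix \<phi> \<phi>' assume \<phi>: "circle_smooth \<phi>" "has_circle_derivative \<phi> \<phi>'"
  obtain p p' :: c0 where p: "\<phi> = apply_bcontfun p" "\<phi>' = apply_bcontfun p'"
    using circle_smooth_cases[OF \<phi>] by metis
  have d: "has_circle_derivative p p'" using \<phi>(2) p by simp
  note [measurable] = c0_measurable
  let ?v = "rep_l2 v"
  have v: "integrable circle_measure ?v" by (intro square_integrable_integrable) simp
  interpret pair_sigma_finite circle_measure circle_measure
    by unfold_locales
  have vm [measurable]: "?v \<in> borel_measurable borel"
    using rep_l2_measurable[of v] by simp
  let ?f = "\<lambda>(y, x). ?v y * (p' x * indicator {coord y<..} (coord x))"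
  have fm: "?f \<in> borel_measurable (circle_measure \<Otimes>\<^sub>M circle_measure)"
  proof -
    have "(\<lambda>(y, x). ?v y * (p' x * (if coord y < coord x then 1 else 0)))
        \<in> borel_measurable (circle_measure \<Otimes>\<^sub>M circle_measure)"
      by measurable
    then show ?thesis by (simp add: indicator_def)
  qed
  have "integrable (circle_measure \<Otimes>\<^sub>M circle_measure) (\<lambda>(y, x). ?v y * p' x)"
  proof (rule Fubini_integrable)
    show "(\<lambda>(y, x). ?v y * p' x) \<in> borel_measurable (circle_measure \<Otimes>\<^sub>M circle_measure)"
      by measurable
    have p': "integrable circle_measure p'"
      by (intro square_integrable_integrable c0_square_integrable)
    show "integrable circle_measure (\<lambda>y. \<integral>x. norm (case (y, x) of (y, x) \<Rightarrow> ?v y * p' x) \<partial>circle_measure)"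
      using v by (simp add: abs_mult)
    show "AE y in circle_measure. integrable circle_measure (\<lambda>x. case (y, x) of (y, x) \<Rightarrow> ?v y * p' x)"
      using p' by simp
  qed
  then have fi: "integrable (circle_measure \<Otimes>\<^sub>M circle_measure) ?f"
    by (rule Bochner_Integration.integrable_bound[OF _ fm])
       (auto simp: abs_mult indicator_def intro!: always_eventually)
  have c_coord: "c x = c (circle_of 0)
      + (\<integral>y. ?v y * indicator {coord y<..} (coord x) \<partial>circle_measure)" for x
  proof -
    have "c x = c (circle_of 0) + prim_H v (coord x)"
      using c[of "coord x"] coord_bounds[of x] by simp
    then show ?thesis unfolding prim_H_eq arc_ind_def by (simp add: indicator_def)
  qed
  have p'0: "(\<integral>x. p' x \<partial>circle_measure) = 0"
    unfolding circle_integral_c0 using integral_circle_derivative[OF d, of 0 1] by simp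
  have inner: "(\<integral>x. p' x * indicator {coord y<..} (coord x) \<partial>circle_measure) = p (circle_of 0)
      - p y" for y
  proof -
    have "{coord y<..<1} \<subseteq> {coord y<..} \<inter> {0..<1}" "{coord y<..} \<inter> {0..<1} \<subseteq> {coord y..1}"
      using coord_bounds[of y] by auto
    from circle_integral_arc[OF _ this, of p'] show ?thesis
      using integral_circle_derivative[OF d, of "coord y" 1] coord_bounds[of y] by simp
  qed
  have "(\<integral>x. rep_l2 (l2_of_c0 c) x * p' x \<partial>circle_measure) = (\<integral>x. c x * p' x \<partial>circle_measure)"
    by (rule integral_l2_of_c0) measurable
  also have "\<dots> = (\<integral>x. c (circle_of 0) * p' x +
      (\<integral>y. ?v y * (p' x * indicator {coord y<..} (coord x)) \<partial>circle_measure) \<partial>circle_measure)"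
  proof (rule Bochner_Integration.integral_cong[OF refl])
    fix x
    have "(\<integral>y. ?v y * (p' x * indicator {coord y<..} (coord x)) \<partial>circle_measure)
        = p' x * (\<integral>y. ?v y * indicator {coord y<..} (coord x) \<partial>circle_measure)"
      by (simp add: mult.left_commute)
    then show "c x * p' x = c (circle_of 0) * p' x +
        (\<integral>y. ?v y * (p' x * indicator {coord y<..} (coord x)) \<partial>circle_measure)"
      by (subst c_coord) (simp add: algebra_simps)
  qed
  also have "\<dots> = (\<integral>x. c (circle_of 0) * p' x \<partial>circle_measure) +
      (\<integral>x. (\<integral>y. ?v y * (p' x * indicator {coord y<..} (coord x)) \<partial>circle_measure) \<partial>circle_measure)"
    using integrable_snd[OF fi] square_integrable_integrable[OF c0_square_integrable[of p']]
    by (intro Bochner_Integration.integral_add) auto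
  also have "(\<integral>x. (\<integral>y. ?v y * (p' x * indicator {coord y<..} (coord x)) \<partial>circle_measure) \<partial>circle_measure)
      = (\<integral>y. (\<integral>x. ?v y * (p' x * indicator {coord y<..} (coord x)) \<partial>circle_measure) \<partial>circle_measure)"
    using Fubini_integral[of "\<lambda>y x. ?v y * (p' x * indicator {coord y<..} (coord x))"] fi by simp
  also have "\<dots> = (\<integral>y. ?v y * p (circle_of 0) - ?v y * p y \<partial>circle_measure)"
    by (simp add: inner right_diff_distrib)
  also have "\<dots> = prim_H v 1 * p (circle_of 0) - (\<integral>y. ?v y * p y \<partial>circle_measure)"
    unfolding integral_rep_l2_1
      using v square_integrable_mult[OF rep_l2[of v] c0_square_integrable[of p]] by simp
  \<comment> \<open>The points 0 and 1 coincide on the circle, so \<open>c\<close> forces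
    \<open>v\<close> to have mean zero and the boundary term drops out.\<close>
  also have "prim_H v 1 = 0" using c[of 1] by simp
  finally show "(\<integral>t. rep_l2 (l2_of_c0 c) t * \<phi>' t \<partial>circle_measure) =
      - (\<integral>t. rep_l2 v t * \<phi> t \<partial>circle_measure)"
    by (simp add: p p'0)
qed


text \<open>Subtracting the mean is exactly what makes the primitive periodic.\<close>

lemma circle_smooth_primitive:
  assumes "circle_smooth \<phi>"
  obtains \<psi> where "circle_smooth \<psi>"
    "has_circle_derivative \<psi> (\<lambda>x. \<phi> x - (\<integral>x. \<phi> x \<partial>circle_measure))"
proof -
  have s: "smooth_on UNIV (\<lambda>s. \<phi> (circle_of s))"
    using assms by (simp add: circle_smooth_def)
  have "continuous_on UNIV \<phi>"
    using smooth_on_imp_continuous_on[OF s] by (simp add: circle_of_continuous_iff)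
  then obtain q :: c0 where q: "\<phi> = apply_bcontfun q" using apply_Bcontfun by metis
  define m where "m = (\<integral>x. \<phi> x \<partial>circle_measure)"
  define d where "d = q - const_bcontfun m"
  have m: "m = prim_C q 1" unfolding m_def q circle_integral_c0 by (simp add: prim_C_def)
  have "prim_C d 0 = prim_C d 1"
    unfolding d_def C.P_minus C.mean_const C.P_0 using m by simp
  then obtain c :: c0 where c: "\<And>t. t \<in> {0..1} \<Longrightarrow> c (circle_of t) = prim_C d t"
    using c0_of_interval[OF C.P_continuous] by metis
  have dc: "has_circle_derivative c d"
    by (rule has_circle_derivative_prim) (use c[of 0] c C.P_0 in simp)
  obtain p where p: "p 0 = (\<lambda>s. \<phi> (circle_of s))"
      "\<And>(k :: nat) x. (p k has_real_derivative p (Suc k) x) (at x)"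
    using smooth_on_real_derivatives[OF s] by metis
  \<comment> \<open>The derivatives of the primitive: itself, then the centred function, then the
    derivatives of \<phi> shifted by one index, where the constant \<open>m\<close> has
    disappeared.\<close>
  define r where "r = (\<lambda>k. case k of 0 \<Rightarrow> (\<lambda>s. c (circle_of s)) | Suc 0 \<Rightarrow> (\<lambda>s. p 0 s
      - m) | Suc (Suc l) \<Rightarrow> p (Suc l))"
  have "(r k has_real_derivative r (Suc k) x) (at x)" for k x
  proof -
    consider "k = 0" | "k = Suc 0" | l where "k = Suc (Suc l)" by (metis not0_implies_Suc)
    then show ?thesis
    proof cases
      case 1
      then show ?thesis using dc by (simp add: r_def has_circle_derivative_def d_def p(1) q)
    next
      case 2
      then show ?thesis using DERIV_diff[OF p(2)[of 0 x] DERIV_const[of m]] by (simp add: r_def)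
    next
      case 3
      then show ?thesis using p(2) by (simp add: r_def)
    qed
  qed
  from smooth_on_real[of r, OF this] have "circle_smooth c" by (simp add: circle_smooth_def r_def)
  moreover have "apply_bcontfun d = (\<lambda>x. \<phi> x - m)" by (simp add: d_def q fun_eq_iff)
  ultimately show thesis using dc unfolding m_def by (intro that[of c]) simp_all
qed

text \<open>Lemma of du Bois-Reymond. Testing against a primitive of the centred \<phi> shows that
  \<open>w\<close> minus its mean is orthogonal to every test function. This says that it is a weak
  derivative of 0, and so it vanishes by \<open>weak_derivative_unique\<close>.\<close>

lemma weak_derivative_zero_imp_const:
  assumes "weak_derivative w 0"
  shows "w = l2_of_c0 (const_bcontfun (prim_H w 1))"
proof -
  let ?k = "prim_H w 1" and ?w = "w - l2_of_c0 (const_bcontfun (prim_H w 1))"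
  have zero: "(\<integral>t. rep_l2 0 t * h t \<partial>circle_measure) = 0" for h
    by (rule integral_eq_zero_AE) (use rep_l2_zero in \<open>eventually_elim, simp\<close>)
  have "weak_derivative 0 ?w"
    unfolding weak_derivative_def zero
  proof (intro allI impI; elim conjE)
    fix \<phi> \<phi>' assume \<phi>: "circle_smooth \<phi>" "has_circle_derivative \<phi> \<phi>'"
    obtain p p' :: c0 where p: "\<phi> = apply_bcontfun p" using circle_smooth_cases[OF \<phi>] by metis
    define m where "m = (\<integral>x. \<phi> x \<partial>circle_measure)"
    obtain \<psi> where \<psi>: "circle_smooth \<psi>" "has_circle_derivative \<psi> (\<lambda>x. \<phi> x - m)"
      using circle_smooth_primitive[OF \<phi>(1)] unfolding m_def by metis
    have si: "\<phi> \<in> square_integrable" unfolding p by (rule c0_square_integrable)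
    have "(\<integral>t. rep_l2 w t * (\<phi> t - m) \<partial>circle_measure) = 0"
      using weak_derivativeD[OF assms \<psi>] zero by simp
    moreover have "(\<integral>t. rep_l2 w t * (\<phi> t - m) \<partial>circle_measure)
        = (\<integral>t. rep_l2 w t * \<phi> t \<partial>circle_measure) - ?k * m"
      unfolding integral_rep_l2_1 right_diff_distrib
      using square_integrable_mult[OF rep_l2[of w] si] square_integrable_integrable[OF rep_l2[of w]]
        by simp
    ultimately have w: "(\<integral>t. rep_l2 w t * \<phi> t \<partial>circle_measure) = ?k * m" by simp
    have "inner (l2_of_c0 (const_bcontfun ?k)) (abs_l2 \<phi>) = ?k * m"
      unfolding l2_of_c0_def inner_abs_abs_l2[OF c0_square_integrable si] m_def by simp
    then have "inner ?w (abs_l2 \<phi>) = 0"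
      using w by (simp add: inner_diff_left inner_abs_l2[OF si, of w])
    then show "0 = - (\<integral>t. rep_l2 ?w t * \<phi> t \<partial>circle_measure)"
      unfolding inner_abs_l2[OF si] by simp
  qed
  moreover have "weak_derivative 0 0" unfolding weak_derivative_def zero by simp
  ultimately have "?w = 0" by (rule weak_derivative_unique)
  then show ?thesis by simp
qed

text \<open>The primitive of \<open>g\<close> is continuous and has the weak derivative
  \<open>g\<close>, so it differs from \<open>u\<close> by a constant; this produces the continuous
  representative of \<open>u\<close>.\<close>

lemma weak_derivative_imp_prim:
  assumes "weak_derivative u g"
  obtains c :: c0 where "l2_of_c0 c = u"
    "\<And>t. t \<in> {0..1} \<Longrightarrow> prim_H g t = c (circle_of t) - c (circle_of 0)"
proof -
  \<comment> \<open>The test function 1 shows that \<open>g\<close> has mean zero, so that its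
    primitive closes up on the circle.\<close>
  have one: "circle_smooth (\<lambda>_. 1)" "has_circle_derivative (\<lambda>_. 1) (\<lambda>_. 0)"
    using smooth_on_real[of "\<lambda>k _. if k = 0 then 1 else 0"]
    by (auto simp: circle_smooth_def has_circle_derivative_def)
  have g1: "prim_H g 1 = 0" unfolding integral_rep_l2_1 using weak_derivativeD[OF assms one] by simp
  note g0 = prim_H_0[of g]
  obtain d :: c0 where d: "\<And>t. t \<in> {0..1} \<Longrightarrow> d (circle_of t) = prim_H g t"
    using c0_of_interval[OF prim_H_continuous, of g] g0 g1 by metis
  have "weak_derivative (l2_of_c0 d) g"
    by (rule weak_derivative_prim) (use d d[of 0] g0 in simp)
  from weak_derivative_add[OF assms weak_derivative_scaleR[OF this, of "-1"]]
  have "weak_derivative (u - l2_of_c0 d) 0" by simp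
  then obtain k where "u - l2_of_c0 d = l2_of_c0 (const_bcontfun k)"
    using weak_derivative_zero_imp_const by blast
  then have "l2_of_c0 (const_bcontfun k + d) = u"
    using linear_add[OF bounded_linear.linear[OF bounded_linear_l2_of_c0]] by (simp add: algebra_simps)
  moreover have "prim_H g t = (const_bcontfun k + d) (circle_of t)
      - (const_bcontfun k + d) (circle_of 0)"
    if "t \<in> {0..1}" for t using d[OF that] d[of 0] g0 by simp
  ultimately show thesis by (rule that)
qed

definition c0_of_h1 :: "h1 \<Rightarrow> c0" where
  "c0_of_h1 u = (THE c. l2_of_c0 c = l2_of_h1 u)"

lemma c0_of_h1_unique: "l2_of_c0 c = l2_of_h1 u \<Longrightarrow> c0_of_h1 u = c"
  unfolding c0_of_h1_def using inj_l2_of_c0 by (intro the_equality) auto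

lemma c0_of_h1:
  shows "l2_of_c0 (c0_of_h1 u) = l2_of_h1 u"
    and "t \<in> {0..1} \<Longrightarrow> prim_H (deriv_h1 u) t = c0_of_h1 u (circle_of t) - c0_of_h1 u (circle_of 0)"
proof -
  obtain c where "l2_of_c0 c = l2_of_h1 u"
    "\<And>t. t \<in> {0..1} \<Longrightarrow> prim_H (deriv_h1 u) t = c (circle_of t) - c (circle_of 0)"
    using weak_derivative_imp_prim[OF deriv_h1] by blast
  then show "l2_of_c0 (c0_of_h1 u) = l2_of_h1 u"
    "t \<in> {0..1} \<Longrightarrow> prim_H (deriv_h1 u) t = c0_of_h1 u (circle_of t) - c0_of_h1 u (circle_of 0)"
    using c0_of_h1_unique by auto
qed

lemma norm_h1_le: "norm (l2_of_h1 u) \<le> norm u" "norm (deriv_h1 u) \<le> norm u"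
  "norm u \<le> norm (l2_of_h1 u) + norm (deriv_h1 u)"
proof -
  have "norm u = sqrt ((norm (l2_of_h1 u))\<^sup>2 + (norm (deriv_h1 u))\<^sup>2)"
    by (simp add: norm_h1_def inner_h1_def power2_norm_eq_inner)
  then show "norm (l2_of_h1 u) \<le> norm u" "norm (deriv_h1 u) \<le> norm u"
    "norm u \<le> norm (l2_of_h1 u) + norm (deriv_h1 u)"
    by (simp_all add: real_le_rsqrt sqrt_sum_squares_le_sum)
qed

text \<open>Sobolev embedding: the oscillation is bounded by the norm of the derivative and the mean
  by the L^2 norm, each at most \<open>norm u\<close>; hence the constant 2.\<close>

lemma norm_c0_of_h1: "norm (c0_of_h1 u) \<le> norm u * 2"
proof -
  let ?c = "c0_of_h1 u"
  have diff: "\<bar>?c (circle_of t) - ?c (circle_of s)\<bar> \<le> norm u" if "0 \<le> s" "s \<le> t" "t \<le> 1" for s t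
  proof -
    have "\<bar>?c (circle_of t) - ?c (circle_of s)\<bar> = \<bar>prim_H (deriv_h1 u) t - prim_H (deriv_h1 u) s\<bar>"
      using c0_of_h1(2)[of t u] c0_of_h1(2)[of s u] that by simp
    also have "\<dots> \<le> norm (deriv_h1 u) * sqrt (t - s)" by (rule prim_H_diff[OF that])
    also have "\<dots> \<le> norm (deriv_h1 u) * 1" using that by (intro mult_left_mono) auto
    finally show ?thesis using norm_h1_le(2)[of u] by simp
  qed
  have diff': "\<bar>?c x - ?c y\<bar> \<le> norm u" for x y
    using diff[of "coord x" "coord y"] diff[of "coord y" "coord x"] coord_bounds[of x] coord_bounds[of y]
    by (cases "coord x \<le> coord y") (auto simp: abs_minus_commute)
  have m: "prim_C ?c 1 = prim_H (l2_of_h1 u) 1"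
    using prim_H_l2_of_c0[of 1 ?c] c0_of_h1(1) by simp
  have "\<bar>prim_H (l2_of_h1 u) 1\<bar> \<le> norm (l2_of_h1 u)"
    using prim_H_diff[of 0 1 "l2_of_h1 u"] by (simp add: prim_H_0)
  then have m': "\<bar>prim_C ?c 1\<bar> \<le> norm u" using m norm_h1_le(1)[of u] by simp
  show ?thesis
  proof (rule norm_bound)
    fix x
    have "?c x - norm u \<le> prim_C ?c 1"
      by (rule C.mean_ge) (use diff' in \<open>simp add: abs_le_iff algebra_simps\<close>)
    moreover have "- ?c x - norm u \<le> prim_C (- ?c) 1"
      by (rule C.mean_ge) (use diff' in \<open>simp add: abs_le_iff algebra_simps\<close>)
    ultimately show "norm (?c x) \<le> norm u * 2" using m' by (simp add: C.P_uminus abs_le_iff)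
  qed
qed

interpretation H: circle_pair deriv_h1 c0_of_h1 l2_of_c0 prim_H
proof
  show "deriv_h1 (u + w) = deriv_h1 u + deriv_h1 w" "deriv_h1 (r *\<^sub>R u) = r *\<^sub>R deriv_h1 u" for u w r
    by (simp_all add: deriv_h1_add deriv_h1_scaleR)
  show "\<exists>K. \<forall>u. norm (deriv_h1 u) \<le> norm u * K"
    using norm_h1_le(2) by (intro exI[of _ 1]) simp
  show "c0_of_h1 (u + w) = c0_of_h1 u + c0_of_h1 w" for u w
    by (rule c0_of_h1_unique)
       (simp add: linear_add[OF bounded_linear.linear[OF bounded_linear_l2_of_c0]] c0_of_h1(1)
           plus_h1.rep_eq)
  show "c0_of_h1 (r *\<^sub>R u) = r *\<^sub>R c0_of_h1 u" for u r
    by (rule c0_of_h1_unique)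
       (simp add: linear_cmul[OF bounded_linear.linear[OF bounded_linear_l2_of_c0]] c0_of_h1(1)
           scaleR_h1.rep_eq)
  show "\<exists>K. \<forall>u. norm (c0_of_h1 u) \<le> norm u * K" using norm_c0_of_h1 by blast
  show "l2_of_c0 (c + d) = l2_of_c0 c + l2_of_c0 d" "l2_of_c0 (r *\<^sub>R c) = r *\<^sub>R l2_of_c0 c"
    "\<exists>K. \<forall>c. norm (l2_of_c0 c) \<le> norm c * K" for c d r
    using bounded_linear_l2_of_c0
      by (auto simp: bounded_linear.bounded bounded_linear.linear linear_add linear_cmul)
  show "prim_H (v + w) t = prim_H v t + prim_H w t" "prim_H (r *\<^sub>R v) t = r *\<^sub>R prim_H v t"
    "\<exists>K. \<forall>v. norm (prim_H v t) \<le> norm v * K" for v w t r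
    unfolding prim_H_def using Cauchy_Schwarz_ineq2 by (auto simp: inner_add_left)
  show "prim_H v 0 = 0" for v by (rule prim_H_0)
  show "\<bar>prim_H v t - prim_H v s\<bar> \<le> norm v" if "0 \<le> s" "s \<le> t" "t \<le> 1" for v s t
    using prim_H_diff[OF that, of v] mult_left_mono[of "sqrt (t - s)" 1 "norm v"] that by simp
  show "continuous_on {0..1} (prim_H v)" for v by (rule prim_H_continuous)
  show "(prim_H (l2_of_c0 c) has_real_derivative c (circle_of t)) (at t within {0..1})"
    if "t \<in> {0..1}" for c t by (rule prim_H_has_derivative[OF that])
  show "prim_H (deriv_h1 u) t = c0_of_h1 u (circle_of t) - c0_of_h1 u (circle_of 0)"
    if "t \<in> {0..1}" for u t by (rule c0_of_h1(2)[OF that])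
  show "\<exists>u. c0_of_h1 u = c \<and> deriv_h1 u = v"
    if "\<And>t. t \<in> {0..1} \<Longrightarrow> prim_H v t = c (circle_of t) - c (circle_of 0)" for v and c :: c0
  proof -
    have w: "weak_derivative (l2_of_c0 c) v" by (rule weak_derivative_prim[OF that])
    then have "l2_of_h1 (h1_of_l2 (l2_of_c0 c)) = l2_of_c0 c" by (intro h1_of_l2_inverse) auto
    then show ?thesis using w c0_of_h1_unique deriv_h1_unique by metis
  qed
  show "u = u'" if "c0_of_h1 u = c0_of_h1 u'" for u u'
    using that c0_of_h1(1) l2_of_h1_inject by metis
  show "norm u \<le> norm (c0_of_h1 u) + norm (deriv_h1 u)" for u
  proof -
    have "norm (l2_of_h1 u) \<le> norm (c0_of_h1 u)"
      using norm_l2_of_c0[of "c0_of_h1 u"] c0_of_h1(1)[of u] by simp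
    then show ?thesis using norm_h1_le(3)[of u] by simp
  qed
qed

lemma F_H_eq:
  assumes f: "continuous_on UNIV f"
  shows "F_H f = H.F f"
proof
  fix u
  have ae: "AE x in circle_measure. rep_l2 (l2_of_h1 u) x = c0_of_h1 u x"
    using rep_l2_of_c0[of "c0_of_h1 u"] unfolding c0_of_h1(1) .
  have "abs_l2 (\<lambda>t. f (t, rep_l2 (l2_of_h1 u) t)) = l2_of_c0 (nem f (c0_of_h1 u))"
    unfolding l2_of_c0_def
  proof (subst abs_l2_eq_iff)
    show ae': "AE x in circle_measure. f (x, rep_l2 (l2_of_h1 u) x) = nem f (c0_of_h1 u) x"
      using ae by eventually_elim (simp add: nem_apply[OF f])
    show n: "apply_bcontfun (nem f (c0_of_h1 u)) \<in> square_integrable" by (rule c0_square_integrable)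
    show "(\<lambda>t. f (t, rep_l2 (l2_of_h1 u) t)) \<in> square_integrable"
    proof -
      \<comment> \<open>Measurability of the composition is checked on the plane, with
        \<open>coord\<close> as the first variable, where the Borel sets of the product are the
        product Borel sets.\<close>
      have "continuous_on UNIV (\<lambda>p. f (circle_of (fst p), snd p))"
        by (intro continuous_on_compose2[OF f] continuous_intros) auto
      then have [measurable]: "(\<lambda>p. f (circle_of (fst p), snd p)) \<in> borel_measurable (borel \<Otimes>\<^sub>M borel)"
        unfolding borel_prod by (rule borel_measurable_continuous_onI)
      have "(\<lambda>t. (\<lambda>p. f (circle_of (fst p), snd p)) (coord t, rep_l2 (l2_of_h1 u) t))
          \<in> borel_measurable circle_measure"
        by measurable
      then have m [measurable]:
          "(\<lambda>t. f (t, rep_l2 (l2_of_h1 u) t)) \<in> borel_measurable circle_measure" by simp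
      have [measurable]: "apply_bcontfun (nem f (c0_of_h1 u)) \<in> borel_measurable circle_measure"
        using c0_measurable by simp
      have "integrable circle_measure (\<lambda>t. (f (t, rep_l2 (l2_of_h1 u) t))\<^sup>2)
          \<longleftrightarrow> integrable circle_measure (\<lambda>t. (nem f (c0_of_h1 u) t)\<^sup>2)"
        by (rule integrable_cong_AE; (measurable)?) (use ae' in \<open>eventually_elim, simp\<close>)
      then show ?thesis using n m by (simp add: square_integrable_def)
    qed
  qed
  then show "F_H f u = H.F f u" by (simp add: F_H_def H.F_def)
qed

section \<open>The strip\<close>

lemma f_plus_tendsto:
  assumes "\<And>x y. x \<le> y \<Longrightarrow> f (t, x) \<le> f (t, y)"
  shows "((\<lambda>x. ereal (f (t, x))) \<longlongrightarrow> f_plus f t) at_top"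
proof -
  let ?s = "SUP n. ereal (f (t, real n))"
  have s: "((\<lambda>x. ereal (f (t, x))) \<longlongrightarrow> ?s) at_top"
  proof (rule order_tendstoI)
    fix a assume "a < ?s"
    then obtain n where n: "a < ereal (f (t, real n))" unfolding less_SUP_iff by blast
    then have "a < ereal (f (t, x))" if "real n \<le> x" for x
      using assms[OF that] by (meson ereal_less_eq(3) less_le_trans)
    then show "\<forall>\<^sub>F x in at_top. a < ereal (f (t, x))" unfolding eventually_at_top_linorder by blast
  next
    fix a assume a: "?s < a"
    have "ereal (f (t, x)) < a" for x
    proof -
      obtain n where "x \<le> real n" using real_arch_simple by blast
      then have "ereal (f (t, x)) \<le> ereal (f (t, real n))" using assms by simp
      also have "\<dots> \<le> ?s" by (rule SUP_upper) simp
      finally show ?thesis using a by (rule le_less_trans)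
    qed
    then show "\<forall>\<^sub>F x in at_top. ereal (f (t, x)) < a" by simp
  qed
  from s have "f_plus f t = ?s" unfolding f_plus_def by (intro tendsto_Lim) auto
  then show ?thesis using s by simp
qed

text \<open>The reflection \<open>- f (t, - x)\<close> preserves monotonicity and exchanges the two
  limits, so only \<open>f_plus\<close> needs a direct treatment.\<close>

lemma f_minus_eq:
  assumes "\<And>x y. x \<le> y \<Longrightarrow> f (t, x) \<le> f (t, y)"
  shows "f_minus f t = - f_plus (\<lambda>(t, x). - f (t, - x)) t"
proof -
  have "((\<lambda>x. ereal (- f (t, - x))) \<longlongrightarrow> f_plus (\<lambda>(t, x). - f (t, - x)) t) at_top"
    using f_plus_tendsto[of "\<lambda>(t, x). - f (t, - x)" t] assms by simp
  from tendsto_uminus_ereal[OF this]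
  have "((\<lambda>x. ereal (f (t, - x))) \<longlongrightarrow> - f_plus (\<lambda>(t, x). - f (t, - x)) t) at_top" by simp
  then have "((\<lambda>x. ereal (f (t, x))) \<longlongrightarrow> - f_plus (\<lambda>(t, x). - f (t, - x)) t) at_bot"
    by (subst filterlim_at_bot_mirror)
  then show ?thesis unfolding f_minus_def by (intro tendsto_Lim) auto
qed

text \<open>The positive parts of the slices increase, so monotone convergence applies even to an
  infinite limit. The negative parts decrease and are dominated by that of \<open>f (t, 0)\<close>;
  their limit is finite, which makes the difference of the two limits meaningful.\<close>

lemma mean_LIMSEQ:
  fixes f :: "circle \<times> real \<Rightarrow> real"
  assumes f: "continuous_on UNIV f" and mono: "\<And>t x y. x \<le> y \<Longrightarrow> f (t, x) \<le> f (t, y)"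
  shows "(\<lambda>n. ereal (\<integral>t. f (t, real n) \<partial>circle_measure)) \<longlonglongrightarrow> circle_ereal_integral (f_plus f)"
    and "(\<integral>\<^sup>+ t. e2ennreal (- f_plus f t) \<partial>circle_measure) \<noteq> \<infinity>"
proof -
  let ?M = circle_measure
  define c where "c = (\<lambda>n. slice f (real n))"
  have c: "apply_bcontfun (c n) = (\<lambda>t. f (t, real n))" for n
    by (simp add: c_def nem_apply[OF f] fun_eq_iff)
  have m [measurable]: "(\<lambda>t. f (t, real n)) \<in> borel_measurable ?M" for n
    using c0_measurable[of "c n"] by (simp add: c)
  have int: "integrable ?M (\<lambda>t. f (t, real n))" for n
    using square_integrable_integrable[OF c0_square_integrable[of "c n"]] by (simp add: c)
  have lim: "(\<lambda>n. ereal (f (t, real n))) \<longlonglongrightarrow> f_plus f t" for t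
    using filterlim_compose[OF f_plus_tendsto filterlim_real_sequentially] mono by metis
  have pm [measurable]: "f_plus f \<in> borel_measurable ?M"
    by (rule borel_measurable_LIMSEQ_order[OF lim]) measurable
  have e2: "(\<lambda>n. e2ennreal (X n)) \<longlonglongrightarrow> e2ennreal x" if "X \<longlonglongrightarrow> x" for X x
    using continuous_at_e2ennreal[of x UNIV] that
      by (metis continuous_within_tendsto_compose' UNIV_I tendsto_compose)
  have pos: "(\<lambda>n. \<integral>\<^sup>+ t. ennreal (f (t, real n)) \<partial>?M) \<longlonglongrightarrow> (\<integral>\<^sup>+ t. e2ennreal (f_plus f t) \<partial>?M)"
  proof (rule nn_integral_LIMSEQ)
    show "incseq (\<lambda>n t. ennreal (f (t, real n)))"
      using mono by (auto simp: incseq_def le_fun_def intro!: ennreal_leI)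
    show "(\<lambda>n. ennreal (f (t, real n))) \<longlonglongrightarrow> e2ennreal (f_plus f t)" for t
      using e2[OF lim[of t]] by simp
  qed measurable
  have fin: "(\<integral>\<^sup>+ t. ennreal (- f (t, 0)) \<partial>?M) < \<infinity>"
    using int[of 0] by (simp add: real_integrable_def less_top[symmetric])
  have neg: "(\<lambda>n. \<integral>\<^sup>+ t. ennreal (- f (t, real n)) \<partial>?M) \<longlonglongrightarrow> (\<integral>\<^sup>+ t. e2ennreal (- f_plus f t) \<partial>?M)"
  proof (rule nn_integral_dominated_convergence[OF _ _ _ _ fin])
    show "AE t in ?M. ennreal (- f (t, real n)) \<le> ennreal (- f (t, 0))" for n
      using mono by (intro AE_I2 ennreal_leI) simp
    show "AE t in ?M. (\<lambda>n. ennreal (- f (t, real n))) \<longlonglongrightarrow> e2ennreal (- f_plus f t)"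
    proof (rule AE_I2)
      fix t
      have "(\<lambda>n. - ereal (f (t, real n))) \<longlonglongrightarrow> - f_plus f t"
        by (intro tendsto_uminus_ereal lim)
      from e2[OF this] show "(\<lambda>n. ennreal (- f (t, real n))) \<longlonglongrightarrow> e2ennreal (- f_plus f t)" by simp
    qed
    show "(\<lambda>t. ennreal (- f (t, 0))) \<in> borel_measurable ?M" using m[of 0] by simp
  qed measurable
  have "(\<integral>\<^sup>+ t. e2ennreal (- f_plus f t) \<partial>?M) \<le> (\<integral>\<^sup>+ t. ennreal (- f (t, 0)) \<partial>?M)"
  proof (rule nn_integral_mono)
    fix t
    have "ereal (f (t, 0)) \<le> f_plus f t"
      by (rule LIMSEQ_le_const[OF lim]) (use mono in auto)
    then have "- f_plus f t \<le> - ereal (f (t, 0))" by (simp only: ereal_minus_le_minus)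
    then have "- f_plus f t \<le> ereal (- f (t, 0))" by simp
    from e2ennreal_mono[OF this] show "e2ennreal (- f_plus f t) \<le> ennreal (- f (t, 0))" by simp
  qed
  then show fin': "(\<integral>\<^sup>+ t. e2ennreal (- f_plus f t) \<partial>?M) \<noteq> \<infinity>" using fin by auto
  have fin'': "enn2ereal (\<integral>\<^sup>+ t. e2ennreal (- f_plus f t) \<partial>?M) \<noteq> \<infinity>"
    "enn2ereal (\<integral>\<^sup>+ t. e2ennreal (- f_plus f t) \<partial>?M) \<noteq> - \<infinity>"
    using fin' enn2ereal_nonneg by (auto simp: enn2ereal_eq_top_iff)
  have "ereal (\<integral>t. f (t, real n) \<partial>?M) = enn2ereal (\<integral>\<^sup>+ t. ennreal (f (t, real n)) \<partial>?M)
      - enn2ereal (\<integral>\<^sup>+ t. ennreal (- f (t, real n)) \<partial>?M)" for n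
  proof -
    have r: "ereal (enn2real a) = enn2ereal a" if "a < \<infinity>" for a
      using that by (cases a) auto
    have "(\<integral>\<^sup>+ t. ennreal (f (t, real n)) \<partial>?M) < \<infinity>" "(\<integral>\<^sup>+ t. ennreal (- f (t, real n)) \<partial>?M) < \<infinity>"
      using int[of n] by (simp_all add: real_integrable_def less_top[symmetric])
    then show ?thesis
      unfolding real_lebesgue_integral_def[OF int] by (simp flip: r ereal_minus(1))
  qed
  then show "(\<lambda>n. ereal (\<integral>t. f (t, real n) \<partial>?M)) \<longlonglongrightarrow> circle_ereal_integral (f_plus f)"
    unfolding circle_ereal_integral_def using fin''
    by (auto intro!: tendsto_diff_ereal_general iffD2[OF tendsto_enn2ereal_iff] pos neg)
qed


lemma mean_eq:
  assumes "continuous_on UNIV f"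
  shows "prim_C (slice f N) 1 = (\<integral>t. f (t, N) \<partial>circle_measure)"
proof -
  have "apply_bcontfun (slice f N) = (\<lambda>t. f (t, N))"
    by (simp add: nem_apply[OF assms] fun_eq_iff)
  then show ?thesis
    using circle_integral_c0[of "slice f N"] by (simp add: prim_C_def)
qed

lemma less_circle_integral_iff:
  fixes f :: "circle \<times> real \<Rightarrow> real"
  assumes f: "continuous_on UNIV f" and sm: "\<forall>t. strict_mono (\<lambda>x. f (t, x))"
  shows "ereal r < circle_ereal_integral (f_plus f) \<longleftrightarrow> (\<exists>n. r < (\<integral>t. f (t, real n) \<partial>circle_measure))"
proof -
  have inc: "f (t, x) < f (t, y)" if "x < y" for t x y
    using sm that by (auto dest: strict_monoD)
  have mono: "f (t, x) \<le> f (t, y)" if "x \<le> y" for t x y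
    using inc[of x y t] that by (cases "x = y") auto
  define m where "m = (\<lambda>n. \<integral>t. f (t, real n) \<partial>circle_measure)"
  have lim: "(\<lambda>n. ereal (m n)) \<longlonglongrightarrow> circle_ereal_integral (f_plus f)"
    unfolding m_def using mean_LIMSEQ(1)[OF f mono] .
  have "m n < m (Suc n)" for n
    unfolding m_def mean_eq[OF f, symmetric] by (rule C.mean_less) (simp add: nem_apply[OF f] inc)
  then have "strict_mono m" by (rule strict_mono_Suc_iff[THEN iffD2, OF allI])
  then have le: "ereal (m n) \<le> circle_ereal_integral (f_plus f)" for n
    by (intro incseq_le[OF _ lim]) (auto simp: incseq_def strict_mono_less_eq)
  show ?thesis
  proof
    assume "ereal r < circle_ereal_integral (f_plus f)"
    then have "\<forall>\<^sub>F n in sequentially. ereal r < ereal (m n)" by (rule order_tendstoD(1)[OF lim])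
    then show "\<exists>n. r < (\<integral>t. f (t, real n) \<partial>circle_measure)"
      by (auto simp: eventually_sequentially m_def)
  next
    assume "\<exists>n. r < (\<integral>t. f (t, real n) \<partial>circle_measure)"
    then obtain n where "ereal r < ereal (m n)" by (auto simp: m_def)
    then show "ereal r < circle_ereal_integral (f_plus f)" using le by (rule less_le_trans)
  qed
qed

lemma circle_integral_less_iff:
  fixes f :: "circle \<times> real \<Rightarrow> real"
  assumes f: "continuous_on UNIV f" and sm: "\<forall>t. strict_mono (\<lambda>x. f (t, x))"
  shows "circle_ereal_integral (f_minus f) < ereal r \<longleftrightarrow> (\<exists>n. (\<integral>t. f (t, - real n) \<partial>circle_measure) < r)"
proof -
  have inc: "f (t, x) < f (t, y)" if "x < y" for t x y
    using sm that by (auto dest: strict_monoD)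
  define g where "g = (\<lambda>(t, x). - f (t, - x))"
  have g: "continuous_on UNIV g"
    unfolding g_def case_prod_beta by (intro continuous_intros continuous_on_compose2[OF f]) auto
  have g_sm: "\<forall>t. strict_mono (\<lambda>x. g (t, x))"
    using inc by (auto simp: g_def strict_mono_def)
  have g_inc: "g (t, x) < g (t, y)" if "x < y" for t x y
    using inc that by (simp add: g_def)
  have mono: "f (t, x) \<le> f (t, y)" "g (t, x) \<le> g (t, y)" if "x \<le> y" for t x y
    using inc[of x y t] g_inc[of x y t] that by (cases "x = y"; auto)+
  have e: "f_minus f = (\<lambda>t. - f_plus g t)"
    using f_minus_eq[of f] mono(1) unfolding g_def by blast
  define a where "a = enn2ereal (\<integral>\<^sup>+ t. e2ennreal (f_plus g t) \<partial>circle_measure)"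
  define b where "b = enn2ereal (\<integral>\<^sup>+ t. e2ennreal (- f_plus g t) \<partial>circle_measure)"
  have "b \<noteq> \<infinity>" "b \<noteq> - \<infinity>"
    using mean_LIMSEQ(2)[OF g mono(2)] unfolding b_def
    using enn2ereal_nonneg by (auto simp: enn2ereal_eq_top_iff)
  \<comment> \<open>In \<open>ereal\<close> this rests on the finiteness of \<open>b\<close>;
    \<open>a\<close> may be infinite.\<close>
  then have "b - a = - (a - b)" by (cases a; cases b) auto
  then have "circle_ereal_integral (f_minus f) = - circle_ereal_integral (f_plus g)"
    unfolding circle_ereal_integral_def e a_def b_def by simp
  then have "circle_ereal_integral (f_minus f) < ereal r \<longleftrightarrow> ereal (- r)
      < circle_ereal_integral (f_plus g)"
    by (simp add: ereal_uminus_less_reorder)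
  then show ?thesis
    unfolding less_circle_integral_iff[OF g g_sm] by (simp add: g_def)
qed

lemma strip_eq:
  fixes f :: "circle \<times> real \<Rightarrow> real"
  assumes f: "continuous_on UNIV f" and sm: "\<forall>t. strict_mono (\<lambda>x. f (t, x))"
  shows "strip f fn = {v. \<exists>N\<ge>0. prim_C (slice f (- N)) 1 < (\<integral>t. fn v t \<partial>circle_measure) \<and>
    (\<integral>t. fn v t \<partial>circle_measure) < prim_C (slice f N) 1}"
proof -
  have inc: "f (t, x) < f (t, y)" if "x < y" for t x y
    using sm that by (auto dest: strict_monoD)
  define m where "m = (\<lambda>N. prim_C (slice f N) 1)"
  have m_apply: "m N = prim_C (slice f N) 1" for N by (simp add: m_def)
  have "m x < m y" if "x < y" for x y
    unfolding m_def by (rule C.mean_less) (simp add: nem_apply[OF f] inc that)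
  then have m: "m x \<le> m y" if "x \<le> y" for x y
    using that by (cases "x = y") (auto intro: less_imp_le)
  \<comment> \<open>The lower and the upper inequality may hold at different indices; since the
    means increase, the larger index serves for both.\<close>
  have e: "(\<exists>n. m (- real n) < r) \<and> (\<exists>n. r < m (real n)) \<longleftrightarrow> (\<exists>N\<ge>0. m (- N) < r \<and> r < m N)" for r
  proof safe
    fix k n :: nat assume "m (- real k) < r" "r < m (real n)"
    then have "m (- real (max k n)) < r" "r < m (real (max k n))"
      using m[of "- real (max k n)" "- real k"] m[of "real n" "real (max k n)"] by auto
    then show "\<exists>N\<ge>0. m (- N) < r \<and> r < m N" by (intro exI[of _ "real (max k n)"]) simp
  next
    fix N assume N: "0 \<le> N" "m (- N) < r" "r < m N"
    obtain n where n: "N \<le> real n" using real_arch_simple by blast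
    show "\<exists>n. m (- real n) < r" using N m[of "- real n" "- N"] n by (intro exI[of _ n]) simp
    show "\<exists>n. r < m (real n)" using N m[of N "real n"] n by (intro exI[of _ n]) simp
  qed
  then show ?thesis
    unfolding strip_def circle_integral_less_iff[OF f sm] less_circle_integral_iff[OF f sm]
      mean_eq[OF f, symmetric] m_apply[symmetric] by (simp only: e)
qed

lemma strip_C_eq:
  assumes "continuous_on UNIV f" "\<forall>t. strict_mono (\<lambda>x. f (t, x))"
  shows "C.target f = strip_C f"
  unfolding strip_C_def strip_eq[OF assms] C.target_def circle_integral_c0 prim_C_def ..

lemma strip_H_eq:
  assumes "continuous_on UNIV f" "\<forall>t. strict_mono (\<lambda>x. f (t, x))"
  shows "H.target f = strip_H f"
  unfolding strip_H_def strip_eq[OF assms] H.target_def integral_rep_l2_1 [symmetric]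
  by (simp add: prim_H_l2_of_c0)

text \<open>Properness makes \<open>f(\<cdot>, N)\<close> and \<open>f(\<cdot>, -N)\<close> uniformly large in absolute value.\<close>

lemma proper_imp_unbounded_means:
  fixes f :: "circle \<times> real \<Rightarrow> real"
  assumes proper: "proper_map euclidean euclidean f"
    and f: "continuous_on UNIV f" and sm: "\<forall>t. strict_mono (\<lambda>x. f (t, x))"
  obtains N where "N \<ge> 0" "prim_C (slice f (- N)) 1 < r"
    "r < prim_C (slice f N) 1"
proof -
  have inc: "f (t, x) < f (t, y)" if "x < y" for t x y
    using sm that by (auto dest: strict_monoD)
  \<comment> \<open>\<open>K\<close> dominates \<open>f (t, 0)\<close> and \<open>r\<close>. By
    properness \<open>f\<close> leaves \<open>[- K, K]\<close> at the levels \<open>N\<close> and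
    \<open>- N\<close>, and comparison with \<open>f (t, 0)\<close> tells on which side.\<close>
  define K where "K = norm (nem f 0) + \<bar>r\<bar> + 1"
  have "compactin euclidean {x \<in> topspace euclidean. f x \<in> {- K..K}}"
    by (rule compactin_proper_map_preimage[OF proper]) simp
  then have "compact {p. f p \<in> {- K..K}}" by simp
  then have "compact (snd ` {p. f p \<in> {- K..K}})"
    by (intro compact_continuous_image continuous_intros)
  then have "bounded (snd ` {p. f p \<in> {- K..K}})" by (rule compact_imp_bounded)
  then obtain B where "\<forall>x\<in>snd ` {p. f p \<in> {- K..K}}. norm x \<le> B" unfolding bounded_iff by (rule exE)
  then have B: "\<And>p. f p \<in> {- K..K} \<Longrightarrow> \<bar>snd p\<bar> \<le> B" by auto
  define N where "N = \<bar>B\<bar> + 1"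
  have out: "f (t, x) \<notin> {- K..K}" if "\<bar>x\<bar> = N" for t x
    using B[of "(t, x)"] that by (auto simp: N_def)
  have "\<bar>f (t, 0)\<bar> \<le> norm (nem f 0)" for t
    using c0_abs_le_norm[of "nem f 0" t] by (simp add: nem_apply[OF f])
  then have f0: "- K \<le> f (t, 0)" "f (t, 0) \<le> K" for t
    unfolding K_def by (smt (verit))+
  have "N > 0" by (simp add: N_def)
  then have "f (t, 0) < f (t, N)" "f (t, - N) < f (t, 0)" for t by (auto intro: inc)
  then have "K < f (t, N)" "f (t, - N) < - K" for t
    using out[of N t] out[of "- N" t] f0[of t] \<open>N > 0\<close> by (smt (verit) atLeastAtMost_iff)+
  then have "prim_C (const_bcontfun K) 1 < prim_C (slice f N) 1"
    "prim_C (slice f (- N)) 1 < prim_C (const_bcontfun (- K)) 1"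
    by (auto intro!: C.mean_less simp: nem_apply[OF f])
  moreover have "r \<le> K" "- K \<le> r" using norm_ge_zero[of "nem f 0"] unfolding K_def by linarith+
  ultimately show thesis
    using \<open>N > 0\<close> unfolding C.mean_const by (intro that[of N]) linarith+
qed

lemma proper_imp_target_UNIV:
  fixes f :: "circle \<times> real \<Rightarrow> real"
  assumes "proper_map euclidean euclidean f" "continuous_on UNIV f" "\<forall>t. strict_mono (\<lambda>x. f (t, x))"
  shows "C.target f = UNIV" "H.target f = UNIV"
proof -
  have "v \<in> C.target f" for v
    using proper_imp_unbounded_means[OF assms, of "prim_C v 1"] unfolding C.target_def by blast
  then show "C.target f = UNIV" by blast
  have "v \<in> H.target f" for v
    using proper_imp_unbounded_means[OF assms, of "prim_H v 1"] unfolding H.target_def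
    by (simp add: prim_H_l2_of_c0) blast
  then show "H.target f = UNIV" by blast
qed

section \<open>Smooth functions on the cylinder\<close>

lemma cylinder_smooth_D2:
  assumes "cylinder_smooth f"
  shows "((\<lambda>y. f (t, y)) has_real_derivative D2 f t x) (at x)"
    and "cylinder_smooth (\<lambda>(t, x). D2 f t x)"
proof -
  let ?F = "\<lambda>(s, x). f (circle_of s, x)"
  obtain f' where "(\<forall>p\<in>UNIV. (?F has_derivative f' p) (at p)) \<and> (\<forall>v. smooth_on UNIV (\<lambda>p. f' p v))"
    using smooth_on_has_derivative[OF assms[unfolded cylinder_smooth_def]] by (rule exE)
  then have f': "\<forall>p. (?F has_derivative f' p) (at p)" "\<forall>v. smooth_on UNIV (\<lambda>p. f' p v)" by simp_all
  have d: "((\<lambda>y. f (circle_of s, y)) has_real_derivative f' (s, x) (0, 1)) (at x)" for s x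
  proof -
    have "(Pair s has_derivative (\<lambda>h. (0, h))) (at x)"
      by (auto intro!: derivative_eq_intros)
    moreover have F': "(?F has_derivative f' (s, x)) (at (s, x))" using f'(1) ..
    ultimately have D: "((\<lambda>y. ?F (s, y)) has_derivative (\<lambda>h. f' (s, x) (0, h))) (at x)"
      by (rule has_derivative_compose)
    have "f' (s, x) (0, h) = f' (s, x) (0, 1) * h" for h
    proof -
      have "f' (s, x) (h *\<^sub>R (0, 1)) = h *\<^sub>R f' (s, x) (0, 1)"
        by (rule linear_cmul[OF has_derivative_linear[OF F']])
      then show ?thesis by (simp add: mult.commute)
    qed
    then have "(\<lambda>h. f' (s, x) (0, h)) = (*) (f' (s, x) (0, 1))" by (rule ext)
    with D show ?thesis unfolding has_field_derivative_def by simp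
  qed
  then have D: "D2 f (circle_of s) x = f' (s, x) (0, 1)" for s x
    unfolding D2_def by (rule DERIV_imp_deriv)
  show "((\<lambda>y. f (t, y)) has_real_derivative D2 f t x) (at x)"
    using d[of "rep_circle t" x] D[of "rep_circle t" x] by simp
  have "(\<lambda>(s, x). case (circle_of s, x) of (t, x) \<Rightarrow> D2 f t x) = (\<lambda>p. f' p (0, 1))"
    by (auto simp: D)
  then show "cylinder_smooth (\<lambda>(t, x). D2 f t x)"
    unfolding cylinder_smooth_def using f'(2) by simp
qed

lemma cylinder_smooth_increasing_field:
  assumes f: "cylinder_smooth f" and inc: "\<And>t. strict_mono (\<lambda>x. f (t, x))"
  shows "increasing_field f"
  unfolding increasing_field_def
proof (intro conjI allI)
  show "continuous_on UNIV f" by (rule cylinder_smooth_imp_continuous_on[OF f])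
  show "strict_mono (\<lambda>x. f (t, x))" for t by (rule inc)
  fix R :: real
  have "compact (range (\<lambda>t :: circle. t) \<times> {- R..R})"
    by (intro compact_Times) (auto simp: compact_circle)
  then have "compact ((\<lambda>(t, x). D2 f t x) ` (UNIV \<times> {- R..R}))"
    using continuous_on_subset[OF cylinder_smooth_imp_continuous_on[OF cylinder_smooth_D2(2)[OF f]]]
    by (intro compact_continuous_image) auto
  then have "bounded ((\<lambda>(t, x). D2 f t x) ` (UNIV \<times> {- R..R}))" by (rule compact_imp_bounded)
  then obtain l where "\<forall>y\<in>(\<lambda>(t, x). D2 f t x) ` (UNIV \<times> {- R..R}). norm y \<le> l"
    unfolding bounded_iff by (rule exE)
  then have l: "\<And>t x. x \<in> {- R..R} \<Longrightarrow> \<bar>D2 f t x\<bar> \<le> l" by force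
  show "\<exists>l. \<forall>t x y. \<bar>x\<bar> \<le> R \<longrightarrow> \<bar>y\<bar> \<le> R \<longrightarrow> \<bar>f (t, x) - f (t, y)\<bar> \<le> l * \<bar>x - y\<bar>"
  proof (intro exI[of _ l] allI impI)
    fix t x y assume xy: "\<bar>x\<bar> \<le> R" "\<bar>y\<bar> \<le> R"
    have "norm (f (t, x) - f (t, y)) \<le> l * norm (x - y)"
      by (rule field_differentiable_bound[where S = "{- R..R}" and f' = "D2 f t"])
         (use xy l in \<open>auto intro!: has_field_derivative_at_within cylinder_smooth_D2(1)[OF f]\<close>)
    then show "\<bar>f (t, x) - f (t, y)\<bar> \<le> l * \<bar>x - y\<bar>" by simp
  qed
qed

theorem proposition4p1:
  fixes f :: "circle \<times> real \<Rightarrow> real"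
  assumes "cylinder_smooth f"
  shows
    "(proper_map euclidean euclidean f \<and> (\<forall>t x. D2 f t x > 0) \<longrightarrow>
        (\<exists>G. diffeomorphism UNIV UNIV (F_C f) G) \<and>
        (\<exists>G. diffeomorphism UNIV UNIV (F_H f) G)) \<and>
     ((\<forall>t x. D2 f t x > 0) \<longrightarrow>
        (\<exists>G. diffeomorphism UNIV (strip_C f) (F_C f) G) \<and>
        (\<exists>G. diffeomorphism UNIV (strip_H f) (F_H f) G)) \<and>
     (proper_map euclidean euclidean f \<and> (\<forall>t. strict_mono (\<lambda>x. f (t, x))) \<longrightarrow>
        (\<exists>G. homeomorphism UNIV UNIV (F_C f) G) \<and>
        (\<exists>G. homeomorphism UNIV UNIV (F_H f) G))"
proof -
  have cont: "continuous_on UNIV f" by (rule cylinder_smooth_imp_continuous_on[OF assms])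
  have inc: "\<forall>t. strict_mono (\<lambda>x. f (t, x))" if "\<forall>t x. D2 f t x > 0"
    using that DERIV_pos_imp_increasing cylinder_smooth_D2(1)[OF assms] by (metis strict_mono_def)
  have diffeo: "(\<exists>G. diffeomorphism UNIV (C.target f) (F_C f) G)
      \<and> (\<exists>G. diffeomorphism UNIV (H.target f) (F_H f) G)"
    if pos: "\<forall>t x. D2 f t x > 0"
  proof -
    \<comment> \<open>The iterated derivatives in the second variable; smoothness on the cylinder
      passes from each to the next.\<close>
    define fs where "fs = (\<lambda>m. ((\<lambda>g (t, x). D2 g t x) ^^ m) f)"
    have smooth: "cylinder_smooth (fs m)" for m
      by (induction m) (auto simp: fs_def assms cylinder_smooth_D2(2))
    have fs: "continuous_on UNIV (fs m)"
        "((\<lambda>y. fs m (t, y)) has_real_derivative fs (Suc m) (t, x)) (at x)" for m t x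
      using cylinder_smooth_imp_continuous_on[OF smooth] cylinder_smooth_D2(1)[OF smooth[of m]]
        by (auto simp: fs_def)
    have "fs 1 (t, x) > 0" for t x using pos by (simp add: fs_def)
    moreover have "fs 0 = f" by (simp add: fs_def)
    moreover have "increasing_field f" using cylinder_smooth_increasing_field[OF assms] inc[OF pos]
      by blast
    ultimately show ?thesis
      using C.F_diffeomorphism[of fs] H.F_diffeomorphism[of fs] fs unfolding F_C_eq F_H_eq[OF cont]
        by metis
  qed
  have homeo: "(\<exists>G. homeomorphism UNIV (C.target f) (F_C f) G)
      \<and> (\<exists>G. homeomorphism UNIV (H.target f) (F_H f) G)"
    if "\<forall>t. strict_mono (\<lambda>x. f (t, x))"
    using C.F_homeomorphism H.F_homeomorphism cylinder_smooth_increasing_field[OF assms] that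
    unfolding F_C_eq F_H_eq[OF cont] by metis
  show ?thesis
  proof (intro conjI impI; (elim conjE)?)
    assume proper: "proper_map euclidean euclidean f" and pos: "\<forall>t x. D2 f t x > 0"
    note U = proper_imp_target_UNIV[OF proper cont inc[OF pos]]
    show "\<exists>G. diffeomorphism UNIV UNIV (F_C f) G" "\<exists>G. diffeomorphism UNIV UNIV (F_H f) G"
      using diffeo[OF pos] unfolding U by auto
  next
    assume pos: "\<forall>t x. D2 f t x > 0"
    note S = strip_C_eq[OF cont inc[OF pos]]
      strip_H_eq[OF cont inc[OF pos]]
    show "\<exists>G. diffeomorphism UNIV (strip_C f) (F_C f) G" "\<exists>G. diffeomorphism UNIV (strip_H f) (F_H f) G"
      using diffeo[OF pos] unfolding S by auto
  next
    assume proper: "proper_map euclidean euclidean f" and mono: "\<forall>t. strict_mono (\<lambda>x. f (t, x))"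
    note U = proper_imp_target_UNIV[OF proper cont mono]
    show "\<exists>G. homeomorphism UNIV UNIV (F_C f) G" "\<exists>G. homeomorphism UNIV UNIV (F_H f) G"
      using homeo[OF mono] unfolding U by auto
  qed
qed

end
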